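(* Let $\mathfrak C=(n,\Lambda,L,P)$ be a stabilizer code, $R=\mathbb Z_n[\Lambda]$, and let $\sigma:F\to P$ be a homomorphism of $R$-modules with $F$ quasi-free and $\mathrm{im}(\sigma)=L$. Let $T$ be the torsion submodule of the cokernel of $\sigma^*:P^*\to F^*$. Then $T\cong Q^0(\mathfrak C)$, where $Q^0(\mathfrak C)=\mathrm{Ext}^1_R(\overline{P/L},R)$.
   Context: Let $n$ be a positive integer, $\mathbb Z_n=\mathbb Z/n\mathbb Z$, $\Lambda$ a finitely generated abelian group, $R=\mathbb Z_n[\Lambda]$, $x^\lambda\in R$ the element corresponding to $\lambda\in\Lambda$. The antipode is $\overline{\sum_\lambda r_\lambda x^\lambda}=\sum_\lambda r_\lambda x^{-\lambda}$; for an $R$-module $M$, $\overline M$ is the same abelian group with $R$-action twisted by the antipode, and $M^*=\mathrm{Hom}_R(\overline M,R)$. An $R$-module is quasi-free if it is isomorphic to $M_0\otimes_{\mathbb Z_n}R$ for some $\mathbb Z_n$-module $M_0$. The torsion submodule of an $R$-module is the set of elements annihilated by some non-zero-divisor of $R$. A stabilizer code $(n,\Lambda,L,P)$ consists of: $P=P_0[\Lambda]=P_0\otimes_{\mathbb Z_n}R$, where $P_0$ is a finitely generated $\mathbb Z_n$-module with an alternating ($\omega_0(a,a)=0$), nondegenerate ($\omega_0(\cdot,a)=0\Rightarrow a=0$) bilinear form $\omega_0:P_0\times P_0\to\mathbb Z_n$, equipped with $\omega:P\times P\to R$, $\omega(a x^\lambda,b x^\mu)=\omega_0(a,b)x^{\mu-\lambda}$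 (extended $\mathbb Z_n$-bilinearly); and an $R$-submodule $L\subset P$ with $\omega|_{L\times L}=0$. *)

theory Defs
  imports "HOL-Algebra.Algebra"
begin

section \<open>Modules\<close>

text \<open>
  Modules are the records of \<^theory>\<open>HOL-Algebra.Module\<close>. That record type extends the ring
  record, but \<^const>\<open>module\<close> does not constrain the multiplication and unit of the second
  argument; those two fields are left unspecified below.
\<close>

definition regular_module :: "'a ring \<Rightarrow> ('a, 'a) module" where
  "regular_module R =
     \<lparr>carrier = carrier R, monoid.mult = monoid.mult R, one = \<one>\<^bsub>R\<^esub>, ring.zero = \<zero>\<^bsub>R\<^esub>, add = add R,
      smult = monoid.mult R\<rparr>"

definition finitely_generated_module :: "'a ring \<Rightarrow> ('a, 'm) module \<Rightarrow> bool" where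
  "finitely_generated_module R M \<longleftrightarrow>
     (\<exists>S. finite S \<and> S \<subseteq> carrier M \<and> (\<forall>N. submodule N R M \<and> S \<subseteq> N \<longrightarrow> N = carrier M))"

definition module_homs :: "'a ring \<Rightarrow> ('a, 'm) module \<Rightarrow> ('a, 'k) module \<Rightarrow> ('m \<Rightarrow> 'k) set" where
  "module_homs R M N =
     {f \<in> carrier M \<rightarrow> carrier N.
        (\<forall>x\<in>carrier M. \<forall>y\<in>carrier M. f (x \<oplus>\<^bsub>M\<^esub> y) = f x \<oplus>\<^bsub>N\<^esub> f y) \<and>
        (\<forall>r\<in>carrier R. \<forall>x\<in>carrier M. f (r \<odot>\<^bsub>M\<^esub> x) = r \<odot>\<^bsub>N\<^esub> f x)}"

definition module_isomorphic :: "'a ring \<Rightarrow> ('a, 'm) module \<Rightarrow> ('a, 'k) module \<Rightarrow> bool" where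
  "module_isomorphic R M N \<longleftrightarrow>
     (\<exists>f\<in>module_homs R M N. bij_betw f (carrier M) (carrier N))"

text \<open>Homomorphisms are taken extensional, so that equal maps on the carrier are equal elements.\<close>

definition Hom_module :: "'a ring \<Rightarrow> ('a, 'm) module \<Rightarrow> ('a, 'k) module \<Rightarrow> ('a, 'm \<Rightarrow> 'k) module" where
  "Hom_module R M N =
     \<lparr>carrier = module_homs R M N \<inter> extensional (carrier M),
      monoid.mult = undefined, one = undefined,
      ring.zero = (\<lambda>x\<in>carrier M. \<zero>\<^bsub>N\<^esub>),
      add = (\<lambda>f g. \<lambda>x\<in>carrier M. f x \<oplus>\<^bsub>N\<^esub> g x),
      smult = (\<lambda>r f. \<lambda>x\<in>carrier M. r \<odot>\<^bsub>N\<^esub> f x)\<rparr>"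

text \<open>
  The quotient by a submodule \<open>H\<close>. All \<open>x\<close> in a coset \<open>C\<close> give the same coset
  \<open>H + r x\<close>, so the union in the scalar multiplication is a single coset.
\<close>

definition quotient_module :: "('a, 'm) module \<Rightarrow> 'm set \<Rightarrow> ('a, 'm set) module" where
  "quotient_module M H =
     \<lparr>carrier = a_rcosets\<^bsub>M\<^esub> H,
      monoid.mult = undefined, one = undefined,
      ring.zero = H,
      add = set_add M,
      smult = (\<lambda>r C. \<Union>x\<in>C. H +>\<^bsub>M\<^esub> (r \<odot>\<^bsub>M\<^esub> x))\<rparr>"

definition non_zero_divisor :: "'a ring \<Rightarrow> 'a \<Rightarrow> bool" where
  "non_zero_divisor R r \<longleftrightarrow>
     r \<in> carrier R \<and> (\<forall>s\<in>carrier R. r \<otimes>\<^bsub>R\<^esub> s = \<zero>\<^bsub>R\<^esub> \<longrightarrow> s = \<zero>\<^bsub>R\<^esub>)"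

definition torsion_submodule :: "'a ring \<Rightarrow> ('a, 'm) module \<Rightarrow> ('a, 'm) module" where
  "torsion_submodule R M =
     M\<lparr>carrier := {m \<in> carrier M. \<exists>r. non_zero_divisor R r \<and> r \<odot>\<^bsub>M\<^esub> m = \<zero>\<^bsub>M\<^esub>}\<rparr>"


section \<open>The functor Ext in degree one\<close>

definition support :: "('a, 'z) ring_scheme \<Rightarrow> ('x \<Rightarrow> 'a) \<Rightarrow> 'x set" where
  "support M f = {x. f x \<noteq> \<zero>\<^bsub>M\<^esub>}"

text \<open>Finitely supported functions on \<open>S\<close>, extended by zero outside \<open>S\<close>.\<close>

definition finsupp :: "'x set \<Rightarrow> ('a, 'z) ring_scheme \<Rightarrow> ('x \<Rightarrow> 'a) set" where
  "finsupp S M = {f. (\<forall>x. f x \<in> carrier M) \<and> support M f \<subseteq> S \<and> finite (support M f)}"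

definition free_module :: "'a ring \<Rightarrow> 'x set \<Rightarrow> ('a, 'x \<Rightarrow> 'a) module" where
  "free_module R S =
     \<lparr>carrier = finsupp S R,
      monoid.mult = undefined, one = undefined,
      ring.zero = (\<lambda>_. \<zero>\<^bsub>R\<^esub>),
      add = (\<lambda>f g x. f x \<oplus>\<^bsub>R\<^esub> g x),
      smult = (\<lambda>r f x. r \<otimes>\<^bsub>R\<^esub> f x)\<rparr>"

text \<open>
  Every module \<open>M\<close> is the image of the free module on its own carrier. Iterating this gives
  the canonical free resolution
  \[ \cdots \to F_2 \stackrel{d_2}{\longrightarrow} F_1 \stackrel{d_1}{\longrightarrow} F_0 \to M \to 0, \]
  where \<open>F\<^sub>0\<close>, \<open>F\<^sub>1\<close>, \<open>F\<^sub>2\<close> are the covers of \<open>M\<close>, of its syzygy and of its second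
  syzygy. Ext in degree one is the cohomology of \<open>Hom(F, N)\<close> at \<open>Hom(F\<^sub>1, N)\<close>.
\<close>

definition cover :: "'a ring \<Rightarrow> ('a, 'm) module \<Rightarrow> ('a, 'm \<Rightarrow> 'a) module" where
  "cover R M = free_module R (carrier M)"

definition cover_map :: "'a ring \<Rightarrow> ('a, 'm) module \<Rightarrow> ('m \<Rightarrow> 'a) \<Rightarrow> 'm" where
  "cover_map R M f = (\<Oplus>\<^bsub>M\<^esub>x\<in>support R f. f x \<odot>\<^bsub>M\<^esub> x)"

definition syzygy :: "'a ring \<Rightarrow> ('a, 'm) module \<Rightarrow> ('a, 'm \<Rightarrow> 'a) module" where
  "syzygy R M = (cover R M)\<lparr>carrier := a_kernel (cover R M) M (cover_map R M)\<rparr>"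

definition Ext1 ::
  "'a ring \<Rightarrow> ('a, 'm) module \<Rightarrow> ('a, 'k) module \<Rightarrow> ('a, ((('m \<Rightarrow> 'a) \<Rightarrow> 'a) \<Rightarrow> 'k) set) module" where
  "Ext1 R M N =
     (let F0 = cover R M;
          F1 = cover R (syzygy R M);
          F2 = cover R (syzygy R (syzygy R M));
          d1 = cover_map R (syzygy R M);
          d2 = cover_map R (syzygy R (syzygy R M));
          C0 = Hom_module R F0 N;
          C1 = Hom_module R F1 N;
          C2 = Hom_module R F2 N;
          Z1 = a_kernel C1 C2 (\<lambda>\<phi>. compose (carrier F2) \<phi> d2);
          B1 = (\<lambda>\<phi>. compose (carrier F1) \<phi> d1) ` carrier C0
      in quotient_module (C1\<lparr>carrier := Z1\<rparr>) B1)"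


section \<open>Group algebras\<close>

text \<open>
  Groups are written multiplicatively, so the product of \<open>\<kappa>\<close> and \<open>\<mu>\<close> below is
  \<open>\<kappa> + \<mu>\<close> in additive notation. An element \<open>f\<close> stands for the sum of
  \<open>f \<kappa>\<close> times \<open>x\<^sup>\<kappa>\<close>.
\<close>

definition group_algebra :: "'a ring \<Rightarrow> 'l monoid \<Rightarrow> ('l \<Rightarrow> 'a) ring" where
  "group_algebra A \<Lambda> =
     \<lparr>carrier = finsupp (carrier \<Lambda>) A,
      monoid.mult = (\<lambda>f g \<nu>.
        finsum A (\<lambda>(\<kappa>, \<mu>). f \<kappa> \<otimes>\<^bsub>A\<^esub> g \<mu>)
          {(\<kappa>, \<mu>) \<in> support A f \<times> support A g. \<kappa> \<otimes>\<^bsub>\<Lambda>\<^esub> \<mu> = \<nu>}),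
      one = (\<lambda>\<nu>. if \<nu> = \<one>\<^bsub>\<Lambda>\<^esub> then \<one>\<^bsub>A\<^esub> else \<zero>\<^bsub>A\<^esub>),
      ring.zero = (\<lambda>_. \<zero>\<^bsub>A\<^esub>),
      add = (\<lambda>f g \<nu>. f \<nu> \<oplus>\<^bsub>A\<^esub> g \<nu>)\<rparr>"

definition antipode :: "'a ring \<Rightarrow> 'l monoid \<Rightarrow> ('l \<Rightarrow> 'a) \<Rightarrow> 'l \<Rightarrow> 'a" where
  "antipode A \<Lambda> f = (\<lambda>\<nu>. if \<nu> \<in> carrier \<Lambda> then f (inv\<^bsub>\<Lambda>\<^esub> \<nu>) else \<zero>\<^bsub>A\<^esub>)"

definition conj_module ::
  "'a ring \<Rightarrow> 'l monoid \<Rightarrow> ('l \<Rightarrow> 'a, 'm) module \<Rightarrow> ('l \<Rightarrow> 'a, 'm) module" where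
  "conj_module A \<Lambda> M = M\<lparr>smult := (\<lambda>r m. antipode A \<Lambda> r \<odot>\<^bsub>M\<^esub> m)\<rparr>"

definition dual_module ::
  "'a ring \<Rightarrow> 'l monoid \<Rightarrow> ('l \<Rightarrow> 'a, 'm) module \<Rightarrow> ('l \<Rightarrow> 'a, 'm \<Rightarrow> 'l \<Rightarrow> 'a) module" where
  "dual_module A \<Lambda> M =
     Hom_module (group_algebra A \<Lambda>) (conj_module A \<Lambda> M) (regular_module (group_algebra A \<Lambda>))"

definition dual_map ::
  "('l \<Rightarrow> 'a, 'm) module \<Rightarrow> ('m \<Rightarrow> 'k) \<Rightarrow> ('k \<Rightarrow> 'l \<Rightarrow> 'a) \<Rightarrow> 'm \<Rightarrow> 'l \<Rightarrow> 'a" where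
  "dual_map M \<sigma> \<phi> = compose (carrier M) \<phi> \<sigma>"

text \<open>
  For an \<open>A\<close>-module \<open>M\<close>, the \<open>A[\<Lambda>]\<close>-module \<open>M[\<Lambda>]\<close>, that is the extension of scalars
  of \<open>M\<close> along the inclusion of \<open>A\<close> in \<open>A[\<Lambda>]\<close>: since \<open>A[\<Lambda>]\<close> is free over \<open>A\<close> on
  the \<open>x\<^sup>\<kappa>\<close>, every element of the tensor product is uniquely a finite sum of
  \<open>f \<kappa> \<otimes> x\<^sup>\<kappa>\<close>, represented here by \<open>f\<close>.
\<close>

definition extend_scalars ::
  "'a ring \<Rightarrow> 'l monoid \<Rightarrow> ('a, 'm) module \<Rightarrow> ('l \<Rightarrow> 'a, 'l \<Rightarrow> 'm) module" where
  "extend_scalars A \<Lambda> M =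
     \<lparr>carrier = finsupp (carrier \<Lambda>) M,
      monoid.mult = undefined, one = undefined,
      ring.zero = (\<lambda>_. \<zero>\<^bsub>M\<^esub>),
      add = (\<lambda>f g \<nu>. f \<nu> \<oplus>\<^bsub>M\<^esub> g \<nu>),
      smult = (\<lambda>r f \<nu>.
        finsum M (\<lambda>(\<kappa>, \<mu>). r \<kappa> \<odot>\<^bsub>M\<^esub> f \<mu>)
          {(\<kappa>, \<mu>) \<in> support A r \<times> support M f. \<kappa> \<otimes>\<^bsub>\<Lambda>\<^esub> \<mu> = \<nu>})\<rparr>"

text \<open>
  The module \<open>M0\<close> may be taken with elements in the type of the elements of \<open>F\<close>: an
  isomorphism from \<open>M0[\<Lambda>]\<close> to \<open>F\<close> embeds \<open>M0\<close> into \<open>F\<close> as the elements \<open>m x\<^sup>0\<close>.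
\<close>

definition quasi_free :: "'a ring \<Rightarrow> 'l monoid \<Rightarrow> ('l \<Rightarrow> 'a, 'f) module \<Rightarrow> bool" where
  "quasi_free A \<Lambda> F \<longleftrightarrow>
     (\<exists>M0 :: ('a, 'f) module.
        module A M0 \<and> module_isomorphic (group_algebra A \<Lambda>) F (extend_scalars A \<Lambda> M0))"


section \<open>Stabilizer codes\<close>

definition bilinear_form :: "'a ring \<Rightarrow> ('a, 'm) module \<Rightarrow> ('m \<Rightarrow> 'm \<Rightarrow> 'a) \<Rightarrow> bool" where
  "bilinear_form A M \<omega> \<longleftrightarrow>
     (\<forall>x\<in>carrier M. (\<lambda>y. \<omega> x y) \<in> module_homs A M (regular_module A)) \<and>
     (\<forall>y\<in>carrier M. (\<lambda>x. \<omega> x y) \<in> module_homs A M (regular_module A))"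

definition extend_form ::
  "'a ring \<Rightarrow> 'l monoid \<Rightarrow> ('a, 'm) module \<Rightarrow> ('m \<Rightarrow> 'm \<Rightarrow> 'a) \<Rightarrow> ('l \<Rightarrow> 'm) \<Rightarrow> ('l \<Rightarrow> 'm) \<Rightarrow> 'l \<Rightarrow> 'a"
  where
  "extend_form A \<Lambda> M \<omega> f g = (\<lambda>\<nu>.
     finsum A (\<lambda>(\<kappa>, \<mu>). \<omega> (f \<kappa>) (g \<mu>))
       {(\<kappa>, \<mu>) \<in> support M f \<times> support M g. inv\<^bsub>\<Lambda>\<^esub> \<kappa> \<otimes>\<^bsub>\<Lambda>\<^esub> \<mu> = \<nu>})"

locale stabilizer_code =
  fixes n :: nat
    and \<Lambda> :: "'l monoid"
    and P0 :: "(int set, 'p) module"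
    and \<omega>0 :: "'p \<Rightarrow> 'p \<Rightarrow> int set"
    and L :: "('l \<Rightarrow> 'p) set"
  assumes n_pos: "n > 0"
    and comm_group: "comm_group \<Lambda>"
    and finitely_generated_group: "\<exists>S. finite S \<and> S \<subseteq> carrier \<Lambda> \<and> generate \<Lambda> S = carrier \<Lambda>"
    and module_P0: "module (ZFact (int n)) P0"
    and finitely_generated_P0: "finitely_generated_module (ZFact (int n)) P0"
    and bilinear: "bilinear_form (ZFact (int n)) P0 \<omega>0"
    and alternating: "a \<in> carrier P0 \<Longrightarrow> \<omega>0 a a = \<zero>\<^bsub>ZFact (int n)\<^esub>"
    and nondegenerate:
      "\<lbrakk>a \<in> carrier P0; \<And>b. b \<in> carrier P0 \<Longrightarrow> \<omega>0 b a = \<zero>\<^bsub>ZFact (int n)\<^esub>\<rbrakk> \<Longrightarrow> a = \<zero>\<^bsub>P0\<^esub>"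
    and submodule_L:
      "submodule L (group_algebra (ZFact (int n)) \<Lambda>) (extend_scalars (ZFact (int n)) \<Lambda> P0)"
    and isotropic:
      "\<lbrakk>f \<in> L; g \<in> L\<rbrakk> \<Longrightarrow>
        extend_form (ZFact (int n)) \<Lambda> P0 \<omega>0 f g = \<zero>\<^bsub>group_algebra (ZFact (int n)) \<Lambda>\<^esub>"

text \<open>The form plays no role in the charge module of a code.\<close>

definition Q0_module ::
  "nat \<Rightarrow> 'l monoid \<Rightarrow> (int set, 'p) module \<Rightarrow> ('l \<Rightarrow> 'p) set \<Rightarrow>
   ('l \<Rightarrow> int set, (((('l \<Rightarrow> 'p) set \<Rightarrow> 'l \<Rightarrow> int set) \<Rightarrow> 'l \<Rightarrow> int set) \<Rightarrow> 'l \<Rightarrow> int set) set) module"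
  where
  "Q0_module n \<Lambda> P0 L =
     (let A = ZFact (int n); R = group_algebra A \<Lambda>
      in Ext1 R (conj_module A \<Lambda> (quotient_module (extend_scalars A \<Lambda> P0) L)) (regular_module R))"

end

theory Submission
  imports Defs
begin

text \<open>
  Let \<open>R\<close> be the group algebra. As \<open>\<sigma>\<close> maps onto \<open>L\<close>, the dual of \<open>L\<close> is a submodule of the dual of \<open>F\<close>, and
  the quotient embeds into the dual of the kernel of \<open>\<sigma>\<close>, which is torsion-free. So \<open>T\<close> is the torsion of
  \<open>L\<^sup>*\<close> modulo the image of \<open>P\<^sup>*\<close>. This quotient is the first Ext of \<open>P/L\<close> because that of \<open>P = P0[\<Lambda>]\<close>
  vanishes, the integers modulo \<open>n\<close> being self-injective.

  It remains to see that it is all torsion: a homomorphism from a submodule of a finitely generated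
  module to \<open>R\<close> extends to the whole module after multiplication by a non-zero-divisor. Choose a
  subgroup \<open>G\<close> of finite index with the unique product property. In its group algebra, elements of content \<open>1\<close>
  are non-zero-divisors, and up to such factors every ideal is generated by a divisor of \<open>n\<close>.
  Hence the argument for self-injectivity of the integers modulo \<open>n\<close> applies once
  these elements are inverted, and linearity over \<open>R\<close> is restored by taking coefficients at the unit.
\<close>

section \<open>Homomorphisms and quotients of modules\<close>

text \<open>Torsion in \<Lambda> is the obstacle: over the integers modulo n > 1, the element 1 + x
  of the group algebra of a group of order 2 has content 1 but is killed by 1 - x. Unique products
  exclude this, yet passing to a subgroup of finite index costs linearity over \<open>R\<close>.
  Averaging over cosets would divide by the index, which need not be a unit modulo n; taking
  coefficients at the unit needs no division, \<open>R\<close> being both induced and coinduced from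
  the smaller algebra. The subgroup is either trivial or infinite: shifting supports apart needs
  room, while the algebra of the trivial group is just the integers modulo n. Both extension results
  rest on \<open>hom_extension_step\<close>, which enlarges the domain by one generator x at the
  price of a factor u. For the vanishing of Ext, the scalars that carry x into the old domain are
  the multiples of an integer d, and u = 1. For the torsion statement this holds only up to a
  non-zero-divisor u. In both cases d divides n, and self-injectivity enters as the fact that an
  element killed by n/d is divisible by d.\<close>

lemma module_homsI:
  assumes "\<And>x. x \<in> carrier M \<Longrightarrow> f x \<in> carrier N"
    and "\<And>x y. x \<in> carrier M \<Longrightarrow> y \<in> carrier M \<Longrightarrow> f (x \<oplus>\<^bsub>M\<^esub> y) = f x \<oplus>\<^bsub>N\<^esub> f y"
    and "\<And>r x. r \<in> carrier R \<Longrightarrow> x \<in> carrier M \<Longrightarrow> f (r \<odot>\<^bsub>M\<^esub> x) = r \<odot>\<^bsub>N\<^esub> f x"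
  shows "f \<in> module_homs R M N"
  using assms by (auto simp: module_homs_def)

lemma module_homs_closed:
  "f \<in> module_homs R M N \<Longrightarrow> x \<in> carrier M \<Longrightarrow> f x \<in> carrier N"
  by (auto simp: module_homs_def)

lemma module_homs_add:
  "f \<in> module_homs R M N \<Longrightarrow> x \<in> carrier M \<Longrightarrow> y \<in> carrier M \<Longrightarrow>
    f (x \<oplus>\<^bsub>M\<^esub> y) = f x \<oplus>\<^bsub>N\<^esub> f y"
  by (simp add: module_homs_def)

lemma module_homs_smult:
  "f \<in> module_homs R M N \<Longrightarrow> r \<in> carrier R \<Longrightarrow> x \<in> carrier M \<Longrightarrow>
    f (r \<odot>\<^bsub>M\<^esub> x) = r \<odot>\<^bsub>N\<^esub> f x"
  by (simp add: module_homs_def)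

lemma additive_zero_minus:
  assumes "abelian_group M" and "abelian_group N"
    and closed: "\<And>x. x \<in> carrier M \<Longrightarrow> f x \<in> carrier N"
    and add: "\<And>x y. x \<in> carrier M \<Longrightarrow> y \<in> carrier M \<Longrightarrow> f (x \<oplus>\<^bsub>M\<^esub> y) = f x \<oplus>\<^bsub>N\<^esub> f y"
  shows "f \<zero>\<^bsub>M\<^esub> = \<zero>\<^bsub>N\<^esub>"
    and "x \<in> carrier M \<Longrightarrow> f (\<ominus>\<^bsub>M\<^esub> x) = \<ominus>\<^bsub>N\<^esub> f x"
    and "x \<in> carrier M \<Longrightarrow> y \<in> carrier M \<Longrightarrow> f (x \<ominus>\<^bsub>M\<^esub> y) = f x \<ominus>\<^bsub>N\<^esub> f y"
proof -
  interpret M: abelian_group M by fact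
  interpret N: abelian_group N by fact
  interpret f: abelian_group_hom M N f
    by (intro abelian_group_homI group_hom.intro group_hom_axioms.intro M.abelian_group_axioms
        N.abelian_group_axioms M.a_group N.a_group) (simp add: hom_def closed add)
  show "f \<zero>\<^bsub>M\<^esub> = \<zero>\<^bsub>N\<^esub>" by simp
  show "x \<in> carrier M \<Longrightarrow> f (\<ominus>\<^bsub>M\<^esub> x) = \<ominus>\<^bsub>N\<^esub> f x" by simp
  show "x \<in> carrier M \<Longrightarrow> y \<in> carrier M \<Longrightarrow> f (x \<ominus>\<^bsub>M\<^esub> y) = f x \<ominus>\<^bsub>N\<^esub> f y"
    by (simp add: a_minus_def)
qed

lemma (in abelian_group) diff_eq_zero_iff:
  assumes "x \<in> carrier G" and "y \<in> carrier G"
  shows "x \<ominus> y = \<zero> \<longleftrightarrow> x = y"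
  using assms add.inv_equality[of x "\<ominus> y"] by (auto simp: a_minus_def r_neg)

lemma (in abelian_group) diff_zero: "x \<in> carrier G \<Longrightarrow> x \<ominus> \<zero> = x"
  using minus_equality[OF l_zero[OF zero_closed]] by (simp add: a_minus_def)

lemma (in module) smult_lcomm:
  "a \<in> carrier R \<Longrightarrow> b \<in> carrier R \<Longrightarrow> x \<in> carrier M \<Longrightarrow>
    a \<odot>\<^bsub>M\<^esub> (b \<odot>\<^bsub>M\<^esub> x) = b \<odot>\<^bsub>M\<^esub> (a \<odot>\<^bsub>M\<^esub> x)"
  by (simp flip: smult_assoc1 add: R.m_comm)

lemma (in module) smult_diff_distr:
  "a \<in> carrier R \<Longrightarrow> x \<in> carrier M \<Longrightarrow> y \<in> carrier M \<Longrightarrow>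
    a \<odot>\<^bsub>M\<^esub> (x \<ominus>\<^bsub>M\<^esub> y) = a \<odot>\<^bsub>M\<^esub> x \<ominus>\<^bsub>M\<^esub> a \<odot>\<^bsub>M\<^esub> y"
  by (simp add: a_minus_def smult_r_distr smult_r_minus)

lemma (in module) submodule_zero: "submodule H R M \<Longrightarrow> \<zero>\<^bsub>M\<^esub> \<in> H"
  using submodule.axioms(1) subgroup.one_closed by fastforce

lemma (in module) submoduleI_smult:
  assumes "H \<subseteq> carrier M" and "\<zero>\<^bsub>M\<^esub> \<in> H"
    and "\<And>a b. a \<in> H \<Longrightarrow> b \<in> H \<Longrightarrow> a \<oplus>\<^bsub>M\<^esub> b \<in> H"
    and smult: "\<And>r a. r \<in> carrier R \<Longrightarrow> a \<in> H \<Longrightarrow> r \<odot>\<^bsub>M\<^esub> a \<in> H"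
  shows "submodule H R M"
proof (rule submoduleI)
  show "\<ominus>\<^bsub>M\<^esub> a \<in> H" if "a \<in> H" for a
    using smult[OF _ that, of "\<ominus> \<one>"] that assms(1) by (auto simp: smult_l_minus subset_iff)
qed (use assms in auto)

lemma module_homs_zero_minus:
  assumes "module R M" and "module R N" and f: "f \<in> module_homs R M N"
  shows "f \<zero>\<^bsub>M\<^esub> = \<zero>\<^bsub>N\<^esub>"
    and "x \<in> carrier M \<Longrightarrow> f (\<ominus>\<^bsub>M\<^esub> x) = \<ominus>\<^bsub>N\<^esub> f x"
    and "x \<in> carrier M \<Longrightarrow> y \<in> carrier M \<Longrightarrow> f (x \<ominus>\<^bsub>M\<^esub> y) = f x \<ominus>\<^bsub>N\<^esub> f y"
  using additive_zero_minus[OF module.axioms(2)[OF assms(1)] module.axioms(2)[OF assms(2)]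
      module_homs_closed[OF f] module_homs_add[OF f]] by blast+

lemma module_homs_comp:
  assumes "f \<in> module_homs R M N" and "g \<in> module_homs R N K"
  shows "(\<lambda>x. g (f x)) \<in> module_homs R M K"
  using assms by (intro module_homsI) (auto simp: module_homs_def Pi_iff)

lemma module_homs_diff:
  assumes M: "module R M" and N: "module R N"
    and f: "f \<in> module_homs R M N" and g: "g \<in> module_homs R M N"
  shows "(\<lambda>x. f x \<ominus>\<^bsub>N\<^esub> g x) \<in> module_homs R M N"
proof -
  interpret N: module R N by fact
  show ?thesis
    using f g by (intro module_homsI)
      (auto simp: module_homs_closed[OF f] module_homs_closed[OF g] module_homs_add[OF f] module_homs_add[OF g]
        module_homs_smult[OF f] module_homs_smult[OF g] a_minus_def N.smult_r_distr N.smult_r_minus N.minus_add N.a_ac)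
qed

lemma Hom_module_simps:
  "carrier (Hom_module R M N) = module_homs R M N \<inter> extensional (carrier M)"
  "\<zero>\<^bsub>Hom_module R M N\<^esub> = (\<lambda>x\<in>carrier M. \<zero>\<^bsub>N\<^esub>)"
  "f \<oplus>\<^bsub>Hom_module R M N\<^esub> g = (\<lambda>x\<in>carrier M. f x \<oplus>\<^bsub>N\<^esub> g x)"
  "r \<odot>\<^bsub>Hom_module R M N\<^esub> f = (\<lambda>x\<in>carrier M. r \<odot>\<^bsub>N\<^esub> f x)"
  by (simp_all add: Hom_module_def)

lemma restrict_module_homs:
  assumes "module R M" and "f \<in> module_homs R M N"
  shows "restrict f (carrier M) \<in> carrier (Hom_module R M N)"
proof -
  interpret module R M by fact
  show ?thesis using assms(2) by (auto simp: Hom_module_simps module_homs_def Pi_iff)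
qed

lemma Hom_module_is_module:
  assumes M: "module R M" and N: "module R N"
  shows "module R (Hom_module R M N)"
proof -
  interpret M: module R M by fact
  interpret N: module R N by fact
  note simps = Hom_module_simps module_homs_def Pi_iff N.smult_r_distr N.smult_l_distr
  show ?thesis
  proof (intro moduleI abelian_groupI)
    show "cring R" ..
    fix f assume f: "f \<in> carrier (Hom_module R M N)"
    have "(\<lambda>x\<in>carrier M. \<ominus>\<^bsub>N\<^esub> f x) \<in> carrier (Hom_module R M N)"
      using f by (auto simp: simps N.minus_add N.smult_r_minus)
    moreover have "(\<lambda>x\<in>carrier M. \<ominus>\<^bsub>N\<^esub> f x) \<oplus>\<^bsub>Hom_module R M N\<^esub> f = \<zero>\<^bsub>Hom_module R M N\<^esub>"
      using f by (auto simp: simps fun_eq_iff N.l_neg)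
    ultimately show "\<exists>g\<in>carrier (Hom_module R M N). g \<oplus>\<^bsub>Hom_module R M N\<^esub> f = \<zero>\<^bsub>Hom_module R M N\<^esub>"
      by blast
    show "\<zero>\<^bsub>Hom_module R M N\<^esub> \<oplus>\<^bsub>Hom_module R M N\<^esub> f = f"
      using f by (auto simp: simps fun_eq_iff extensional_def)
    show "\<one>\<^bsub>R\<^esub> \<odot>\<^bsub>Hom_module R M N\<^esub> f = f"
      using f by (auto simp: simps fun_eq_iff extensional_def)
    fix r assume r: "r \<in> carrier R"
    show "r \<odot>\<^bsub>Hom_module R M N\<^esub> f \<in> carrier (Hom_module R M N)"
      using f r by (auto simp: simps N.smult_lcomm)
  next
    fix f g assume fg: "f \<in> carrier (Hom_module R M N)" "g \<in> carrier (Hom_module R M N)"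
    show "f \<oplus>\<^bsub>Hom_module R M N\<^esub> g \<in> carrier (Hom_module R M N)"
      using fg by (auto simp: simps N.a_ac)
    show "f \<oplus>\<^bsub>Hom_module R M N\<^esub> g = g \<oplus>\<^bsub>Hom_module R M N\<^esub> f"
      using fg by (auto simp: simps fun_eq_iff N.a_comm)
  qed (auto simp: simps fun_eq_iff N.a_assoc N.smult_assoc1)
qed

lemma Hom_module_eval:
  assumes "x \<in> carrier M"
  shows "(\<lambda>f. f x) \<in> module_homs R (Hom_module R M N) N"
  using assms by (auto simp: module_homs_def Hom_module_simps Pi_iff)

lemma Hom_module_eqI:
  assumes "f \<in> carrier (Hom_module R M N)" and "g \<in> carrier (Hom_module R M N)"
    and "\<And>x. x \<in> carrier M \<Longrightarrow> f x = g x"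
  shows "f = g"
  using assms by (auto simp: Hom_module_simps intro: extensionalityI)

lemma Hom_module_diff_apply:
  assumes "module R M" and "module R N" and "f \<in> carrier (Hom_module R M N)"
    and "g \<in> carrier (Hom_module R M N)" and "x \<in> carrier M"
  shows "(f \<ominus>\<^bsub>Hom_module R M N\<^esub> g) x = f x \<ominus>\<^bsub>N\<^esub> g x"
  using module_homs_zero_minus(3)[OF Hom_module_is_module[OF assms(1,2)] assms(2)
      Hom_module_eval[OF assms(5)] assms(3,4)] .

lemma Hom_module_precompose:
  assumes "module R M" and "module R M'" and "f \<in> module_homs R M M'"
  shows "(\<lambda>\<phi>. compose (carrier M) \<phi> f) \<in> module_homs R (Hom_module R M' N) (Hom_module R M N)"
proof (rule module_homsI)
  interpret M: module R M by fact
  interpret M': module R M' by fact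
  note f = module_homs_closed[OF assms(3)]
  show "compose (carrier M) \<phi> f \<in> carrier (Hom_module R M N)"
    if "\<phi> \<in> carrier (Hom_module R M' N)" for \<phi>
    using restrict_module_homs[OF assms(1) module_homs_comp[OF assms(3)], of \<phi> N] that
    by (simp add: compose_def Hom_module_simps)
qed (auto simp: Hom_module_simps compose_def fun_eq_iff module_homs_closed[OF assms(3)])

lemma module_homs_kernel_submodule:
  assumes M: "module R M" and N: "module R N" and f: "f \<in> module_homs R M N"
  shows "submodule (a_kernel M N f) R M"
proof -
  interpret M: module R M by fact
  interpret N: module R N by fact
  show ?thesis
    by (rule M.submoduleI) (auto simp: a_kernel_def' module_homs_zero_minus[OF M N f]
        module_homs_add[OF f] module_homs_smult[OF f])
qed

lemma module_homs_image_submodule: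
  assumes M: "module R M" and N: "module R N" and f: "f \<in> module_homs R M N"
  shows "submodule (f ` carrier M) R N"
proof -
  interpret M: module R M by fact
  interpret N: module R N by fact
  show ?thesis
  proof (rule N.submoduleI)
    show "f ` carrier M \<subseteq> carrier N" using module_homs_closed[OF f] by auto
    show "\<zero>\<^bsub>N\<^esub> \<in> f ` carrier M"
      using module_homs_zero_minus(1)[OF M N f] M.zero_closed by (metis imageI)
    show "\<ominus>\<^bsub>N\<^esub> a \<in> f ` carrier M" if "a \<in> f ` carrier M" for a
      using that module_homs_zero_minus(2)[OF M N f] M.a_inv_closed by (metis (no_types) image_iff)
    show "a \<oplus>\<^bsub>N\<^esub> b \<in> f ` carrier M" if "a \<in> f ` carrier M" "b \<in> f ` carrier M" for a b
      using that module_homs_add[OF f] M.a_closed by (metis (no_types) image_iff)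
    show "r \<odot>\<^bsub>N\<^esub> a \<in> f ` carrier M" if "r \<in> carrier R" "a \<in> f ` carrier M" for r a
      using that module_homs_smult[OF f] M.smult_closed by (metis (no_types) image_iff)
  qed
qed

text \<open>Two preimages of one element of \<open>Y\<close> differ by an element of the kernel of
  \<open>p\<close>, where \<open>z\<close> vanishes, so every choice of preimage gives the same
  value. Homomorphisms out of \<open>L\<close>, \<open>P\<close> and a syzygy are obtained in this
  way from maps on modules above them.\<close>

lemma module_homs_factor:
  assumes E: "module R E" and Y: "module R Y" and N: "module R N"
    and p: "p \<in> module_homs R E Y" "p ` carrier E = carrier Y"
    and z: "z \<in> module_homs R E N"
    and ker: "\<And>x. x \<in> carrier E \<Longrightarrow> p x = \<zero>\<^bsub>Y\<^esub> \<Longrightarrow> z x = \<zero>\<^bsub>N\<^esub>"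
  obtains \<theta> where "\<theta> \<in> carrier (Hom_module R Y N)" and "\<And>x. x \<in> carrier E \<Longrightarrow> \<theta> (p x) = z x"
proof -
  interpret E: module R E by fact
  interpret Y: module R Y by fact
  interpret N: module R N by fact
  note homs = module_homs_closed[OF p(1)] module_homs_closed[OF z] module_homs_add[OF p(1)]
    module_homs_add[OF z] module_homs_smult[OF p(1)] module_homs_smult[OF z]
  define \<theta> where "\<theta> = (\<lambda>y. z (SOME x. x \<in> carrier E \<and> p x = y))"
  have eq: "z x = z x'" if "x \<in> carrier E" "x' \<in> carrier E" "p x = p x'" for x x'
  proof -
    have "p (x \<ominus>\<^bsub>E\<^esub> x') = \<zero>\<^bsub>Y\<^esub>"
      using that by (simp add: module_homs_zero_minus[OF E Y p(1)] homs a_minus_def Y.r_neg)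
    then have "z x \<ominus>\<^bsub>N\<^esub> z x' = \<zero>\<^bsub>N\<^esub>"
      using ker[of "x \<ominus>\<^bsub>E\<^esub> x'"] that by (simp add: module_homs_zero_minus[OF E N z])
    then show ?thesis using that by (simp add: homs N.diff_eq_zero_iff)
  qed
  have \<theta>p: "\<theta> (p x) = z x" if x: "x \<in> carrier E" for x
  proof -
    have "(SOME x'. x' \<in> carrier E \<and> p x' = p x) \<in> carrier E \<and>
        p (SOME x'. x' \<in> carrier E \<and> p x' = p x) = p x"
      by (rule someI[of _ x]) (simp add: x)
    then show ?thesis unfolding \<theta>_def using eq[OF _ x] by blast
  qed
  have "\<theta> \<in> module_homs R Y N"
  proof (rule module_homsI)
    fix y assume "y \<in> carrier Y"
    then obtain x where x: "x \<in> carrier E" "y = p x" using p(2) by blast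
    then show "\<theta> y \<in> carrier N" by (simp add: \<theta>p homs)
    show "\<theta> (r \<odot>\<^bsub>Y\<^esub> y) = r \<odot>\<^bsub>N\<^esub> \<theta> y" if "r \<in> carrier R" for r
      using x that \<theta>p[of "r \<odot>\<^bsub>E\<^esub> x"] by (simp add: \<theta>p homs)
    fix y' assume "y' \<in> carrier Y"
    then obtain x' where x': "x' \<in> carrier E" "y' = p x'" using p(2) by blast
    then show "\<theta> (y \<oplus>\<^bsub>Y\<^esub> y') = \<theta> y \<oplus>\<^bsub>N\<^esub> \<theta> y'"
      using x \<theta>p[of "x \<oplus>\<^bsub>E\<^esub> x'"] by (simp add: \<theta>p homs)
  qed
  then have "restrict \<theta> (carrier Y) \<in> carrier (Hom_module R Y N)"
    by (rule restrict_module_homs[OF Y])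
  then show thesis
    by (rule that) (simp add: \<theta>p homs)
qed

text \<open>The operations of \<open>Q\<close> are known only on images under \<open>p\<close>, and
  surjectivity carries each axiom over from \<open>M\<close>. For quotients this replaces
  computations with cosets.\<close>

lemma module_surj_image:
  fixes Q :: "('a, 'q) module"
  assumes M: "module R M"
    and surj: "p ` carrier M = carrier Q" and zero: "p \<zero>\<^bsub>M\<^esub> = \<zero>\<^bsub>Q\<^esub>"
    and add: "\<And>x y. x \<in> carrier M \<Longrightarrow> y \<in> carrier M \<Longrightarrow> p x \<oplus>\<^bsub>Q\<^esub> p y = p (x \<oplus>\<^bsub>M\<^esub> y)"
    and smult: "\<And>r x. r \<in> carrier R \<Longrightarrow> x \<in> carrier M \<Longrightarrow> r \<odot>\<^bsub>Q\<^esub> p x = p (r \<odot>\<^bsub>M\<^esub> x)"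
  shows "module R Q"
proof -
  interpret M: module R M by fact
  have obt: "\<exists>x. x \<in> carrier M \<and> y = p x" if "y \<in> carrier Q" for y
    using that surj by blast
  have p: "p x \<in> carrier Q" if "x \<in> carrier M" for x
    using that surj by blast
  show ?thesis
  proof (intro moduleI abelian_groupI)
    show "cring R" ..
    show "\<zero>\<^bsub>Q\<^esub> \<in> carrier Q" using p[OF M.zero_closed] zero by simp
    fix y1 assume "y1 \<in> carrier Q"
    then obtain x1 where x1: "x1 \<in> carrier M" "y1 = p x1" using obt by blast
    show "\<zero>\<^bsub>Q\<^esub> \<oplus>\<^bsub>Q\<^esub> y1 = y1"
      using x1 add[OF M.zero_closed x1(1)] zero by simp
    have "p (\<ominus>\<^bsub>M\<^esub> x1) \<oplus>\<^bsub>Q\<^esub> y1 = \<zero>\<^bsub>Q\<^esub>"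
      using x1 by (simp add: add M.l_neg zero)
    then show "\<exists>z\<in>carrier Q. z \<oplus>\<^bsub>Q\<^esub> y1 = \<zero>\<^bsub>Q\<^esub>" using p x1 by blast
    show "\<one>\<^bsub>R\<^esub> \<odot>\<^bsub>Q\<^esub> y1 = y1" using x1 by (simp add: smult)
    fix r assume r: "r \<in> carrier R"
    show "r \<odot>\<^bsub>Q\<^esub> y1 \<in> carrier Q" using x1 r by (simp add: smult p)
    fix s assume s: "s \<in> carrier R"
    show "(r \<oplus>\<^bsub>R\<^esub> s) \<odot>\<^bsub>Q\<^esub> y1 = r \<odot>\<^bsub>Q\<^esub> y1 \<oplus>\<^bsub>Q\<^esub> s \<odot>\<^bsub>Q\<^esub> y1"
      using x1 r s by (simp add: smult add M.smult_l_distr)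
    show "(r \<otimes>\<^bsub>R\<^esub> s) \<odot>\<^bsub>Q\<^esub> y1 = r \<odot>\<^bsub>Q\<^esub> (s \<odot>\<^bsub>Q\<^esub> y1)"
      using x1 r s by (simp add: smult M.smult_assoc1)
  next
    fix y1 y2 assume "y1 \<in> carrier Q" "y2 \<in> carrier Q"
    then obtain x1 x2 where x: "x1 \<in> carrier M" "y1 = p x1" "x2 \<in> carrier M" "y2 = p x2"
      using obt by blast
    show "y1 \<oplus>\<^bsub>Q\<^esub> y2 \<in> carrier Q" using x by (simp add: add p)
    show "y1 \<oplus>\<^bsub>Q\<^esub> y2 = y2 \<oplus>\<^bsub>Q\<^esub> y1" using x by (simp add: add M.a_comm)
    show "r \<odot>\<^bsub>Q\<^esub> (y1 \<oplus>\<^bsub>Q\<^esub> y2) = r \<odot>\<^bsub>Q\<^esub> y1 \<oplus>\<^bsub>Q\<^esub> r \<odot>\<^bsub>Q\<^esub> y2" if "r \<in> carrier R" for r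
      using x that by (simp add: smult add M.smult_r_distr)
    fix y3 assume "y3 \<in> carrier Q"
    then obtain x3 where "x3 \<in> carrier M" "y3 = p x3" using obt by blast
    then show "y1 \<oplus>\<^bsub>Q\<^esub> y2 \<oplus>\<^bsub>Q\<^esub> y3 = y1 \<oplus>\<^bsub>Q\<^esub> (y2 \<oplus>\<^bsub>Q\<^esub> y3)"
      using x by (simp add: add M.a_assoc)
  qed
qed

section \<open>Quotient modules\<close>

lemma quotient_module_simps:
  "carrier (quotient_module M H) = (\<lambda>x. H +>\<^bsub>M\<^esub> x) ` carrier M"
  "\<zero>\<^bsub>quotient_module M H\<^esub> = H"
  by (auto simp: quotient_module_def A_RCOSETS_def')

context
  fixes R :: "'a ring" and M :: "('a, 'm) module"
  assumes M: "module R M"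
begin

interpretation module R M by (rule M)

lemma submodule_abelian_subgroup: "submodule H R M \<Longrightarrow> abelian_subgroup H M"
  by (intro abelian_subgroupI3 additive_subgroupI submodule.axioms(1) abelian_group_axioms)

lemma quotient_eq_iff:
  assumes "submodule H R M" and "x \<in> carrier M" and "y \<in> carrier M"
  shows "H +>\<^bsub>M\<^esub> x = H +>\<^bsub>M\<^esub> y \<longleftrightarrow> x \<ominus>\<^bsub>M\<^esub> y \<in> H"
proof -
  interpret H: abelian_subgroup H M by (rule submodule_abelian_subgroup) fact
  have "H +>\<^bsub>M\<^esub> x = H +>\<^bsub>M\<^esub> y \<longleftrightarrow> x \<in> H +>\<^bsub>M\<^esub> y"
    using H.a_repr_independenceD[OF assms(2), of y] H.a_repr_independence'[OF _ assms(3), of x] by metis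
  then show ?thesis using assms by (simp add: H.a_rcos_module minus_eq)
qed

lemma quotient_add:
  assumes "submodule H R M" and "x \<in> carrier M" and "y \<in> carrier M"
  shows "(H +>\<^bsub>M\<^esub> x) \<oplus>\<^bsub>quotient_module M H\<^esub> (H +>\<^bsub>M\<^esub> y) = H +>\<^bsub>M\<^esub> (x \<oplus>\<^bsub>M\<^esub> y)"
proof -
  interpret H: abelian_subgroup H M by (rule submodule_abelian_subgroup) fact
  show ?thesis using assms by (simp add: quotient_module_def H.a_rcos_sum)
qed

lemma quotient_smult:
  assumes H: "submodule H R M" and r: "r \<in> carrier R" and x: "x \<in> carrier M"
  shows "r \<odot>\<^bsub>quotient_module M H\<^esub> (H +>\<^bsub>M\<^esub> x) = H +>\<^bsub>M\<^esub> (r \<odot>\<^bsub>M\<^esub> x)"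
proof -
  interpret H: abelian_subgroup H M by (rule submodule_abelian_subgroup) fact
  have "H +>\<^bsub>M\<^esub> (r \<odot>\<^bsub>M\<^esub> y) = H +>\<^bsub>M\<^esub> (r \<odot>\<^bsub>M\<^esub> x)" if y: "y \<in> H +>\<^bsub>M\<^esub> x" for y
  proof -
    have yM: "y \<in> carrier M" using y x H.a_elemrcos_carrier by blast
    have "y \<ominus>\<^bsub>M\<^esub> x \<in> H" using y x yM by (simp add: H.a_rcos_module minus_eq)
    then have "r \<odot>\<^bsub>M\<^esub> (y \<ominus>\<^bsub>M\<^esub> x) \<in> H" using submoduleE(4)[OF H r] by blast
    then show ?thesis
      using r x yM by (simp add: quotient_eq_iff[OF H] a_minus_def smult_r_distr smult_r_minus)
  qed
  then have "(\<Union>y\<in>H +>\<^bsub>M\<^esub> x. H +>\<^bsub>M\<^esub> (r \<odot>\<^bsub>M\<^esub> y)) = H +>\<^bsub>M\<^esub> (r \<odot>\<^bsub>M\<^esub> x)"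
    using H.a_rcos_self[OF x] by blast
  then show ?thesis by (simp add: quotient_module_def)
qed

lemma quotient_zero:
  assumes "submodule H R M"
  shows "H +>\<^bsub>M\<^esub> \<zero>\<^bsub>M\<^esub> = H"
  using submoduleE(1)[OF assms] by simp

lemma quotient_is_module:
  assumes H: "submodule H R M"
  shows "module R (quotient_module M H)"
  by (rule module_surj_image[OF module_axioms, of "\<lambda>x. H +>\<^bsub>M\<^esub> x"])
    (auto simp: quotient_module_simps quotient_zero[OF H] quotient_add[OF H] quotient_smult[OF H])

lemma quotient_proj:
  assumes H: "submodule H R M"
  shows "(\<lambda>x. H +>\<^bsub>M\<^esub> x) \<in> module_homs R M (quotient_module M H)"
  by (intro module_homsI) (simp_all add: quotient_module_simps quotient_add[OF H] quotient_smult[OF H])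

lemma quotient_proj_zero_iff:
  assumes H: "submodule H R M" and "x \<in> carrier M"
  shows "H +>\<^bsub>M\<^esub> x = H \<longleftrightarrow> x \<in> H"
  using quotient_eq_iff[OF H assms(2) zero_closed] assms(2) by (simp add: quotient_zero[OF H] diff_zero)

end

text \<open>By \<open>ker\<close> the maps from \<open>D\<close> to the two quotients have the same
  kernel; the first has image \<open>T\<close>, the second is onto by \<open>surj\<close>. Both
  sides are therefore \<open>D\<close> modulo that kernel. The intended \<open>D\<close> is the dual
  of \<open>L\<close>.\<close>

lemma quotient_modules_isomorphic:
  assumes D: "module R D" and M1: "module R M1" and M2: "module R M2"
    and H1: "submodule H1 R M1" and H2: "submodule H2 R M2"
    and f1: "f1 \<in> module_homs R D M1" and f2: "f2 \<in> module_homs R D M2"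
    and ker: "\<And>d. d \<in> carrier D \<Longrightarrow> f1 d \<in> H1 \<longleftrightarrow> f2 d \<in> H2"
    and T: "T = (\<lambda>d. H1 +>\<^bsub>M1\<^esub> f1 d) ` carrier D"
    and surj: "\<And>y. y \<in> carrier M2 \<Longrightarrow> \<exists>d\<in>carrier D. y \<ominus>\<^bsub>M2\<^esub> f2 d \<in> H2"
  shows "module_isomorphic R (quotient_module M1 H1\<lparr>carrier := T\<rparr>) (quotient_module M2 H2)"
proof -
  interpret D: module R D by fact
  interpret M1: module R M1 by fact
  interpret M2: module R M2 by fact
  define u where "u = (\<lambda>d. H1 +>\<^bsub>M1\<^esub> f1 d)"
  define v where "v = (\<lambda>d. H2 +>\<^bsub>M2\<^esub> f2 d)"
  let ?Q1 = "quotient_module M1 H1" and ?Q2 = "quotient_module M2 H2"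
  have u: "u \<in> module_homs R D ?Q1" unfolding u_def
    by (rule module_homs_comp[OF f1 quotient_proj[OF M1 H1]])
  have v: "v \<in> module_homs R D ?Q2" unfolding v_def
    by (rule module_homs_comp[OF f2 quotient_proj[OF M2 H2]])
  have uv: "u d = u d' \<longleftrightarrow> v d = v d'" if "d \<in> carrier D" "d' \<in> carrier D" for d d'
    using that ker[of "d \<ominus>\<^bsub>D\<^esub> d'"]
    by (simp add: u_def v_def quotient_eq_iff[OF M1 H1] quotient_eq_iff[OF M2 H2] module_homs_closed[OF f1]
        module_homs_closed[OF f2] module_homs_zero_minus[OF D M1 f1] module_homs_zero_minus[OF D M2 f2])
  define g where "g = (\<lambda>t. v (SOME d. d \<in> carrier D \<and> u d = t))"
  have gu: "g (u d) = v d" if d: "d \<in> carrier D" for d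
  proof -
    have "(SOME d'. d' \<in> carrier D \<and> u d' = u d) \<in> carrier D \<and>
        u (SOME d'. d' \<in> carrier D \<and> u d' = u d) = u d"
      by (rule someI[of _ d]) (simp add: d)
    then show ?thesis unfolding g_def using uv[OF _ d] by blast
  qed
  have T': "T = u ` carrier D" by (simp add: T u_def)
  have "g \<in> module_homs R (?Q1\<lparr>carrier := T\<rparr>) ?Q2"
  proof (rule module_homsI)
    fix t assume "t \<in> carrier (?Q1\<lparr>carrier := T\<rparr>)"
    then obtain d where d: "d \<in> carrier D" "t = u d" by (auto simp: T')
    show "g t \<in> carrier ?Q2" using d by (simp add: gu module_homs_closed[OF v])
    show "g (r \<odot>\<^bsub>?Q1\<lparr>carrier := T\<rparr>\<^esub> t) = r \<odot>\<^bsub>?Q2\<^esub> g t" if "r \<in> carrier R" for r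
      using d that by (simp add: gu flip: module_homs_smult[OF u] module_homs_smult[OF v])
    fix t' assume "t' \<in> carrier (?Q1\<lparr>carrier := T\<rparr>)"
    then obtain d' where d': "d' \<in> carrier D" "t' = u d'" by (auto simp: T')
    show "g (t \<oplus>\<^bsub>?Q1\<lparr>carrier := T\<rparr>\<^esub> t') = g t \<oplus>\<^bsub>?Q2\<^esub> g t'"
      using d d' by (simp add: gu flip: module_homs_add[OF u] module_homs_add[OF v])
  qed
  moreover have "inj_on g T"
    using uv by (auto simp: inj_on_def T' gu)
  moreover have "g ` T = carrier ?Q2"
  proof -
    have "g ` T = v ` carrier D" by (force simp: T' gu)
    also have "\<dots> = carrier ?Q2"
    proof
      show "v ` carrier D \<subseteq> carrier ?Q2" using module_homs_closed[OF v] by blast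
      show "carrier ?Q2 \<subseteq> v ` carrier D"
        using surj module_homs_closed[OF f2] by (auto simp: quotient_module_simps v_def image_iff quotient_eq_iff[OF M2 H2])
    qed
    finally show ?thesis .
  qed
  ultimately show ?thesis
    unfolding module_isomorphic_def by (intro bexI[of _ g]) (auto simp: bij_betw_def)
qed

lemma module_homs_restrict_codomain:
  assumes "f \<in> module_homs R M N" and "\<And>x. x \<in> carrier M \<Longrightarrow> f x \<in> S"
  shows "f \<in> module_homs R M (N\<lparr>carrier := S\<rparr>)"
  using assms by (auto simp: module_homs_def)

lemma module_homs_restrict_domain:
  assumes "f \<in> module_homs R M N" and "S \<subseteq> carrier M"
  shows "f \<in> module_homs R (M\<lparr>carrier := S\<rparr>) N"
  using assms by (auto simp: module_homs_def Pi_iff subset_iff)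

lemma module_homs_add_fun:
  assumes M: "module R M" and N: "module R N"
    and f: "f \<in> module_homs R M N" and g: "g \<in> module_homs R M N"
  shows "(\<lambda>x. f x \<oplus>\<^bsub>N\<^esub> g x) \<in> module_homs R M N"
proof -
  interpret N: module R N by fact
  show ?thesis
    using f g by (intro module_homsI)
      (auto simp: module_homs_closed[OF f] module_homs_closed[OF g] module_homs_add[OF f] module_homs_add[OF g]
        module_homs_smult[OF f] module_homs_smult[OF g] N.smult_r_distr N.a_ac)
qed

text \<open>Subtraction uses an inverse chosen inside the carrier, so it is not obvious that it
  survives a restriction of the carrier. The inclusion is a homomorphism and therefore preserves
  it.\<close>

lemma submodule_minus:
  fixes R :: "'a ring" and M :: "('a, 'm) module"
  assumes M: "module R M" and S: "submodule S R M" and "x \<in> S" and "y \<in> S"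
  shows "x \<ominus>\<^bsub>M\<lparr>carrier := S\<rparr>\<^esub> y = x \<ominus>\<^bsub>M\<^esub> y"
proof -
  have "(\<lambda>x. x) \<in> module_homs R (M\<lparr>carrier := S\<rparr>) M"
    using module.submoduleE(1)[OF M S] by (auto simp: module_homs_def)
  from module_homs_zero_minus(3)[OF submodule.submodule_is_module[OF S M] M this, of x y] assms(3,4)
  show ?thesis by simp
qed

section \<open>Free modules\<close>

text \<open>One notion for three things: a basis element of a free module, a monomial of the group
  algebra, and an element m x^s of an extension of scalars.\<close>

definition single :: "('a, 'z) ring_scheme \<Rightarrow> 'x \<Rightarrow> 'a \<Rightarrow> 'x \<Rightarrow> 'a" where
  "single M s a = (\<lambda>x. if x = s then a else \<zero>\<^bsub>M\<^esub>)"

text \<open>The homomorphism out of a free module that is prescribed by \<rho> on the basis;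
  \<open>cover_map\<close> is the case of the identity.\<close>

definition lin_ext :: "'a ring \<Rightarrow> ('a, 'm) module \<Rightarrow> ('x \<Rightarrow> 'm) \<Rightarrow> ('x \<Rightarrow> 'a) \<Rightarrow> 'm" where
  "lin_ext R M \<rho> f = (\<Oplus>\<^bsub>M\<^esub>x\<in>support R f. f x \<odot>\<^bsub>M\<^esub> \<rho> x)"

lemma cover_map_lin_ext: "cover_map R M = lin_ext R M (\<lambda>x. x)"
  by (simp add: fun_eq_iff cover_map_def lin_ext_def)

lemma finsuppD:
  assumes "f \<in> finsupp S M"
  shows "f x \<in> carrier M" and "support M f \<subseteq> S" and "finite (support M f)"
    and "x \<notin> S \<Longrightarrow> f x = \<zero>\<^bsub>M\<^esub>"
  using assms by (auto simp: finsupp_def support_def)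

lemma finsuppI:
  assumes "\<And>x. f x \<in> carrier M" and "finite U" and "U \<subseteq> S" and "\<And>x. x \<notin> U \<Longrightarrow> f x = \<zero>\<^bsub>M\<^esub>"
  shows "f \<in> finsupp S M"
proof -
  have "support M f \<subseteq> U" using assms(4) by (auto simp: support_def)
  then show ?thesis using assms(1-3) finite_subset by (fastforce simp: finsupp_def)
qed

lemma (in abelian_group) finsupp_zero: "(\<lambda>_. \<zero>) \<in> finsupp S G"
  by (rule finsuppI[of _ _ "{}"]) auto

lemma (in abelian_group) finsupp_add:
  assumes "f \<in> finsupp S G" and "g \<in> finsupp S G"
  shows "(\<lambda>x. f x \<oplus> g x) \<in> finsupp S G"
  by (rule finsuppI[of _ _ "support G f \<union> support G g"])
    (use finsuppD[OF assms(1)] finsuppD[OF assms(2)] in \<open>auto simp: support_def\<close>)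

lemma (in abelian_group) finsupp_minus:
  assumes "f \<in> finsupp S G"
  shows "(\<lambda>x. \<ominus> f x) \<in> finsupp S G"
  by (rule finsuppI[of _ _ "support G f"])
    (use finsuppD[OF assms(1)] minus_equality[OF l_zero[OF zero_closed]] in \<open>auto simp: support_def\<close>)

lemma (in abelian_group) single_finsupp:
  "s \<in> S \<Longrightarrow> a \<in> carrier G \<Longrightarrow> single G s a \<in> finsupp S G"
  by (rule finsuppI[of _ _ "{s}"]) (auto simp: single_def)

lemma (in abelian_group) finsupp_induct [consumes 1, case_names zero add]:
  assumes "f \<in> finsupp S G"
    and zero: "Q (\<lambda>_. \<zero>)"
    and add: "\<And>g s a. g \<in> finsupp S G \<Longrightarrow> s \<in> S \<Longrightarrow> a \<in> carrier G \<Longrightarrow> Q g \<Longrightarrow>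
      Q (\<lambda>x. g x \<oplus> single G s a x)"
  shows "Q f"
proof -
  have "finite U \<Longrightarrow> f \<in> finsupp S G \<Longrightarrow> support G f \<subseteq> U \<Longrightarrow> Q f" for U f
  proof (induction U arbitrary: f rule: finite_induct)
    case empty
    then have "f = (\<lambda>_. \<zero>)" by (auto simp: support_def)
    then show ?case using zero by simp
  next
    case (insert s U)
    show ?case
    proof (cases "s \<in> S")
      case True
      define g where "g = f(s := \<zero>)"
      have "g \<in> finsupp S G"
        by (rule finsuppI[of _ _ "support G f"])
          (use finsuppD[OF insert.prems(1)] in \<open>auto simp: g_def support_def\<close>)
      moreover have "support G g \<subseteq> U" using insert.prems(2) by (auto simp: g_def support_def)
      ultimately have "Q (\<lambda>x. g x \<oplus> single G s (f s) x)"
        using insert.IH add True finsuppD(1)[OF insert.prems(1)] by blast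
      moreover have "(\<lambda>x. g x \<oplus> single G s (f s) x) = f"
        using finsuppD(1)[OF insert.prems(1)] by (auto simp: g_def single_def fun_eq_iff)
      ultimately show ?thesis by simp
    next
      case False
      then have "support G f \<subseteq> U" using insert.prems finsuppD(2)[OF insert.prems(1)] by auto
      then show ?thesis using insert.IH insert.prems by blast
    qed
  qed
  then show ?thesis using finsuppD[OF assms(1)] assms(1) by blast
qed

lemma free_module_simps:
  "carrier (free_module R S) = finsupp S R"
  "\<zero>\<^bsub>free_module R S\<^esub> = (\<lambda>_. \<zero>\<^bsub>R\<^esub>)"
  "f \<oplus>\<^bsub>free_module R S\<^esub> g = (\<lambda>x. f x \<oplus>\<^bsub>R\<^esub> g x)"
  "r \<odot>\<^bsub>free_module R S\<^esub> f = (\<lambda>x. r \<otimes>\<^bsub>R\<^esub> f x)"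
  by (simp_all add: free_module_def)

lemma free_module_is_module:
  assumes "cring R"
  shows "module R (free_module R S)"
proof -
  interpret cring R by fact
  have smult: "(\<lambda>x. r \<otimes>\<^bsub>R\<^esub> f x) \<in> finsupp S R" if "r \<in> carrier R" "f \<in> finsupp S R" for r f
    by (rule finsuppI[of _ _ "support R f"]) (use that finsuppD[OF that(2)] in \<open>auto simp: support_def\<close>)
  show ?thesis
  proof (intro moduleI abelian_groupI)
    show "\<exists>g\<in>carrier (free_module R S). g \<oplus>\<^bsub>free_module R S\<^esub> f = \<zero>\<^bsub>free_module R S\<^esub>"
      if "f \<in> carrier (free_module R S)" for f
      using that finsuppD(1)[of f S R] finsupp_minus[of f S]
      by (intro bexI[of _ "\<lambda>x. \<ominus>\<^bsub>R\<^esub> f x"]) (auto simp: free_module_simps l_neg)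
  qed (auto simp: free_module_simps smult finsupp_add finsupp_zero assms finsuppD(1) a_ac
      l_distr r_distr m_assoc fun_eq_iff)
qed

text \<open>Supports change under addition and scaling. Summing over a common finite set above them
  makes the sums comparable.\<close>

lemma lin_ext_mono:
  assumes M: "module R M" and "finite U" and "support R f \<subseteq> U"
    and "\<And>x. x \<in> U \<Longrightarrow> \<rho> x \<in> carrier M" and "\<And>x. f x \<in> carrier R"
  shows "lin_ext R M \<rho> f = (\<Oplus>\<^bsub>M\<^esub>x\<in>U. f x \<odot>\<^bsub>M\<^esub> \<rho> x)"
proof -
  interpret module R M by fact
  show ?thesis unfolding lin_ext_def
    by (rule add.finprod_mono_neutral_cong_left) (use assms in \<open>auto simp: support_def\<close>)
qed

lemma lin_ext_hom:
  assumes M: "module R M" and \<rho>: "\<And>x. x \<in> S \<Longrightarrow> \<rho> x \<in> carrier M"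
  shows "lin_ext R M \<rho> \<in> module_homs R (free_module R S) M"
proof -
  interpret module R M by fact
  interpret F: module R "free_module R S" by (rule free_module_is_module) (rule R.is_cring)
  show ?thesis
  proof (rule module_homsI)
    fix f assume "f \<in> carrier (free_module R S)"
    then have f: "f \<in> finsupp S R" by (simp add: free_module_simps)
    note fD = finsuppD[OF f]
    have \<rho>f: "\<rho> x \<in> carrier M" if "x \<in> support R f" for x using that fD(2) \<rho> by blast
    show "lin_ext R M \<rho> f \<in> carrier M"
      unfolding lin_ext_def using fD \<rho>f by (intro M.finsum_closed) auto
    show "lin_ext R M \<rho> (r \<odot>\<^bsub>free_module R S\<^esub> f) = r \<odot>\<^bsub>M\<^esub> lin_ext R M \<rho> f" if r: "r \<in> carrier R" for r
    proof -
      have "lin_ext R M \<rho> (r \<odot>\<^bsub>free_module R S\<^esub> f)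
          = (\<Oplus>\<^bsub>M\<^esub>x\<in>support R f. (r \<odot>\<^bsub>free_module R S\<^esub> f) x \<odot>\<^bsub>M\<^esub> \<rho> x)"
        by (rule lin_ext_mono[OF M fD(3)]) (use fD \<rho>f r in \<open>auto simp: free_module_simps support_def\<close>)
      also have "\<dots> = (\<Oplus>\<^bsub>M\<^esub>x\<in>support R f. r \<odot>\<^bsub>M\<^esub> (f x \<odot>\<^bsub>M\<^esub> \<rho> x))"
        by (rule M.finsum_cong') (use fD \<rho>f r in \<open>auto simp: free_module_simps smult_assoc1\<close>)
      also have "\<dots> = r \<odot>\<^bsub>M\<^esub> lin_ext R M \<rho> f"
        unfolding lin_ext_def using fD \<rho>f r by (intro finsum_smult_ldistr[symmetric]) auto
      finally show ?thesis .
    qed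
    fix g assume "g \<in> carrier (free_module R S)"
    then have g: "g \<in> finsupp S R" by (simp add: free_module_simps)
    note gD = finsuppD[OF g]
    let ?U = "support R f \<union> support R g"
    have \<rho>U: "\<rho> x \<in> carrier M" if "x \<in> ?U" for x using that fD(2) gD(2) \<rho> by blast
    have U: "finite ?U" using fD gD by simp
    have "lin_ext R M \<rho> (f \<oplus>\<^bsub>free_module R S\<^esub> g)
        = (\<Oplus>\<^bsub>M\<^esub>x\<in>?U. (f \<oplus>\<^bsub>free_module R S\<^esub> g) x \<odot>\<^bsub>M\<^esub> \<rho> x)"
      by (rule lin_ext_mono[OF M U]) (use fD(1) gD(1) \<rho>U in \<open>auto simp: free_module_simps support_def\<close>)
    also have "\<dots> = (\<Oplus>\<^bsub>M\<^esub>x\<in>?U. f x \<odot>\<^bsub>M\<^esub> \<rho> x \<oplus>\<^bsub>M\<^esub> g x \<odot>\<^bsub>M\<^esub> \<rho> x)"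
      by (rule M.finsum_cong') (use fD(1) gD(1) \<rho>U in \<open>auto simp: free_module_simps smult_l_distr\<close>)
    also have "\<dots> = (\<Oplus>\<^bsub>M\<^esub>x\<in>?U. f x \<odot>\<^bsub>M\<^esub> \<rho> x) \<oplus>\<^bsub>M\<^esub> (\<Oplus>\<^bsub>M\<^esub>x\<in>?U. g x \<odot>\<^bsub>M\<^esub> \<rho> x)"
      by (rule M.finsum_addf) (use fD(1) gD(1) \<rho>U in auto)
    also have "(\<Oplus>\<^bsub>M\<^esub>x\<in>?U. f x \<odot>\<^bsub>M\<^esub> \<rho> x) = lin_ext R M \<rho> f"
      by (rule lin_ext_mono[OF M U, symmetric]) (use fD(1) \<rho>U in auto)
    also have "(\<Oplus>\<^bsub>M\<^esub>x\<in>?U. g x \<odot>\<^bsub>M\<^esub> \<rho> x) = lin_ext R M \<rho> g"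
      by (rule lin_ext_mono[OF M U, symmetric]) (use gD(1) \<rho>U in auto)
    finally show "lin_ext R M \<rho> (f \<oplus>\<^bsub>free_module R S\<^esub> g) = lin_ext R M \<rho> f \<oplus>\<^bsub>M\<^esub> lin_ext R M \<rho> g" .
  qed
qed

lemma lin_ext_single:
  assumes M: "module R M" and "\<rho> s \<in> carrier M"
  shows "lin_ext R M \<rho> (single R s \<one>\<^bsub>R\<^esub>) = \<rho> s"
proof -
  interpret module R M by fact
  have "lin_ext R M \<rho> (single R s \<one>\<^bsub>R\<^esub>) = (\<Oplus>\<^bsub>M\<^esub>x\<in>{s}. single R s \<one>\<^bsub>R\<^esub> x \<odot>\<^bsub>M\<^esub> \<rho> x)"
    by (rule lin_ext_mono[OF M]) (use assms in \<open>auto simp: single_def support_def\<close>)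
  also have "\<dots> = \<rho> s" using assms(2) by (simp add: single_def)
  finally show ?thesis .
qed

lemma free_module_hom_eqI:
  assumes M: "module R M" and g: "g \<in> module_homs R (free_module R S) M"
    and h: "h \<in> module_homs R (free_module R S) M"
    and eq: "\<And>s. s \<in> S \<Longrightarrow> g (single R s \<one>\<^bsub>R\<^esub>) = h (single R s \<one>\<^bsub>R\<^esub>)"
    and f: "f \<in> carrier (free_module R S)"
  shows "g f = h f"
proof -
  interpret module R M by fact
  have F: "module R (free_module R S)" by (rule free_module_is_module) (rule R.is_cring)
  have "f \<in> finsupp S R" using f by (simp add: free_module_simps)
  then show ?thesis
  proof (induction rule: R.finsupp_induct)
    case zero
    then show ?case
      using module_homs_zero_minus(1)[OF F M g] module_homs_zero_minus(1)[OF F M h]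
      by (simp add: free_module_simps)
  next
    case (add f s a)
    let ?e = "single R s \<one>\<^bsub>R\<^esub>"
    have e: "?e \<in> carrier (free_module R S)" using add by (simp add: free_module_simps R.single_finsupp)
    have sum: "(\<lambda>x. f x \<oplus>\<^bsub>R\<^esub> single R s a x) = f \<oplus>\<^bsub>free_module R S\<^esub> a \<odot>\<^bsub>free_module R S\<^esub> ?e"
      using add by (auto simp: free_module_simps single_def)
    have "\<phi> (\<lambda>x. f x \<oplus>\<^bsub>R\<^esub> single R s a x) = \<phi> f \<oplus>\<^bsub>M\<^esub> a \<odot>\<^bsub>M\<^esub> \<phi> ?e"
      if "\<phi> \<in> module_homs R (free_module R S) M" for \<phi>
    proof -
      have "f \<in> carrier (free_module R S)" using add by (simp add: free_module_simps)
      then show ?thesis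
        unfolding sum module_homs_smult[OF that add(3) e, symmetric]
        by (rule module_homs_add[OF that _ module.smult_closed[OF F add(3) e]])
    qed
    from this[OF g] this[OF h] show ?case using eq add by simp
  qed
qed

lemma cover_is_module: "cring R \<Longrightarrow> module R (cover R M)"
  unfolding cover_def by (rule free_module_is_module)

lemma cover_map_hom: "module R M \<Longrightarrow> cover_map R M \<in> module_homs R (cover R M) M"
  unfolding cover_def cover_map_lin_ext by (rule lin_ext_hom)

lemma single_in_cover:
  assumes "cring R" and "x \<in> carrier M"
  shows "single R x \<one>\<^bsub>R\<^esub> \<in> carrier (cover R M)"
proof -
  interpret cring R by fact
  show ?thesis using assms by (simp add: cover_def free_module_simps single_finsupp)
qed

lemma cover_map_single:
  "module R M \<Longrightarrow> x \<in> carrier M \<Longrightarrow> cover_map R M (single R x \<one>\<^bsub>R\<^esub>) = x"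
  unfolding cover_map_lin_ext by (rule lin_ext_single)

lemma cover_map_surj:
  assumes "module R M"
  shows "cover_map R M ` carrier (cover R M) = carrier M"
  using module_homs_closed[OF cover_map_hom[OF assms]] cover_map_single[OF assms]
    single_in_cover[OF module.axioms(1)[OF assms]] by (metis (no_types, lifting) image_eqI image_subsetI subsetI subset_antisym)

lemma syzygy_carrier:
  "carrier (syzygy R M) = {f \<in> carrier (cover R M). cover_map R M f = \<zero>\<^bsub>M\<^esub>}"
  by (simp add: syzygy_def a_kernel_def')

lemma syzygy_is_module:
  assumes "module R M"
  shows "module R (syzygy R M)"
  unfolding syzygy_def
  by (intro submodule.submodule_is_module module_homs_kernel_submodule cover_is_module cover_map_hom
      assms module.axioms(1)[OF assms])

lemma syzygy_ops:
  "\<zero>\<^bsub>syzygy R M\<^esub> = \<zero>\<^bsub>cover R M\<^esub>" "f \<oplus>\<^bsub>syzygy R M\<^esub> g = f \<oplus>\<^bsub>cover R M\<^esub> g"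
  "r \<odot>\<^bsub>syzygy R M\<^esub> f = r \<odot>\<^bsub>cover R M\<^esub> f"
  by (simp_all add: syzygy_def)

section \<open>Ext in degree one from a presentation\<close>

text \<open>As \<open>d2\<close> maps onto the kernel of \<open>d1\<close>, the condition that
  \<phi> o d2 vanishes says that \<phi> vanishes on this kernel, that is, factors through the
  syzygy. In this form the second syzygy disappears from all later arguments.\<close>

definition Ext1_cocycles :: "'a ring \<Rightarrow> ('a, 'm) module \<Rightarrow> ('a, 'k) module \<Rightarrow> ((('m \<Rightarrow> 'a) \<Rightarrow> 'a) \<Rightarrow> 'k) set" where
  "Ext1_cocycles R M N =
    {\<phi> \<in> carrier (Hom_module R (cover R (syzygy R M)) N).
      \<forall>g\<in>carrier (cover R (syzygy R M)). cover_map R (syzygy R M) g = \<zero>\<^bsub>syzygy R M\<^esub> \<longrightarrow> \<phi> g = \<zero>\<^bsub>N\<^esub>}"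

definition Ext1_boundaries :: "'a ring \<Rightarrow> ('a, 'm) module \<Rightarrow> ('a, 'k) module \<Rightarrow> ((('m \<Rightarrow> 'a) \<Rightarrow> 'a) \<Rightarrow> 'k) set" where
  "Ext1_boundaries R M N =
    (\<lambda>\<phi>. compose (carrier (cover R (syzygy R M))) \<phi> (cover_map R (syzygy R M))) ` carrier (Hom_module R (cover R M) N)"

lemma
  assumes M: "module R M" and N: "module R N"
  shows Ext1_cocycles_submodule:
      "submodule (Ext1_cocycles R M N) R (Hom_module R (cover R (syzygy R M)) N)"
    and Ext1_eq_cocycles_mod_boundaries:
      "Ext1 R M N = quotient_module
        (Hom_module R (cover R (syzygy R M)) N\<lparr>carrier := Ext1_cocycles R M N\<rparr>) (Ext1_boundaries R M N)"
proof -
  note cring = module.axioms(1)[OF M]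
  let ?K = "syzygy R M"
  let ?K2 = "syzygy R ?K"
  note K = syzygy_is_module[OF M]
  note K2 = syzygy_is_module[OF K]
  let ?d2 = "cover_map R ?K2"
  let ?F1 = "cover R ?K" and ?F2 = "cover R ?K2"
  let ?C1 = "Hom_module R ?F1 N" and ?C2 = "Hom_module R ?F2 N"
  note F1 = cover_is_module[OF cring, of ?K]
  note F2 = cover_is_module[OF cring, of ?K2]
  have d2: "?d2 \<in> module_homs R ?F2 ?F1"
    using cover_map_hom[OF K2] by (auto simp: module_homs_def Pi_iff syzygy_carrier syzygy_ops)
  let ?pre = "\<lambda>\<phi>. compose (carrier ?F2) \<phi> ?d2"
  have pre: "?pre \<in> module_homs R ?C1 ?C2" by (rule Hom_module_precompose[OF F2 F1 d2])
  have eq: "a_kernel ?C1 ?C2 ?pre = Ext1_cocycles R M N"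
  proof -
    have "?pre \<phi> = \<zero>\<^bsub>?C2\<^esub> \<longleftrightarrow> (\<forall>g\<in>carrier ?F1. cover_map R ?K g = \<zero>\<^bsub>?K\<^esub> \<longrightarrow> \<phi> g = \<zero>\<^bsub>N\<^esub>)" for \<phi>
    proof -
      have "?pre \<phi> = \<zero>\<^bsub>?C2\<^esub> \<longleftrightarrow> (\<forall>g\<in>carrier ?F2. \<phi> (?d2 g) = \<zero>\<^bsub>N\<^esub>)"
        by (auto simp: compose_def Hom_module_simps fun_eq_iff)
      also have "\<dots> \<longleftrightarrow> (\<forall>g\<in>carrier ?K2. \<phi> g = \<zero>\<^bsub>N\<^esub>)"
        unfolding cover_map_surj[OF K2, symmetric] by simp
      finally show ?thesis by (auto simp: syzygy_carrier[of R ?K])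
    qed
    then show ?thesis by (auto simp: a_kernel_def' Ext1_cocycles_def)
  qed
  show "submodule (Ext1_cocycles R M N) R ?C1"
    using module_homs_kernel_submodule[OF Hom_module_is_module[OF F1 N] Hom_module_is_module[OF F2 N] pre]
    by (simp add: eq)
  show "Ext1 R M N = quotient_module (?C1\<lparr>carrier := Ext1_cocycles R M N\<rparr>) (Ext1_boundaries R M N)"
    by (simp add: Ext1_def Let_def eq Ext1_boundaries_def)
qed

lemma Ext1_boundaries_submodule:
  assumes M: "module R M" and N: "module R N"
  shows "submodule (Ext1_boundaries R M N) R
    (Hom_module R (cover R (syzygy R M)) N\<lparr>carrier := Ext1_cocycles R M N\<rparr>)"
proof -
  note cring = module.axioms(1)[OF M]
  let ?K = "syzygy R M"
  note K = syzygy_is_module[OF M]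
  let ?F0 = "cover R M" and ?F1 = "cover R ?K"
  let ?C1 = "Hom_module R ?F1 N"
  note F0 = cover_is_module[OF cring, of M] and F1 = cover_is_module[OF cring, of ?K]
  have d1: "cover_map R ?K \<in> module_homs R ?F1 ?F0"
    using cover_map_hom[OF K] by (auto simp: module_homs_def Pi_iff syzygy_carrier syzygy_ops)
  let ?pre = "\<lambda>\<phi>. compose (carrier ?F1) \<phi> (cover_map R ?K)"
  have pre: "?pre \<in> module_homs R (Hom_module R ?F0 N) ?C1" by (rule Hom_module_precompose[OF F1 F0 d1])
  have "?pre \<phi> \<in> Ext1_cocycles R M N" if "\<phi> \<in> carrier (Hom_module R ?F0 N)" for \<phi>
    using module_homs_closed[OF pre that] that module_homs_zero_minus(1)[OF F0 N, of \<phi>]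
    by (auto simp: Ext1_cocycles_def compose_def syzygy_ops Hom_module_simps)
  then have "?pre \<in> module_homs R (Hom_module R ?F0 N) (?C1\<lparr>carrier := Ext1_cocycles R M N\<rparr>)"
    by (rule module_homs_restrict_codomain[OF pre])
  then show ?thesis unfolding Ext1_boundaries_def
    by (intro module_homs_image_submodule submodule.submodule_is_module Ext1_cocycles_submodule
        Hom_module_is_module F0 F1 M N)
qed

text \<open>
  The hypothesis \<open>ext\<close> says that the first Ext of \<open>P\<close> into \<open>N\<close> vanishes, so that the long
  exact sequence of \<open>0 \<rightarrow> L \<rightarrow> P \<rightarrow> P/L \<rightarrow> 0\<close> ends in \<open>Hom(P,N) \<rightarrow> Hom(L,N) \<rightarrow> Ext(P/L,N) \<rightarrow> 0\<close>.
\<close>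

lemma Ext1_quotient:
  fixes R :: "'a ring" and P :: "('a, 'p) module" and N :: "('a, 'k) module" and L :: "'p set"
  defines "Q \<equiv> quotient_module P L"
  defines "C \<equiv> Hom_module R (cover R (syzygy R Q)) N\<lparr>carrier := Ext1_cocycles R Q N\<rparr>"
  defines "B \<equiv> Ext1_boundaries R Q N"
  defines "PL \<equiv> P\<lparr>carrier := L\<rparr>"
  assumes P: "module R P" and L: "submodule L R P" and N: "module R N"
    and ext: "\<And>\<theta>. \<theta> \<in> module_homs R (syzygy R P) N \<Longrightarrow>
      \<exists>h\<in>module_homs R (cover R P) N. \<forall>k\<in>carrier (syzygy R P). h k = \<theta> k"
  obtains f where "f \<in> module_homs R (Hom_module R PL N) C"
    and "\<And>\<phi>. \<phi> \<in> carrier (Hom_module R PL N) \<Longrightarrow>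
      f \<phi> \<in> B \<longleftrightarrow> (\<exists>\<Psi>\<in>carrier (Hom_module R P N). \<forall>l\<in>L. \<Psi> l = \<phi> l)"
    and "\<And>c. c \<in> carrier C \<Longrightarrow> \<exists>\<phi>\<in>carrier (Hom_module R PL N). c \<ominus>\<^bsub>C\<^esub> f \<phi> \<in> B"
proof -
  interpret P: module R P by fact
  interpret N: module R N by fact
  note cring = P.R.is_cring
  have LP: "L \<subseteq> carrier P" by (rule P.submoduleE(1)[OF L])
  have PLm: "module R PL" unfolding PL_def by (rule submodule.submodule_is_module[OF L P])
  have Q: "module R Q" unfolding Q_def by (rule quotient_is_module[OF P L])
  define \<pi> where "\<pi> = (\<lambda>x. L +>\<^bsub>P\<^esub> x)"
  have \<pi>: "\<pi> \<in> module_homs R P Q" unfolding \<pi>_def Q_def by (rule quotient_proj[OF P L])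
  have \<pi>0: "\<pi> x = \<zero>\<^bsub>Q\<^esub> \<longleftrightarrow> x \<in> L" if "x \<in> carrier P" for x
    using quotient_proj_zero_iff[OF P L that] by (simp add: \<pi>_def Q_def quotient_module_simps)
  define rep where "rep = (\<lambda>m. SOME x. x \<in> carrier P \<and> \<pi> x = m)"
  have rep: "rep m \<in> carrier P \<and> \<pi> (rep m) = m" if "m \<in> carrier Q" for m
    unfolding rep_def by (rule someI_ex) (use that in \<open>auto simp: Q_def \<pi>_def quotient_module_simps\<close>)
  let ?F0 = "cover R Q" and ?K = "syzygy R Q" and ?F1 = "cover R (syzygy R Q)" and ?FP = "cover R P"
  let ?C1 = "Hom_module R ?F1 N"
  let ?d = "cover_map R ?K" and ?\<epsilon> = "cover_map R Q" and ?q = "cover_map R P"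
  note K = syzygy_is_module[OF Q]
  note F0 = cover_is_module[OF cring, of Q] and F1 = cover_is_module[OF cring, of ?K]
    and FP = cover_is_module[OF cring, of P]
  interpret F0: module R ?F0 by (rule F0)
  interpret FP: module R ?FP by (rule FP)
  interpret K: module R ?K by (rule K)
  interpret PL: module R PL by (rule PLm)
  note d = cover_map_hom[OF K] and \<epsilon> = cover_map_hom[OF Q] and q = cover_map_hom[OF P]
  let ?e = "\<lambda>x. single R x \<one>\<^bsub>R\<^esub>"
  \<comment> \<open>The two covers are compared: \<open>t\<close> lifts the projection \<pi>, and
    \<open>s\<close> lifts a choice of representatives. The choice need not be linear on P/L, but on
    a free module it extends linearly, and t o s is the identity.\<close>
  define s where "s = lin_ext R ?FP (\<lambda>m. ?e (rep m))"
  define t where "t = lin_ext R ?F0 (\<lambda>p. ?e (\<pi> p))"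
  have s: "s \<in> module_homs R ?F0 ?FP"
    unfolding s_def cover_def[of R Q] by (rule lin_ext_hom[OF FP]) (simp add: rep single_in_cover cring)
  have t: "t \<in> module_homs R ?FP ?F0"
    unfolding t_def cover_def[of R P]
    by (rule lin_ext_hom[OF F0]) (simp add: single_in_cover cring module_homs_closed[OF \<pi>])
  have s_single: "s (?e m) = ?e (rep m)" if "m \<in> carrier Q" for m
    unfolding s_def using that by (intro lin_ext_single[OF FP]) (simp add: rep single_in_cover cring)
  have t_single: "t (?e p) = ?e (\<pi> p)" if "p \<in> carrier P" for p
    unfolding t_def using that
    by (intro lin_ext_single[OF F0]) (simp add: single_in_cover cring module_homs_closed[OF \<pi>])
  have ts: "t (s f) = f" if "f \<in> carrier ?F0" for f
  proof (rule free_module_hom_eqI[OF F0, where g = "\<lambda>f. t (s f)" and h = "\<lambda>f. f" and S = "carrier Q"])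
    show "(\<lambda>f. t (s f)) \<in> module_homs R (free_module R (carrier Q)) ?F0"
      using module_homs_comp[OF s t] by (simp add: cover_def)
    show "(\<lambda>f. f) \<in> module_homs R (free_module R (carrier Q)) ?F0"
      by (auto simp: module_homs_def cover_def)
  qed (use that in \<open>auto simp: s_single t_single rep cover_def\<close>)
  have \<epsilon>t: "?\<epsilon> (t g) = \<pi> (?q g)" if "g \<in> carrier ?FP" for g
  proof (rule free_module_hom_eqI[OF Q, where g = "\<lambda>g. ?\<epsilon> (t g)" and h = "\<lambda>g. \<pi> (?q g)" and S = "carrier P"])
    show "(\<lambda>g. ?\<epsilon> (t g)) \<in> module_homs R (free_module R (carrier P)) Q"
      using module_homs_comp[OF t \<epsilon>] by (simp add: cover_def)
    show "(\<lambda>g. \<pi> (?q g)) \<in> module_homs R (free_module R (carrier P)) Q"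
      using module_homs_comp[OF q \<pi>] by (simp add: cover_def)
  qed (use that in \<open>auto simp: t_single cover_map_single P Q module_homs_closed[OF \<pi>] cover_def\<close>)
  \<comment> \<open>A lift to \<open>P\<close> of the cover of P/L. On the relations of P/L it takes
    values in \<open>L\<close>, so a homomorphism on \<open>L\<close> pulls back to the syzygy;
    \<open>f\<close> below is the connecting homomorphism in terms of cocycles.\<close>
  define \<alpha> where "\<alpha> = (\<lambda>f. ?q (s f))"
  have \<alpha>: "\<alpha> \<in> module_homs R ?F0 P" unfolding \<alpha>_def by (rule module_homs_comp[OF s q])
  have \<pi>\<alpha>: "\<pi> (\<alpha> f) = ?\<epsilon> f" if "f \<in> carrier ?F0" for f
    using \<epsilon>t[of "s f"] ts that by (simp add: \<alpha>_def module_homs_closed[OF s])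
  have tK: "t g \<in> carrier ?K" if "g \<in> carrier ?FP" "?q g \<in> L" for g
    using that \<epsilon>t[of g] \<pi>0[of "?q g"] LP by (auto simp: syzygy_carrier module_homs_closed[OF t])
  have KF0: "carrier ?K \<subseteq> carrier ?F0" by (auto simp: syzygy_carrier)
  have \<alpha>K: "\<alpha> k \<in> L" if "k \<in> carrier ?K" for k
    using that \<pi>\<alpha>[of k] \<pi>0[of "\<alpha> k"] by (auto simp: syzygy_carrier module_homs_closed[OF \<alpha>])
  have \<alpha>KL: "\<alpha> \<in> module_homs R ?K PL"
    unfolding PL_def using \<alpha>K KF0
    by (auto simp: module_homs_def syzygy_ops Pi_iff module_homs_add[OF \<alpha>] module_homs_smult[OF \<alpha>] subset_iff)
  define f :: "('p \<Rightarrow> 'k) \<Rightarrow> _" where "f = (\<lambda>\<phi>. compose (carrier ?F1) \<phi> (\<lambda>g. \<alpha> (?d g)))"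
  have f1: "f \<in> module_homs R (Hom_module R PL N) ?C1"
    unfolding f_def by (rule Hom_module_precompose[OF F1 PLm module_homs_comp[OF d \<alpha>KL]])
  have f_apply: "f \<phi> g = \<phi> (\<alpha> (?d g))" if "g \<in> carrier ?F1" for \<phi> g
    using that by (simp add: f_def compose_def)
  have \<phi>hom: "\<phi> \<in> module_homs R PL N" if "\<phi> \<in> carrier (Hom_module R PL N)" for \<phi>
    using that by (simp add: Hom_module_simps)
  have fC: "f \<in> module_homs R (Hom_module R PL N) C"
    unfolding C_def
  proof (rule module_homs_restrict_codomain[OF f1])
    fix \<phi> assume \<phi>: "\<phi> \<in> carrier (Hom_module R PL N)"
    have "\<phi> (\<alpha> \<zero>\<^bsub>?K\<^esub>) = \<zero>\<^bsub>N\<^esub>"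
      using module_homs_zero_minus(1)[OF K N module_homs_comp[OF \<alpha>KL \<phi>hom[OF \<phi>]]] .
    then show "f \<phi> \<in> Ext1_cocycles R Q N"
      using module_homs_closed[OF f1 \<phi>] by (simp add: Ext1_cocycles_def f_apply)
  qed
  \<comment> \<open>A boundary is a map that comes, through \<open>?d\<close>, from a homomorphism
    on the whole cover of P/L. The witness \<chi> is freed from being extensional, as only its
    values on the cover matter.\<close>
  have B_iff: "c \<in> B \<longleftrightarrow> (\<exists>\<chi>\<in>module_homs R ?F0 N. \<forall>g\<in>carrier ?F1. c g = \<chi> (?d g))"
    if c: "c \<in> carrier ?C1" for c
  proof
    assume "c \<in> B"
    then show "\<exists>\<chi>\<in>module_homs R ?F0 N. \<forall>g\<in>carrier ?F1. c g = \<chi> (?d g)"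
      by (auto simp: B_def Ext1_boundaries_def compose_def Hom_module_simps)
  next
    assume "\<exists>\<chi>\<in>module_homs R ?F0 N. \<forall>g\<in>carrier ?F1. c g = \<chi> (?d g)"
    then obtain \<chi> where \<chi>: "\<chi> \<in> module_homs R ?F0 N" "\<And>g. g \<in> carrier ?F1 \<Longrightarrow> c g = \<chi> (?d g)" by blast
    have "c = compose (carrier ?F1) (restrict \<chi> (carrier ?F0)) ?d"
      using c \<chi>(2) KF0 module_homs_closed[OF d]
      by (auto simp: fun_eq_iff compose_def Hom_module_simps extensional_def subset_iff)
    then show "c \<in> B" unfolding B_def Ext1_boundaries_def
      using restrict_module_homs[OF F0 \<chi>(1)] by blast
  qed
  have d_surj: "(\<forall>g\<in>carrier ?F1. \<Phi> (?d g)) \<longleftrightarrow> (\<forall>k\<in>carrier ?K. \<Phi> k)" for \<Phi>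
    unfolding cover_map_surj[OF K, symmetric] by simp
  show thesis
  proof (rule that[OF fC])
    fix \<phi> assume \<phi>C: "\<phi> \<in> carrier (Hom_module R PL N)"
    note \<phi> = \<phi>hom[OF \<phi>C]
    have "f \<phi> \<in> B \<longleftrightarrow> (\<exists>\<chi>\<in>module_homs R ?F0 N. \<forall>g\<in>carrier ?F1. \<phi> (\<alpha> (?d g)) = \<chi> (?d g))"
      using B_iff[OF module_homs_closed[OF f1 \<phi>C]] by (simp add: f_apply)
    also have "\<dots> \<longleftrightarrow> (\<exists>\<chi>\<in>module_homs R ?F0 N. \<forall>k\<in>carrier ?K. \<phi> (\<alpha> k) = \<chi> k)"
      by (intro bex_cong refl d_surj[of "\<lambda>k. \<phi> (\<alpha> k) = \<chi> k" for \<chi>])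
    also have "\<dots> \<longleftrightarrow> (\<exists>\<Psi>\<in>carrier (Hom_module R P N). \<forall>l\<in>L. \<Psi> l = \<phi> l)"
    proof
      assume "\<exists>\<chi>\<in>module_homs R ?F0 N. \<forall>k\<in>carrier ?K. \<phi> (\<alpha> k) = \<chi> k"
      then obtain \<chi> where \<chi>: "\<chi> \<in> module_homs R ?F0 N" and \<chi>K: "\<And>k. k \<in> carrier ?K \<Longrightarrow> \<phi> (\<alpha> k) = \<chi> k"
        by blast
      \<comment> \<open>\<open>?q g\<close> and \<open>\<alpha> (t g)\<close> have the same class in
        P/L, so \<open>r g\<close> lies in \<open>L\<close> and \<phi> applies to it. Together with
        \<chi> on the other summand this extends \<phi> o q from the preimage of \<open>L\<close> to
        the whole cover of \<open>P\<close>, and the extension descends to \<Psi>.\<close>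
      define r where "r = (\<lambda>g. ?q g \<ominus>\<^bsub>P\<^esub> \<alpha> (t g))"
      have rP: "r \<in> module_homs R ?FP P"
        unfolding r_def by (rule module_homs_diff[OF FP P q module_homs_comp[OF t \<alpha>]])
      have "r g \<in> L" if "g \<in> carrier ?FP" for g
      proof -
        have "\<pi> (r g) = \<zero>\<^bsub>Q\<^esub>"
          using that \<epsilon>t[OF that] \<pi>\<alpha>[of "t g"] abelian_group.diff_eq_zero_iff[OF module.axioms(2)[OF Q]]
          by (simp add: r_def module_homs_zero_minus[OF P Q \<pi>] module_homs_closed[OF q] module_homs_closed[OF \<alpha>]
              module_homs_closed[OF t] module_homs_closed[OF \<epsilon>] module_homs_closed[OF \<pi>])
        then show ?thesis using \<pi>0 module_homs_closed[OF rP that] by simp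
      qed
      then have r: "r \<in> module_homs R ?FP PL" unfolding PL_def by (rule module_homs_restrict_codomain[OF rP])
      have z: "(\<lambda>g. \<phi> (r g) \<oplus>\<^bsub>N\<^esub> \<chi> (t g)) \<in> module_homs R ?FP N"
        by (rule module_homs_add_fun[OF FP N module_homs_comp[OF r \<phi>] module_homs_comp[OF t \<chi>]])
      have r_eq: "\<phi> (r g) \<oplus>\<^bsub>N\<^esub> \<chi> (t g) = \<phi> (?q g)" if g: "g \<in> carrier ?FP" "?q g \<in> L" for g
      proof -
        have \<alpha>t: "\<alpha> (t g) \<in> L" by (rule \<alpha>K[OF tK[OF g]])
        have "r g \<oplus>\<^bsub>P\<^esub> \<alpha> (t g) = ?q g"
          using LP g(2) \<alpha>t by (auto simp: r_def P.minus_eq P.a_assoc P.l_neg subset_iff)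
        moreover have "\<phi> (r g \<oplus>\<^bsub>PL\<^esub> \<alpha> (t g)) = \<phi> (r g) \<oplus>\<^bsub>N\<^esub> \<phi> (\<alpha> (t g))"
          by (rule module_homs_add[OF \<phi>]) (use \<alpha>t module_homs_closed[OF r g(1)] in \<open>simp_all add: PL_def\<close>)
        ultimately show ?thesis using \<chi>K[OF tK[OF g]] by (simp add: PL_def)
      qed
      obtain \<Psi> where \<Psi>: "\<Psi> \<in> carrier (Hom_module R P N)"
        and \<Psi>q: "\<And>g. g \<in> carrier ?FP \<Longrightarrow> \<Psi> (?q g) = \<phi> (r g) \<oplus>\<^bsub>N\<^esub> \<chi> (t g)"
      proof (rule module_homs_factor[OF FP P N q cover_map_surj[OF P] z])
        show "\<phi> (r g) \<oplus>\<^bsub>N\<^esub> \<chi> (t g) = \<zero>\<^bsub>N\<^esub>" if "g \<in> carrier ?FP" "?q g = \<zero>\<^bsub>P\<^esub>" for g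
          using r_eq[OF that(1)] that(2) PL.zero_closed module_homs_zero_minus(1)[OF PLm N \<phi>]
          by (simp add: PL_def)
      qed blast
      have "\<Psi> l = \<phi> l" if "l \<in> L" for l
      proof -
        have l: "l \<in> carrier P" using that LP by blast
        have "\<Psi> (?q (?e l)) = \<phi> (?q (?e l))"
          using \<Psi>q[of "?e l"] r_eq[of "?e l"] single_in_cover[OF cring l] that
          by (simp add: cover_map_single[OF P l])
        then show ?thesis by (simp add: cover_map_single[OF P l])
      qed
      then show "\<exists>\<Psi>\<in>carrier (Hom_module R P N). \<forall>l\<in>L. \<Psi> l = \<phi> l" using \<Psi> by blast
    next
      assume "\<exists>\<Psi>\<in>carrier (Hom_module R P N). \<forall>l\<in>L. \<Psi> l = \<phi> l"
      then obtain \<Psi> where \<Psi>: "\<Psi> \<in> module_homs R P N" "\<forall>l\<in>L. \<Psi> l = \<phi> l" by (auto simp: Hom_module_simps)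
      then show "\<exists>\<chi>\<in>module_homs R ?F0 N. \<forall>k\<in>carrier ?K. \<phi> (\<alpha> k) = \<chi> k"
        using module_homs_comp[OF \<alpha> \<Psi>(1)] \<alpha>K by (intro bexI[of _ "\<lambda>f. \<Psi> (\<alpha> f)"]) auto
    qed
    finally show "f \<phi> \<in> B \<longleftrightarrow> (\<exists>\<Psi>\<in>carrier (Hom_module R P N). \<forall>l\<in>L. \<Psi> l = \<phi> l)" .
  next
    fix c assume c: "c \<in> carrier C"
    then have c1: "c \<in> carrier ?C1" and ch: "c \<in> module_homs R ?F1 N"
      and c0: "\<And>g. g \<in> carrier ?F1 \<Longrightarrow> ?d g = \<zero>\<^bsub>?K\<^esub> \<Longrightarrow> c g = \<zero>\<^bsub>N\<^esub>"
      by (auto simp: C_def Ext1_cocycles_def Hom_module_simps)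
    obtain \<theta> where \<theta>C: "\<theta> \<in> carrier (Hom_module R ?K N)"
      and \<theta>d: "\<And>g. g \<in> carrier ?F1 \<Longrightarrow> \<theta> (?d g) = c g"
      using module_homs_factor[OF F1 K N d cover_map_surj[OF K] ch c0] by blast
    then have \<theta>: "\<theta> \<in> module_homs R ?K N" by (simp add: Hom_module_simps)
    \<comment> \<open>On the preimage of \<open>L\<close> in the cover of \<open>P\<close> the map
      \<theta> o t is defined, but it need not vanish on the relations of \<open>P\<close>. By
      \<open>ext\<close>, its restriction to these relations extends to some \<open>h\<close>, and
      after subtracting \<open>h\<close> the map descends to \<phi> on \<open>L\<close>.\<close>
    define LF where "LF = {g \<in> carrier ?FP. ?q g \<in> L}"
    have LF_kernel: "LF = a_kernel ?FP Q (\<lambda>g. \<pi> (?q g))"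
      unfolding LF_def a_kernel_def'
      by (intro Collect_cong conj_cong refl \<pi>0[symmetric] module_homs_closed[OF q])
    have LF: "submodule LF R ?FP"
      unfolding LF_kernel by (rule module_homs_kernel_submodule[OF FP Q module_homs_comp[OF q \<pi>]])
    note LFm = submodule.submodule_is_module[OF LF FP]
    have tLF: "t \<in> module_homs R (?FP\<lparr>carrier := LF\<rparr>) ?K"
      using module_homs_restrict_domain[OF t, of LF] tK
      by (auto simp: module_homs_def LF_def Pi_iff syzygy_ops)
    have "carrier (syzygy R P) \<subseteq> LF"
      using PL.zero_closed by (auto simp: syzygy_carrier LF_def PL_def)
    then have "t \<in> module_homs R (syzygy R P) ?K"
      using tLF by (auto simp: module_homs_def Pi_iff syzygy_ops subset_iff)
    from ext[OF module_homs_comp[OF this \<theta>]]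
    obtain h where h: "h \<in> module_homs R ?FP N"
      and h_eq: "\<And>k. k \<in> carrier (syzygy R P) \<Longrightarrow> h k = \<theta> (t k)" by blast
    have hLF: "h \<in> module_homs R (?FP\<lparr>carrier := LF\<rparr>) N"
      by (rule module_homs_restrict_domain[OF h]) (auto simp: LF_def)
    have z: "(\<lambda>g. \<theta> (t g) \<ominus>\<^bsub>N\<^esub> h g) \<in> module_homs R (?FP\<lparr>carrier := LF\<rparr>) N"
      by (rule module_homs_diff[OF LFm N module_homs_comp[OF tLF \<theta>] hLF])
    have qLF: "?q \<in> module_homs R (?FP\<lparr>carrier := LF\<rparr>) PL"
      unfolding PL_def
      by (rule module_homs_restrict_codomain[OF module_homs_restrict_domain[OF q]]) (auto simp: LF_def)
    have q_surj: "?q ` carrier (?FP\<lparr>carrier := LF\<rparr>) = carrier PL"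
      using LP cover_map_surj[OF P] by (auto simp: LF_def PL_def image_iff set_eq_iff subset_iff) metis
    obtain \<phi> where \<phi>C: "\<phi> \<in> carrier (Hom_module R PL N)"
      and \<phi>q: "\<And>g. g \<in> carrier (?FP\<lparr>carrier := LF\<rparr>) \<Longrightarrow> \<phi> (?q g) = \<theta> (t g) \<ominus>\<^bsub>N\<^esub> h g"
    proof (rule module_homs_factor[OF LFm PLm N qLF q_surj z])
      fix g assume g: "g \<in> carrier (?FP\<lparr>carrier := LF\<rparr>)" "?q g = \<zero>\<^bsub>PL\<^esub>"
      then have "g \<in> carrier (syzygy R P)" by (simp add: syzygy_carrier PL_def LF_def)
      from h_eq[OF this] show "\<theta> (t g) \<ominus>\<^bsub>N\<^esub> h g = \<zero>\<^bsub>N\<^esub>"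
        using module_homs_closed[OF hLF g(1)] by (simp add: N.diff_eq_zero_iff)
    qed blast
    have "c \<ominus>\<^bsub>C\<^esub> f \<phi> \<in> B"
    proof -
      have diff: "c \<ominus>\<^bsub>C\<^esub> f \<phi> = c \<ominus>\<^bsub>?C1\<^esub> f \<phi>"
        using submodule_minus[OF Hom_module_is_module[OF F1 N] Ext1_cocycles_submodule[OF Q N]] c
          module_homs_closed[OF fC \<phi>C] by (simp add: C_def)
      \<comment> \<open>As t o s is the identity, \<open>c g\<close> is \<theta> o t at
        \<open>s (?d g)\<close>, so only the correction \<open>h (s (?d g))\<close> survives. Since
        h o s is defined on the whole cover of P/L, the difference is a boundary.\<close>
      have "(c \<ominus>\<^bsub>?C1\<^esub> f \<phi>) g = h (s (?d g))" if g: "g \<in> carrier ?F1" for g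
      proof -
        have k: "?d g \<in> carrier ?K" by (rule module_homs_closed[OF d g])
        then have kF0: "?d g \<in> carrier ?F0" using KF0 by blast
        have sk: "s (?d g) \<in> LF"
          using \<alpha>K[OF k] module_homs_closed[OF s kF0] by (simp add: LF_def \<alpha>_def)
        have "\<phi> (\<alpha> (?d g)) = c g \<ominus>\<^bsub>N\<^esub> h (s (?d g))"
          using \<phi>q[of "s (?d g)"] sk \<theta>d[OF g] ts[OF kF0] by (simp add: \<alpha>_def)
        moreover have "c g \<in> carrier N" "h (s (?d g)) \<in> carrier N"
          using module_homs_closed[OF ch g] module_homs_closed[OF hLF] sk by simp_all
        ultimately show ?thesis
          unfolding Hom_module_diff_apply[OF F1 N c1 module_homs_closed[OF f1 \<phi>C] g] f_apply[OF g]
          by (simp add: N.minus_eq N.minus_add N.minus_minus N.r_neg flip: N.a_assoc)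
      qed
      moreover have "c \<ominus>\<^bsub>?C1\<^esub> f \<phi> \<in> carrier ?C1"
        using c1 module_homs_closed[OF f1 \<phi>C]
        by (simp add: abelian_group.minus_closed[OF module.axioms(2)[OF Hom_module_is_module[OF F1 N]]])
      moreover have "(\<lambda>k. h (s k)) \<in> module_homs R ?F0 N" by (rule module_homs_comp[OF s h])
      ultimately show ?thesis using B_iff diff by metis
    qed
    then show "\<exists>\<phi>\<in>carrier (Hom_module R PL N). c \<ominus>\<^bsub>C\<^esub> f \<phi> \<in> B" using \<phi>C by blast
  qed
qed

section \<open>Extending homomorphisms one generator at a time\<close>

lemma (in abelian_group) add_eq_of_diff_eq:
  assumes "v' \<in> carrier G" "v \<in> carrier G" "w \<in> carrier G" "w' \<in> carrier G"
    and eq: "v' \<ominus> v = w \<ominus> w'"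
  shows "v \<oplus> w = v' \<oplus> w'"
proof -
  have "w = (w \<ominus> w') \<oplus> w'" using assms by (simp add: a_minus_def a_assoc l_neg)
  then have "v \<oplus> w = v \<oplus> ((v' \<ominus> v) \<oplus> w')" unfolding eq by simp
  also have "\<dots> = v \<oplus> (v' \<ominus> v) \<oplus> w'" using assms(1-4) by (simp add: a_assoc)
  also have "v \<oplus> (v' \<ominus> v) = v'" using assms(1-4) by (simp add: a_minus_def a_lcomm[of v v'] r_neg)
  finally show ?thesis .
qed

text \<open>The extension sends k + b x to u \<theta>(k) + b z, where z solves d z = \<theta>(d u
  x). Such a z exists by \<open>divisible\<close>, because whatever annihilates d annihilates
  \<theta>(d u x); \<open>conductor\<close> makes the value independent of the expression k + b x.
  The factor u serves conductors that are generated by d only up to u.\<close>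

lemma hom_extension_step:
  fixes R :: "'a ring" and E :: "('a, 'm) module" and N :: "('a, 'k) module"
  assumes E: "module R E" and N: "module R N" and K: "submodule K R E"
    and \<theta>: "\<theta> \<in> module_homs R (E\<lparr>carrier := K\<rparr>) N"
    and x: "x \<in> carrier E" and d: "d \<in> carrier R" and u: "u \<in> carrier R"
    and dux: "(d \<otimes>\<^bsub>R\<^esub> u) \<odot>\<^bsub>E\<^esub> x \<in> K"
    and conductor: "\<And>b. b \<in> carrier R \<Longrightarrow> b \<odot>\<^bsub>E\<^esub> x \<in> K \<Longrightarrow> \<exists>c\<in>carrier R. b = c \<otimes>\<^bsub>R\<^esub> d"
    and divisible: "\<And>y. y \<in> carrier N \<Longrightarrow>
      (\<And>b. b \<in> carrier R \<Longrightarrow> b \<otimes>\<^bsub>R\<^esub> d = \<zero>\<^bsub>R\<^esub> \<Longrightarrow> b \<odot>\<^bsub>N\<^esub> y = \<zero>\<^bsub>N\<^esub>) \<Longrightarrow> \<exists>z\<in>carrier N. y = d \<odot>\<^bsub>N\<^esub> z"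
  obtains K' \<theta>' where "submodule K' R E" and "K \<subseteq> K'" and "x \<in> K'"
    and "\<theta>' \<in> module_homs R (E\<lparr>carrier := K'\<rparr>) N" and "\<And>k. k \<in> K \<Longrightarrow> \<theta>' k = u \<odot>\<^bsub>N\<^esub> \<theta> k"
proof -
  interpret E: module R E by fact
  interpret N: module R N by fact
  interpret K: module R "E\<lparr>carrier := K\<rparr>" by (rule submodule.submodule_is_module[OF K E])
  note KE = E.submoduleE(1)[OF K]
  have KE': "k \<in> carrier E" if "k \<in> K" for k using that KE by blast
  have K_add: "k \<oplus>\<^bsub>E\<^esub> k' \<in> K" if "k \<in> K" "k' \<in> K" for k k' using E.submoduleE(5)[OF K] that by blast
  have K_smult: "r \<odot>\<^bsub>E\<^esub> k \<in> K" if "r \<in> carrier R" "k \<in> K" for r k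
    using E.submoduleE(4)[OF K] that by blast
  note K_zero = E.submodule_zero[OF K]
  have K_diff: "k \<ominus>\<^bsub>E\<^esub> k' \<in> K" if "k \<in> K" "k' \<in> K" for k k'
    using that K_add E.submoduleE(3)[OF K] by (simp add: a_minus_def)
  have \<theta>N: "\<theta> k \<in> carrier N" if "k \<in> K" for k using module_homs_closed[OF \<theta>] that by simp
  have \<theta>_add: "\<theta> (k \<oplus>\<^bsub>E\<^esub> k') = \<theta> k \<oplus>\<^bsub>N\<^esub> \<theta> k'" if "k \<in> K" "k' \<in> K" for k k'
    using module_homs_add[OF \<theta>, of k k'] that by simp
  have \<theta>_smult: "\<theta> (r \<odot>\<^bsub>E\<^esub> k) = r \<odot>\<^bsub>N\<^esub> \<theta> k" if "r \<in> carrier R" "k \<in> K" for r k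
    using module_homs_smult[OF \<theta>, of r k] that by simp
  have \<theta>_diff: "\<theta> (k \<ominus>\<^bsub>E\<^esub> k') = \<theta> k \<ominus>\<^bsub>N\<^esub> \<theta> k'" if "k \<in> K" "k' \<in> K" for k k'
    using module_homs_zero_minus(3)[OF K.module_axioms N \<theta>, of k k'] submodule_minus[OF E K that] that by simp
  define y where "y = \<theta> ((d \<otimes>\<^bsub>R\<^esub> u) \<odot>\<^bsub>E\<^esub> x)"
  have yN: "y \<in> carrier N" unfolding y_def by (rule \<theta>N[OF dux])
  have "\<exists>z\<in>carrier N. y = d \<odot>\<^bsub>N\<^esub> z"
  proof (rule divisible[OF yN])
    fix b assume b: "b \<in> carrier R" "b \<otimes>\<^bsub>R\<^esub> d = \<zero>\<^bsub>R\<^esub>"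
    have "b \<odot>\<^bsub>N\<^esub> y = \<theta> (b \<odot>\<^bsub>E\<^esub> ((d \<otimes>\<^bsub>R\<^esub> u) \<odot>\<^bsub>E\<^esub> x))"
      using \<theta>_smult[OF b(1) dux] by (simp add: y_def)
    also have "b \<odot>\<^bsub>E\<^esub> ((d \<otimes>\<^bsub>R\<^esub> u) \<odot>\<^bsub>E\<^esub> x) = (b \<otimes>\<^bsub>R\<^esub> d \<otimes>\<^bsub>R\<^esub> u) \<odot>\<^bsub>E\<^esub> x"
      using b(1) d u x by (simp add: E.smult_assoc1[symmetric] E.m_assoc)
    also have "\<dots> = \<zero>\<^bsub>E\<^esub>" using b u x by simp
    also have "\<theta> \<zero>\<^bsub>E\<^esub> = \<zero>\<^bsub>N\<^esub>" using module_homs_zero_minus(1)[OF K.module_axioms N \<theta>] by simp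
    finally show "b \<odot>\<^bsub>N\<^esub> y = \<zero>\<^bsub>N\<^esub>" .
  qed
  then obtain z where z: "z \<in> carrier N" "y = d \<odot>\<^bsub>N\<^esub> z" by blast
  \<comment> \<open>Two expressions of one element put (b - b') x into \<open>K\<close>, so b - b' =
    c d. Applying \<theta> to u (b - b') x = c (d u x) gives c d z = (b - b') z, which is the
    difference to be balanced.\<close>
  have unique: "u \<odot>\<^bsub>N\<^esub> \<theta> k \<oplus>\<^bsub>N\<^esub> b \<odot>\<^bsub>N\<^esub> z = u \<odot>\<^bsub>N\<^esub> \<theta> k' \<oplus>\<^bsub>N\<^esub> b' \<odot>\<^bsub>N\<^esub> z"
    if kb: "k \<in> K" "b \<in> carrier R" "k' \<in> K" "b' \<in> carrier R"
      and eq: "k \<oplus>\<^bsub>E\<^esub> b \<odot>\<^bsub>E\<^esub> x = k' \<oplus>\<^bsub>E\<^esub> b' \<odot>\<^bsub>E\<^esub> x" for k b k' b'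
  proof -
    have diff: "(b \<ominus>\<^bsub>R\<^esub> b') \<odot>\<^bsub>E\<^esub> x = k' \<ominus>\<^bsub>E\<^esub> k"
    proof -
      have "(b \<ominus>\<^bsub>R\<^esub> b') \<odot>\<^bsub>E\<^esub> x = (k \<oplus>\<^bsub>E\<^esub> b \<odot>\<^bsub>E\<^esub> x) \<ominus>\<^bsub>E\<^esub> k \<ominus>\<^bsub>E\<^esub> b' \<odot>\<^bsub>E\<^esub> x"
        using kb x KE' by (simp add: a_minus_def E.smult_l_distr E.smult_l_minus E.a_ac E.r_neg1 E.r_neg2)
      also have "\<dots> = k' \<ominus>\<^bsub>E\<^esub> k"
        unfolding eq using kb x KE' by (simp add: a_minus_def E.a_ac E.r_neg1 E.r_neg2 E.r_neg)
      finally show ?thesis .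
    qed
    have "(b \<ominus>\<^bsub>R\<^esub> b') \<odot>\<^bsub>E\<^esub> x \<in> K" unfolding diff by (rule K_diff[OF kb(3,1)])
    then obtain c where c: "c \<in> carrier R" "b \<ominus>\<^bsub>R\<^esub> b' = c \<otimes>\<^bsub>R\<^esub> d"
      using conductor[of "b \<ominus>\<^bsub>R\<^esub> b'"] kb by auto
    have "u \<odot>\<^bsub>N\<^esub> \<theta> k' \<ominus>\<^bsub>N\<^esub> u \<odot>\<^bsub>N\<^esub> \<theta> k = \<theta> (u \<odot>\<^bsub>E\<^esub> ((b \<ominus>\<^bsub>R\<^esub> b') \<odot>\<^bsub>E\<^esub> x))"
      unfolding diff using kb u by (simp add: \<theta>_smult K_diff \<theta>_diff N.smult_diff_distr \<theta>N)
    also have "u \<odot>\<^bsub>E\<^esub> ((b \<ominus>\<^bsub>R\<^esub> b') \<odot>\<^bsub>E\<^esub> x) = c \<odot>\<^bsub>E\<^esub> ((d \<otimes>\<^bsub>R\<^esub> u) \<odot>\<^bsub>E\<^esub> x)"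
      unfolding c(2) using c(1) d u x by (simp add: E.smult_assoc1[symmetric] E.m_ac)
    also have "\<theta> \<dots> = (b \<ominus>\<^bsub>R\<^esub> b') \<odot>\<^bsub>N\<^esub> z"
      unfolding \<theta>_smult[OF c(1) dux] y_def[symmetric] z(2) c(2) using c(1) d z(1) by (simp add: N.smult_assoc1)
    finally have *: "u \<odot>\<^bsub>N\<^esub> \<theta> k' \<ominus>\<^bsub>N\<^esub> u \<odot>\<^bsub>N\<^esub> \<theta> k = b \<odot>\<^bsub>N\<^esub> z \<ominus>\<^bsub>N\<^esub> b' \<odot>\<^bsub>N\<^esub> z"
      using kb z(1) by (simp add: a_minus_def N.smult_l_distr N.smult_l_minus)
    let ?v = "u \<odot>\<^bsub>N\<^esub> \<theta> k" and ?v' = "u \<odot>\<^bsub>N\<^esub> \<theta> k'" and ?w = "b \<odot>\<^bsub>N\<^esub> z" and ?w' = "b' \<odot>\<^bsub>N\<^esub> z"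
    have cl: "?v \<in> carrier N" "?v' \<in> carrier N" "?w \<in> carrier N" "?w' \<in> carrier N"
      using kb u z(1) \<theta>N by auto
    show ?thesis by (rule N.add_eq_of_diff_eq[OF cl(2,1,3,4) *])
  qed
  define K' where "K' = {k \<oplus>\<^bsub>E\<^esub> b \<odot>\<^bsub>E\<^esub> x | k b. k \<in> K \<and> b \<in> carrier R}"
  define \<theta>' where "\<theta>' = (\<lambda>e. SOME v. \<exists>k b. k \<in> K \<and> b \<in> carrier R \<and> e = k \<oplus>\<^bsub>E\<^esub> b \<odot>\<^bsub>E\<^esub> x \<and>
      v = u \<odot>\<^bsub>N\<^esub> \<theta> k \<oplus>\<^bsub>N\<^esub> b \<odot>\<^bsub>N\<^esub> z)"
  have \<theta>'_eq: "\<theta>' (k \<oplus>\<^bsub>E\<^esub> b \<odot>\<^bsub>E\<^esub> x) = u \<odot>\<^bsub>N\<^esub> \<theta> k \<oplus>\<^bsub>N\<^esub> b \<odot>\<^bsub>N\<^esub> z" if "k \<in> K" "b \<in> carrier R" for k b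
  proof -
    let ?Q = "\<lambda>v. \<exists>k' b'. k' \<in> K \<and> b' \<in> carrier R \<and> k \<oplus>\<^bsub>E\<^esub> b \<odot>\<^bsub>E\<^esub> x = k' \<oplus>\<^bsub>E\<^esub> b' \<odot>\<^bsub>E\<^esub> x \<and>
      v = u \<odot>\<^bsub>N\<^esub> \<theta> k' \<oplus>\<^bsub>N\<^esub> b' \<odot>\<^bsub>N\<^esub> z"
    have "?Q (SOME v. ?Q v)" by (rule someI_ex) (use that in blast)
    then obtain k' b' where kb': "k' \<in> K" "b' \<in> carrier R" "k \<oplus>\<^bsub>E\<^esub> b \<odot>\<^bsub>E\<^esub> x = k' \<oplus>\<^bsub>E\<^esub> b' \<odot>\<^bsub>E\<^esub> x"
      and v: "(SOME v. ?Q v) = u \<odot>\<^bsub>N\<^esub> \<theta> k' \<oplus>\<^bsub>N\<^esub> b' \<odot>\<^bsub>N\<^esub> z"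
      by blast
    show ?thesis unfolding \<theta>'_def by (rule trans[OF v unique[OF that kb', symmetric]])
  qed
  have sum: "(k \<oplus>\<^bsub>E\<^esub> b \<odot>\<^bsub>E\<^esub> x) \<oplus>\<^bsub>E\<^esub> (k' \<oplus>\<^bsub>E\<^esub> b' \<odot>\<^bsub>E\<^esub> x) = (k \<oplus>\<^bsub>E\<^esub> k') \<oplus>\<^bsub>E\<^esub> (b \<oplus>\<^bsub>R\<^esub> b') \<odot>\<^bsub>E\<^esub> x"
    if "k \<in> K" "b \<in> carrier R" "k' \<in> K" "b' \<in> carrier R" for k b k' b'
    using that x KE' by (simp add: E.smult_l_distr E.a_ac)
  have scale: "r \<odot>\<^bsub>E\<^esub> (k \<oplus>\<^bsub>E\<^esub> b \<odot>\<^bsub>E\<^esub> x) = r \<odot>\<^bsub>E\<^esub> k \<oplus>\<^bsub>E\<^esub> (r \<otimes>\<^bsub>R\<^esub> b) \<odot>\<^bsub>E\<^esub> x"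
    if "r \<in> carrier R" "k \<in> K" "b \<in> carrier R" for r k b
    using that x KE' by (simp add: E.smult_r_distr E.smult_assoc1)
  have K'I: "k \<oplus>\<^bsub>E\<^esub> b \<odot>\<^bsub>E\<^esub> x \<in> K'" if "k \<in> K" "b \<in> carrier R" for k b
    using that unfolding K'_def by blast
  have K'E: "\<exists>k b. k \<in> K \<and> b \<in> carrier R \<and> e = k \<oplus>\<^bsub>E\<^esub> b \<odot>\<^bsub>E\<^esub> x" if "e \<in> K'" for e
    using that unfolding K'_def by blast
  show thesis
  proof (rule that[of K' \<theta>'])
    show "K \<subseteq> K'"
    proof
      fix k assume "k \<in> K"
      then show "k \<in> K'" using K'I[OF _ E.R.zero_closed, of k] x KE' by simp
    qed
    show "x \<in> K'" using K'I[OF K_zero E.R.one_closed] x by simp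
    show "submodule K' R E"
    proof (rule E.submoduleI_smult)
      show "K' \<subseteq> carrier E" using KE' x by (auto simp: K'_def)
      show "\<zero>\<^bsub>E\<^esub> \<in> K'" using K'I[OF K_zero E.R.zero_closed] x by simp
      show "r \<odot>\<^bsub>E\<^esub> e \<in> K'" if "r \<in> carrier R" "e \<in> K'" for r e
        using K'E[OF that(2)] that(1) scale K'I K_smult E.R.m_closed by metis
      show "e \<oplus>\<^bsub>E\<^esub> e' \<in> K'" if "e \<in> K'" "e' \<in> K'" for e e'
        using K'E[OF that(1)] K'E[OF that(2)] sum K'I K_add E.R.a_closed by metis
    qed
    show "\<theta>' k = u \<odot>\<^bsub>N\<^esub> \<theta> k" if "k \<in> K" for k
      using \<theta>'_eq[OF that E.R.zero_closed] that x z(1) u KE' \<theta>N by simp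
    show "\<theta>' \<in> module_homs R (E\<lparr>carrier := K'\<rparr>) N"
    proof (rule module_homsI)
      fix e assume "e \<in> carrier (E\<lparr>carrier := K'\<rparr>)"
      then obtain k b where e: "k \<in> K" "b \<in> carrier R" "e = k \<oplus>\<^bsub>E\<^esub> b \<odot>\<^bsub>E\<^esub> x"
        using K'E[of e] by auto
      show "\<theta>' e \<in> carrier N" using e u z(1) \<theta>N by (simp add: \<theta>'_eq)
      show "\<theta>' (r \<odot>\<^bsub>E\<lparr>carrier := K'\<rparr>\<^esub> e) = r \<odot>\<^bsub>N\<^esub> \<theta>' e" if r: "r \<in> carrier R" for r
        using e u z(1) \<theta>N r
        by (simp add: scale[OF r] \<theta>'_eq K_smult \<theta>_smult N.smult_r_distr N.smult_assoc1 N.smult_lcomm[of u r])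
      fix e' assume "e' \<in> carrier (E\<lparr>carrier := K'\<rparr>)"
      then obtain k' b' where e': "k' \<in> K" "b' \<in> carrier R" "e' = k' \<oplus>\<^bsub>E\<^esub> b' \<odot>\<^bsub>E\<^esub> x"
        using K'E[of e'] by auto
      show "\<theta>' (e \<oplus>\<^bsub>E\<lparr>carrier := K'\<rparr>\<^esub> e') = \<theta>' e \<oplus>\<^bsub>N\<^esub> \<theta>' e'"
        using e e' u z(1) \<theta>N
        by (simp add: sum \<theta>'_eq K_add \<theta>_add N.smult_r_distr N.smult_l_distr N.a_ac)
    qed
  qed
qed

section \<open>Extension of scalars to a group algebra\<close>

lemma (in group) inv_mult_cancel:
  assumes "x \<in> carrier G" and "y \<in> carrier G"
  shows "inv x \<otimes> (x \<otimes> y) = y" and "x \<otimes> (inv x \<otimes> y) = y"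
  using assms by (simp_all flip: m_assoc)

locale scalar_extension = A: cring A + \<Lambda>: comm_group \<Lambda> + M: module A M
  for A :: "'a ring" and \<Lambda> :: "'l monoid" (structure) and M :: "('a, 'm) module"
begin

abbreviation "E \<equiv> extend_scalars A \<Lambda> M"

lemma carrier_E: "carrier E = finsupp (carrier \<Lambda>) M"
  and zero_E: "\<zero>\<^bsub>E\<^esub> = (\<lambda>_. \<zero>\<^bsub>M\<^esub>)"
  and add_E: "f \<oplus>\<^bsub>E\<^esub> g = (\<lambda>\<nu>. f \<nu> \<oplus>\<^bsub>M\<^esub> g \<nu>)"
  by (simp_all add: extend_scalars_def)

text \<open>A pair with product \<nu> is determined by its first entry. Any finite \<open>U\<close>
  above the support is allowed, so that sums for different scalars can run over the same
  set.\<close>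

lemma smult_E_eq:
  assumes r: "r \<in> finsupp (carrier \<Lambda>) A" and f: "f \<in> finsupp (carrier \<Lambda>) M"
    and U: "finite U" "support A r \<subseteq> U" "U \<subseteq> carrier \<Lambda>" and \<nu>: "\<nu> \<in> carrier \<Lambda>"
  shows "(r \<odot>\<^bsub>E\<^esub> f) \<nu> = (\<Oplus>\<^bsub>M\<^esub>\<kappa>\<in>U. r \<kappa> \<odot>\<^bsub>M\<^esub> f (inv \<kappa> \<otimes> \<nu>))"
proof -
  note rD = finsuppD[OF r] and fD = finsuppD[OF f]
  let ?V = "{\<kappa> \<in> support A r. inv \<kappa> \<otimes> \<nu> \<in> support M f}"
  let ?h = "\<lambda>\<kappa>. (\<kappa>, inv \<kappa> \<otimes> \<nu>)"
  let ?g = "\<lambda>(\<kappa>, \<mu>). r \<kappa> \<odot>\<^bsub>M\<^esub> f \<mu>"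
  have set: "{(\<kappa>, \<mu>) \<in> support A r \<times> support M f. \<kappa> \<otimes> \<mu> = \<nu>} = ?h ` ?V"
  proof -
    have "p \<in> {(\<kappa>, \<mu>) \<in> support A r \<times> support M f. \<kappa> \<otimes> \<mu> = \<nu>} \<longleftrightarrow> p \<in> ?h ` ?V" for p
      using rD(2) fD(2) \<nu> by (cases p) (auto simp: image_iff \<Lambda>.inv_mult_cancel subset_iff)
    then show ?thesis by blast
  qed
  have "(r \<odot>\<^bsub>E\<^esub> f) \<nu> = finsum M ?g (?h ` ?V)"
    by (simp only: extend_scalars_def module.simps set)
  also have "\<dots> = (\<Oplus>\<^bsub>M\<^esub>\<kappa>\<in>?V. r \<kappa> \<odot>\<^bsub>M\<^esub> f (inv \<kappa> \<otimes> \<nu>))"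
    by (subst M.add.finprod_reindex) (use rD fD in \<open>auto simp: inj_on_def\<close>)
  also have "\<dots> = (\<Oplus>\<^bsub>M\<^esub>\<kappa>\<in>U. r \<kappa> \<odot>\<^bsub>M\<^esub> f (inv \<kappa> \<otimes> \<nu>))"
    by (rule M.add.finprod_mono_neutral_cong_left) (use U rD fD in \<open>auto simp: support_def\<close>)
  finally show ?thesis .
qed

lemma smult_E_outside:
  assumes r: "r \<in> finsupp (carrier \<Lambda>) A" and f: "f \<in> finsupp (carrier \<Lambda>) M" and \<nu>: "\<nu> \<notin> carrier \<Lambda>"
  shows "(r \<odot>\<^bsub>E\<^esub> f) \<nu> = \<zero>\<^bsub>M\<^esub>"
proof -
  have "{(\<kappa>, \<mu>) \<in> support A r \<times> support M f. \<kappa> \<otimes> \<mu> = \<nu>} = {}"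
    using finsuppD(2)[OF r] finsuppD(2)[OF f] \<nu> by auto
  then show ?thesis by (simp only: extend_scalars_def module.simps M.finsum_empty)
qed

lemma smult_E_closed:
  assumes r: "r \<in> finsupp (carrier \<Lambda>) A" and f: "f \<in> finsupp (carrier \<Lambda>) M"
  shows "r \<odot>\<^bsub>E\<^esub> f \<in> finsupp (carrier \<Lambda>) M"
proof (rule finsuppI)
  note rD = finsuppD[OF r] and fD = finsuppD[OF f]
  let ?U = "(\<lambda>(\<kappa>, \<mu>). \<kappa> \<otimes> \<mu>) ` (support A r \<times> support M f)"
  show "finite ?U" using rD fD by simp
  show "?U \<subseteq> carrier \<Lambda>" using rD fD by auto
  show "(r \<odot>\<^bsub>E\<^esub> f) \<nu> = \<zero>\<^bsub>M\<^esub>" if "\<nu> \<notin> ?U" for \<nu>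
  proof -
    have "{(\<kappa>, \<mu>) \<in> support A r \<times> support M f. \<kappa> \<otimes> \<mu> = \<nu>} = {}" using that by auto
    then show ?thesis by (simp only: extend_scalars_def module.simps M.finsum_empty)
  qed
  show "(r \<odot>\<^bsub>E\<^esub> f) \<nu> \<in> carrier M" for \<nu>
    unfolding extend_scalars_def using rD fD by (auto intro!: M.finsum_closed)
qed

lemma smult_E_single:
  assumes a: "a \<in> carrier A" and \<kappa>: "\<kappa> \<in> carrier \<Lambda>" and f: "f \<in> finsupp (carrier \<Lambda>) M"
  shows "single A \<kappa> a \<odot>\<^bsub>E\<^esub> f = (\<lambda>\<nu>. if \<nu> \<in> carrier \<Lambda> then a \<odot>\<^bsub>M\<^esub> f (inv \<kappa> \<otimes> \<nu>) else \<zero>\<^bsub>M\<^esub>)"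
proof -
  have s: "single A \<kappa> a \<in> finsupp (carrier \<Lambda>) A" by (rule A.single_finsupp[OF \<kappa> a])
  have "(single A \<kappa> a \<odot>\<^bsub>E\<^esub> f) \<nu> = a \<odot>\<^bsub>M\<^esub> f (inv \<kappa> \<otimes> \<nu>)" if "\<nu> \<in> carrier \<Lambda>" for \<nu>
    by (subst smult_E_eq[OF s f, of "{\<kappa>}"])
      (use that a \<kappa> finsuppD(1)[OF f] in \<open>auto simp: single_def support_def\<close>)
  then show ?thesis using smult_E_outside[OF s f] by auto
qed

lemma smult_E_single_single:
  assumes "a \<in> carrier A" and "\<kappa> \<in> carrier \<Lambda>" and "m \<in> carrier M" and "\<mu> \<in> carrier \<Lambda>"
  shows "single A \<kappa> a \<odot>\<^bsub>E\<^esub> single M \<mu> m = single M (\<kappa> \<otimes> \<mu>) (a \<odot>\<^bsub>M\<^esub> m)"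
proof -
  have "inv \<kappa> \<otimes> \<nu> = \<mu> \<longleftrightarrow> \<nu> = \<kappa> \<otimes> \<mu>" if "\<nu> \<in> carrier \<Lambda>" for \<nu>
    using that assms by (auto simp: \<Lambda>.inv_mult_cancel)
  then show ?thesis
    unfolding smult_E_single[OF assms(1,2) M.single_finsupp[OF assms(4,3)]]
    using assms by (auto simp: single_def fun_eq_iff)
qed

lemma smult_E_add_left:
  assumes r: "r \<in> finsupp (carrier \<Lambda>) A" "s \<in> finsupp (carrier \<Lambda>) A"
    and f: "f \<in> finsupp (carrier \<Lambda>) M"
  shows "(\<lambda>\<nu>. r \<nu> \<oplus>\<^bsub>A\<^esub> s \<nu>) \<odot>\<^bsub>E\<^esub> f = (\<lambda>\<nu>. (r \<odot>\<^bsub>E\<^esub> f) \<nu> \<oplus>\<^bsub>M\<^esub> (s \<odot>\<^bsub>E\<^esub> f) \<nu>)"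
proof -
  note D = finsuppD[OF r(1)] finsuppD[OF r(2)]
  let ?U = "support A r \<union> support A s"
  have U: "finite ?U" "?U \<subseteq> carrier \<Lambda>" using D by auto
  have supp: "support A (\<lambda>\<nu>. r \<nu> \<oplus>\<^bsub>A\<^esub> s \<nu>) \<subseteq> ?U" by (auto simp: support_def)
  show "(\<lambda>\<nu>. r \<nu> \<oplus>\<^bsub>A\<^esub> s \<nu>) \<odot>\<^bsub>E\<^esub> f = (\<lambda>\<nu>. (r \<odot>\<^bsub>E\<^esub> f) \<nu> \<oplus>\<^bsub>M\<^esub> (s \<odot>\<^bsub>E\<^esub> f) \<nu>)"
  proof
    fix \<nu>
    show "((\<lambda>\<nu>. r \<nu> \<oplus>\<^bsub>A\<^esub> s \<nu>) \<odot>\<^bsub>E\<^esub> f) \<nu> = (r \<odot>\<^bsub>E\<^esub> f) \<nu> \<oplus>\<^bsub>M\<^esub> (s \<odot>\<^bsub>E\<^esub> f) \<nu>"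
    proof (cases "\<nu> \<in> carrier \<Lambda>")
      case True
      show ?thesis
        unfolding smult_E_eq[OF A.finsupp_add[OF r] f U(1) supp U(2) True]
          smult_E_eq[OF r(1) f U(1) Un_upper1 U(2) True] smult_E_eq[OF r(2) f U(1) Un_upper2 U(2) True]
        using D(1) D(5) finsuppD(1)[OF f]
        by (subst M.finsum_addf[symmetric]) (auto simp: M.smult_l_distr intro!: M.finsum_cong')
    next
      case False
      then show ?thesis by (simp add: smult_E_outside A.finsupp_add r f)
    qed
  qed
qed

lemma smult_E_add_right:
  assumes r: "r \<in> finsupp (carrier \<Lambda>) A"
    and f: "f \<in> finsupp (carrier \<Lambda>) M" "g \<in> finsupp (carrier \<Lambda>) M"
  shows "r \<odot>\<^bsub>E\<^esub> (\<lambda>\<nu>. f \<nu> \<oplus>\<^bsub>M\<^esub> g \<nu>) = (\<lambda>\<nu>. (r \<odot>\<^bsub>E\<^esub> f) \<nu> \<oplus>\<^bsub>M\<^esub> (r \<odot>\<^bsub>E\<^esub> g) \<nu>)"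
proof -
  note D = finsuppD[OF r]
  show "r \<odot>\<^bsub>E\<^esub> (\<lambda>\<nu>. f \<nu> \<oplus>\<^bsub>M\<^esub> g \<nu>) = (\<lambda>\<nu>. (r \<odot>\<^bsub>E\<^esub> f) \<nu> \<oplus>\<^bsub>M\<^esub> (r \<odot>\<^bsub>E\<^esub> g) \<nu>)"
  proof
    fix \<nu>
    show "(r \<odot>\<^bsub>E\<^esub> (\<lambda>\<nu>. f \<nu> \<oplus>\<^bsub>M\<^esub> g \<nu>)) \<nu> = (r \<odot>\<^bsub>E\<^esub> f) \<nu> \<oplus>\<^bsub>M\<^esub> (r \<odot>\<^bsub>E\<^esub> g) \<nu>"
    proof (cases "\<nu> \<in> carrier \<Lambda>")
      case True
      show ?thesis
        unfolding smult_E_eq[OF r M.finsupp_add[OF f] D(3) order_refl D(2) True]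
          smult_E_eq[OF r f(1) D(3) order_refl D(2) True] smult_E_eq[OF r f(2) D(3) order_refl D(2) True]
        using D(1) finsuppD(1)[OF f(1)] finsuppD(1)[OF f(2)]
        by (subst M.finsum_addf[symmetric]) (auto simp: M.smult_r_distr intro!: M.finsum_cong')
    next
      case False
      then show ?thesis by (simp add: smult_E_outside M.finsupp_add r f)
    qed
  qed
qed

lemma smult_E_zero:
  assumes "f \<in> finsupp (carrier \<Lambda>) M"
  shows "(\<lambda>_. \<zero>\<^bsub>A\<^esub>) \<odot>\<^bsub>E\<^esub> f = (\<lambda>_. \<zero>\<^bsub>M\<^esub>)"
proof
  fix \<nu>
  show "((\<lambda>_. \<zero>\<^bsub>A\<^esub>) \<odot>\<^bsub>E\<^esub> f) \<nu> = \<zero>\<^bsub>M\<^esub>"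
    by (cases "\<nu> \<in> carrier \<Lambda>")
      (simp_all add: smult_E_eq[of _ _ "{}"] smult_E_outside A.finsupp_zero assms support_def)
qed

end

lemma group_algebra_simps:
  "carrier (group_algebra A \<Lambda>) = finsupp (carrier \<Lambda>) A"
  "\<zero>\<^bsub>group_algebra A \<Lambda>\<^esub> = (\<lambda>_. \<zero>\<^bsub>A\<^esub>)"
  "f \<oplus>\<^bsub>group_algebra A \<Lambda>\<^esub> g = (\<lambda>\<nu>. f \<nu> \<oplus>\<^bsub>A\<^esub> g \<nu>)"
  "\<one>\<^bsub>group_algebra A \<Lambda>\<^esub> = single A \<one>\<^bsub>\<Lambda>\<^esub> \<one>\<^bsub>A\<^esub>"
  by (simp_all add: group_algebra_def single_def)

lemma regular_module_simps:
  "carrier (regular_module R) = carrier R" "\<zero>\<^bsub>regular_module R\<^esub> = \<zero>\<^bsub>R\<^esub>"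
  "x \<oplus>\<^bsub>regular_module R\<^esub> y = x \<oplus>\<^bsub>R\<^esub> y" "x \<odot>\<^bsub>regular_module R\<^esub> y = x \<otimes>\<^bsub>R\<^esub> y"
  by (simp_all add: regular_module_def)

lemma regular_module_is_module: "cring R \<Longrightarrow> module R (regular_module R)"
proof -
  assume "cring R"
  then interpret cring R .
  show ?thesis
    by (intro moduleI abelian_groupI)
      (auto simp: regular_module_simps is_cring a_ac l_distr r_distr m_assoc intro: bexI[of _ "\<ominus>\<^bsub>R\<^esub> _"] l_neg)
qed

text \<open>The ring product is the action on the extension of the regular module, so the ring
  axioms follow from the facts on \<open>extend_scalars\<close> without a second computation with
  convolutions.\<close>

lemma group_algebra_mult:
  "r \<otimes>\<^bsub>group_algebra A \<Lambda>\<^esub> s = r \<odot>\<^bsub>extend_scalars A \<Lambda> (regular_module A)\<^esub> s"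
  by (simp add: group_algebra_def extend_scalars_def regular_module_simps support_def
      finsum_def finprod_def regular_module_def cong: if_cong)

lemma single_regular: "single (regular_module A) = single A"
  by (simp add: fun_eq_iff single_def regular_module_simps)

lemma finsupp_regular: "finsupp S (regular_module A) = finsupp S A"
  by (simp add: finsupp_def regular_module_simps support_def)

lemma (in scalar_extension) regular_scalar_extension: "scalar_extension A \<Lambda> (regular_module A)"
  by (intro scalar_extension.intro A.is_cring \<Lambda>.comm_group_axioms regular_module_is_module)

text \<open>Both sides are additive in \<open>r\<close> and in \<open>s\<close>. This leaves
  monomials, where the claim is that two successive shifts compose to the shift by the
  product.\<close>

lemma (in scalar_extension) smult_E_assoc:
  assumes r: "r \<in> finsupp (carrier \<Lambda>) A" and s: "s \<in> finsupp (carrier \<Lambda>) A"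
    and f: "f \<in> finsupp (carrier \<Lambda>) M"
  shows "(r \<otimes>\<^bsub>group_algebra A \<Lambda>\<^esub> s) \<odot>\<^bsub>E\<^esub> f = r \<odot>\<^bsub>E\<^esub> (s \<odot>\<^bsub>E\<^esub> f)"
proof -
  interpret R: scalar_extension A \<Lambda> "regular_module A" by (rule regular_scalar_extension)
  let ?R = "group_algebra A \<Lambda>"
  note R = R.smult_E_zero R.smult_E_add_left R.smult_E_add_right R.smult_E_closed R.smult_E_single_single
  note R = R[unfolded finsupp_regular single_regular group_algebra_mult[symmetric] regular_module_simps]
  have single_single: "(single A \<kappa> a \<otimes>\<^bsub>?R\<^esub> single A \<mu> b) \<odot>\<^bsub>E\<^esub> f = single A \<kappa> a \<odot>\<^bsub>E\<^esub> (single A \<mu> b \<odot>\<^bsub>E\<^esub> f)"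
    if "\<kappa> \<in> carrier \<Lambda>" "a \<in> carrier A" "\<mu> \<in> carrier \<Lambda>" "b \<in> carrier A" for \<kappa> a \<mu> b
  proof -
    have inner: "single A \<mu> b \<odot>\<^bsub>E\<^esub> f \<in> finsupp (carrier \<Lambda>) M"
      by (rule smult_E_closed[OF A.single_finsupp f]) (use that in auto)
    have ab: "a \<otimes>\<^bsub>A\<^esub> b \<in> carrier A" "\<kappa> \<otimes> \<mu> \<in> carrier \<Lambda>" using that by auto
    show ?thesis
      unfolding R(5)[OF that(2,1,4,3)] smult_E_single[OF that(2,1) inner]
      unfolding smult_E_single[OF that(4,3) f] smult_E_single[OF ab f]
      using that finsuppD(1)[OF f]
      by (auto simp: fun_eq_iff M.smult_assoc1 \<Lambda>.inv_mult_group \<Lambda>.m_assoc)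
  qed
  have single: "(single A \<kappa> a \<otimes>\<^bsub>?R\<^esub> s) \<odot>\<^bsub>E\<^esub> f = single A \<kappa> a \<odot>\<^bsub>E\<^esub> (s \<odot>\<^bsub>E\<^esub> f)"
    if \<kappa>: "\<kappa> \<in> carrier \<Lambda>" "a \<in> carrier A" for \<kappa> a
    using s
  proof (induction rule: A.finsupp_induct)
    case zero
    have "single A \<kappa> a \<otimes>\<^bsub>?R\<^esub> (\<lambda>_. \<zero>\<^bsub>A\<^esub>) = (\<lambda>_. \<zero>\<^bsub>A\<^esub>)"
      using \<kappa> R.smult_E_single[of a \<kappa> "\<lambda>_. \<zero>\<^bsub>A\<^esub>"]
      by (auto simp: group_algebra_mult finsupp_regular A.finsupp_zero regular_module_simps)
    moreover have "single A \<kappa> a \<odot>\<^bsub>E\<^esub> (\<lambda>_. \<zero>\<^bsub>M\<^esub>) = (\<lambda>_. \<zero>\<^bsub>M\<^esub>)"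
      using \<kappa> by (auto simp: smult_E_single M.finsupp_zero)
    ultimately show ?case by (simp add: smult_E_zero f)
  next
    case (add g \<mu> b)
    then show ?case
      using \<kappa> f by (simp add: R smult_E_add_left smult_E_add_right smult_E_closed A.single_finsupp flip: single_single)
  qed
  show ?thesis
    using r
  proof (induction rule: A.finsupp_induct)
    case zero
    then show ?case by (simp add: R s f smult_E_zero smult_E_closed)
  next
    case (add g \<mu> b)
    then show ?case
      using s f by (simp add: R smult_E_add_left smult_E_add_right smult_E_closed A.single_finsupp single)
  qed
qed

lemma (in scalar_extension) smult_E_one:
  assumes f: "f \<in> finsupp (carrier \<Lambda>) M"
  shows "single A \<one> \<one>\<^bsub>A\<^esub> \<odot>\<^bsub>E\<^esub> f = f"
  using finsuppD[OF f] by (auto simp: smult_E_single f fun_eq_iff)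

lemma (in scalar_extension) group_algebra_cring: "cring (group_algebra A \<Lambda>)"
proof -
  interpret R: scalar_extension A \<Lambda> "regular_module A" by (rule regular_scalar_extension)
  let ?R = "group_algebra A \<Lambda>"
  note R = R.smult_E_zero R.smult_E_add_left R.smult_E_add_right R.smult_E_closed R.smult_E_single_single R.smult_E_assoc R.smult_E_one
  note R = R[unfolded finsupp_regular single_regular group_algebra_mult[symmetric] regular_module_simps]
  have zero_right: "r \<otimes>\<^bsub>?R\<^esub> (\<lambda>_. \<zero>\<^bsub>A\<^esub>) = (\<lambda>_. \<zero>\<^bsub>A\<^esub>)" if "r \<in> finsupp (carrier \<Lambda>) A" for r
    using that
  proof (induction rule: A.finsupp_induct)
    case zero
    then show ?case by (simp add: R A.finsupp_zero)
  next
    case (add g \<kappa> a)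
    then have "single A \<kappa> a \<otimes>\<^bsub>?R\<^esub> (\<lambda>_. \<zero>\<^bsub>A\<^esub>) = (\<lambda>_. \<zero>\<^bsub>A\<^esub>)"
      using R.smult_E_single[of a \<kappa> "\<lambda>_. \<zero>\<^bsub>A\<^esub>"]
      by (auto simp: group_algebra_mult finsupp_regular A.finsupp_zero regular_module_simps)
    then show ?case using add by (simp add: R A.finsupp_zero A.single_finsupp)
  qed
  have single_comm: "single A \<kappa> a \<otimes>\<^bsub>?R\<^esub> s = s \<otimes>\<^bsub>?R\<^esub> single A \<kappa> a"
    if \<kappa>: "\<kappa> \<in> carrier \<Lambda>" "a \<in> carrier A" and s: "s \<in> finsupp (carrier \<Lambda>) A" for \<kappa> a s
    using s
  proof (induction rule: A.finsupp_induct)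
    case zero
    then show ?case using \<kappa> by (simp add: R zero_right A.single_finsupp)
  next
    case (add g \<mu> b)
    then show ?case
      using \<kappa> by (simp add: R A.single_finsupp A.m_comm \<Lambda>.m_comm)
  qed
  have comm: "r \<otimes>\<^bsub>?R\<^esub> s = s \<otimes>\<^bsub>?R\<^esub> r" if r: "r \<in> finsupp (carrier \<Lambda>) A" and s: "s \<in> finsupp (carrier \<Lambda>) A" for r s
    using r
  proof (induction rule: A.finsupp_induct)
    case zero
    then show ?case using s by (simp add: R zero_right)
  next
    case (add g \<mu> b)
    then show ?case
      using s by (simp add: R A.single_finsupp single_comm)
  qed
  show ?thesis
  proof (intro cringI abelian_groupI comm_monoidI)
    show "\<exists>g\<in>carrier ?R. g \<oplus>\<^bsub>?R\<^esub> f = \<zero>\<^bsub>?R\<^esub>" if "f \<in> carrier ?R" for f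
      using that finsuppD(1)[of f "carrier \<Lambda>" A] A.finsupp_minus[of f "carrier \<Lambda>"]
      by (intro bexI[of _ "\<lambda>x. \<ominus>\<^bsub>A\<^esub> f x"]) (auto simp: group_algebra_simps A.l_neg)
  qed (auto simp: group_algebra_simps R A.finsupp_add A.finsupp_zero A.single_finsupp
      finsuppD(1) A.a_ac intro: comm)
qed

lemma (in scalar_extension) E_is_module: "module (group_algebra A \<Lambda>) E"
proof (intro moduleI abelian_groupI group_algebra_cring)
  show "\<exists>g\<in>carrier E. g \<oplus>\<^bsub>E\<^esub> f = \<zero>\<^bsub>E\<^esub>" if "f \<in> carrier E" for f
    using that finsuppD(1)[of f "carrier \<Lambda>" M] M.finsupp_minus[of f "carrier \<Lambda>"]
    by (intro bexI[of _ "\<lambda>x. \<ominus>\<^bsub>M\<^esub> f x"]) (auto simp: carrier_E zero_E add_E M.l_neg)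
qed (auto simp: carrier_E zero_E add_E group_algebra_simps smult_E_add_left smult_E_add_right smult_E_closed smult_E_assoc smult_E_one
    M.finsupp_add M.finsupp_zero finsuppD(1) M.a_ac)

section \<open>The antipode\<close>

context scalar_extension
begin

abbreviation "R \<equiv> group_algebra A \<Lambda>"
abbreviation "anti \<equiv> antipode A \<Lambda>"

lemma R_single_single:
  assumes "a \<in> carrier A" "\<kappa> \<in> carrier \<Lambda>" "b \<in> carrier A" "\<mu> \<in> carrier \<Lambda>"
  shows "single A \<kappa> a \<otimes>\<^bsub>R\<^esub> single A \<mu> b = single A (\<kappa> \<otimes> \<mu>) (a \<otimes>\<^bsub>A\<^esub> b)"
proof -
  interpret R: scalar_extension A \<Lambda> "regular_module A" by (rule regular_scalar_extension)
  show ?thesis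
    using R.smult_E_single_single[of a \<kappa> b \<mu>] assms
    by (simp add: single_regular group_algebra_mult regular_module_simps)
qed

lemma R_single_mult:
  assumes a: "a \<in> carrier A" and \<kappa>: "\<kappa> \<in> carrier \<Lambda>" and f: "f \<in> carrier R"
  shows "single A \<kappa> a \<otimes>\<^bsub>R\<^esub> f = (\<lambda>\<nu>. if \<nu> \<in> carrier \<Lambda> then a \<otimes>\<^bsub>A\<^esub> f (inv \<kappa> \<otimes> \<nu>) else \<zero>\<^bsub>A\<^esub>)"
proof -
  interpret R: scalar_extension A \<Lambda> "regular_module A" by (rule regular_scalar_extension)
  show ?thesis
    using R.smult_E_single[OF a \<kappa>, of f] f
    by (simp add: finsupp_regular single_regular group_algebra_simps group_algebra_mult regular_module_simps cong: if_cong)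
qed

lemma single_in_R: "\<kappa> \<in> carrier \<Lambda> \<Longrightarrow> a \<in> carrier A \<Longrightarrow> single A \<kappa> a \<in> carrier R"
  by (simp add: group_algebra_simps A.single_finsupp)

lemma antipode_closed:
  assumes r: "r \<in> carrier R"
  shows "anti r \<in> carrier R"
proof -
  have r': "r \<in> finsupp (carrier \<Lambda>) A" using r by (simp add: group_algebra_simps)
  note rD = finsuppD[OF r']
  show ?thesis unfolding group_algebra_simps
  proof (rule finsuppI)
    show "finite ((\<lambda>\<kappa>. inv \<kappa>) ` support A r)" "(\<lambda>\<kappa>. inv \<kappa>) ` support A r \<subseteq> carrier \<Lambda>"
      using rD by auto
    show "anti r \<nu> = \<zero>\<^bsub>A\<^esub>" if "\<nu> \<notin> (\<lambda>\<kappa>. inv \<kappa>) ` support A r" for \<nu>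
    proof (cases "\<nu> \<in> carrier \<Lambda>")
      case True
      then have "inv \<nu> \<notin> support A r" using that \<Lambda>.inv_inv[OF True] by (metis imageI)
      then show ?thesis by (simp add: antipode_def support_def)
    qed (simp add: antipode_def)
    show "anti r \<nu> \<in> carrier A" for \<nu> using rD(1) by (simp add: antipode_def)
  qed
qed

lemma antipode_single:
  assumes "\<kappa> \<in> carrier \<Lambda>" and "a \<in> carrier A"
  shows "anti (single A \<kappa> a) = single A (inv \<kappa>) a"
proof
  fix \<nu>
  have "inv \<nu> = \<kappa> \<longleftrightarrow> \<nu> = inv \<kappa>" if "\<nu> \<in> carrier \<Lambda>"
    using \<Lambda>.inv_inv[OF that] \<Lambda>.inv_inv[OF assms(1)] by metis
  moreover have "\<nu> \<noteq> inv \<kappa>" if "\<nu> \<notin> carrier \<Lambda>"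
    using that \<Lambda>.inv_closed[OF assms(1)] by metis
  ultimately show "anti (single A \<kappa> a) \<nu> = single A (inv \<kappa>) a \<nu>"
    using assms(1) by (cases "\<nu> \<in> carrier \<Lambda>") (simp_all add: antipode_def single_def)
qed

lemma antipode_add:
  assumes "r \<in> carrier R" and "s \<in> carrier R"
  shows "anti (r \<oplus>\<^bsub>R\<^esub> s) = anti r \<oplus>\<^bsub>R\<^esub> anti s"
  by (auto simp: antipode_def group_algebra_simps)

lemma antipode_zero: "anti \<zero>\<^bsub>R\<^esub> = \<zero>\<^bsub>R\<^esub>"
  by (auto simp: antipode_def group_algebra_simps)

lemma R_induct [consumes 1, case_names zero add]:
  assumes "r \<in> carrier R" and "Q \<zero>\<^bsub>R\<^esub>"
    and "\<And>s \<kappa> a. s \<in> carrier R \<Longrightarrow> \<kappa> \<in> carrier \<Lambda> \<Longrightarrow> a \<in> carrier A \<Longrightarrow> Q s \<Longrightarrow> Q (s \<oplus>\<^bsub>R\<^esub> single A \<kappa> a)"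
  shows "Q r"
  using A.finsupp_induct[of r "carrier \<Lambda>" Q] assms unfolding group_algebra_simps by blast

lemma antipode_mult:
  assumes r: "r \<in> carrier R" and s: "s \<in> carrier R"
  shows "anti (r \<otimes>\<^bsub>R\<^esub> s) = anti r \<otimes>\<^bsub>R\<^esub> anti s"
proof -
  interpret R: cring R by (rule group_algebra_cring)
  have single: "anti (single A \<kappa> a \<otimes>\<^bsub>R\<^esub> s) = anti (single A \<kappa> a) \<otimes>\<^bsub>R\<^esub> anti s"
    if "\<kappa> \<in> carrier \<Lambda>" "a \<in> carrier A" for \<kappa> a
    using s
  proof (induction rule: R_induct)
    case zero
    then show ?case using that by (simp add: antipode_zero antipode_closed single_in_R)
  next
    case (add s \<mu> b)
    then show ?case
      using that by (simp add: R.r_distr antipode_add antipode_closed single_in_R R_single_single antipode_single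
          \<Lambda>.inv_mult)
  qed
  show ?thesis
    using r
  proof (induction rule: R_induct)
    case zero
    then show ?case using s by (simp add: antipode_zero antipode_closed)
  next
    case (add r \<mu> b)
    then show ?case
      using s by (simp add: R.l_distr antipode_add antipode_closed single_in_R single)
  qed
qed

lemma antipode_one: "anti \<one>\<^bsub>R\<^esub> = \<one>\<^bsub>R\<^esub>"
  using antipode_single[OF \<Lambda>.one_closed A.one_closed] unfolding group_algebra_simps by simp

end

lemma conj_module_simps:
  "carrier (conj_module A \<Lambda> M) = carrier M" "\<zero>\<^bsub>conj_module A \<Lambda> M\<^esub> = \<zero>\<^bsub>M\<^esub>"
  "x \<oplus>\<^bsub>conj_module A \<Lambda> M\<^esub> y = x \<oplus>\<^bsub>M\<^esub> y" "r \<odot>\<^bsub>conj_module A \<Lambda> M\<^esub> x = antipode A \<Lambda> r \<odot>\<^bsub>M\<^esub> x"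
  by (simp_all add: conj_module_def)

lemma conj_module_add_monoid: "add_monoid (conj_module A \<Lambda> M) = add_monoid M"
  by (simp add: conj_module_def)

lemma conj_module_is_module:
  assumes A: "cring A" and \<Lambda>: "comm_group \<Lambda>" and M: "module (group_algebra A \<Lambda>) M"
  shows "module (group_algebra A \<Lambda>) (conj_module A \<Lambda> M)"
proof -
  interpret A: scalar_extension A \<Lambda> "regular_module A"
    by (intro scalar_extension.intro A \<Lambda> regular_module_is_module)
  interpret M: module "group_algebra A \<Lambda>" M by (rule M)
  show ?thesis
    by (intro moduleI abelian_groupI)
      (auto simp: conj_module_simps M.a_ac A.antipode_closed A.antipode_add A.antipode_mult A.antipode_one
        M.smult_l_distr M.smult_r_distr M.smult_assoc1 A.group_algebra_cring intro: bexI[of _ "\<ominus>\<^bsub>M\<^esub> _"] M.l_neg)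
qed

lemma conj_module_homs:
  assumes A: "cring A" and \<Lambda>: "comm_group \<Lambda>" and f: "f \<in> module_homs (group_algebra A \<Lambda>) M N"
  shows "f \<in> module_homs (group_algebra A \<Lambda>) (conj_module A \<Lambda> M) (conj_module A \<Lambda> N)"
proof -
  interpret A: scalar_extension A \<Lambda> "regular_module A"
    by (intro scalar_extension.intro A \<Lambda> regular_module_is_module)
  show ?thesis
    using f by (auto simp: module_homs_def conj_module_simps A.antipode_closed)
qed

lemma conj_submodule:
  assumes A: "cring A" and \<Lambda>: "comm_group \<Lambda>" and H: "submodule H (group_algebra A \<Lambda>) M"
  shows "submodule H (group_algebra A \<Lambda>) (conj_module A \<Lambda> M)"
proof -
  interpret A: scalar_extension A \<Lambda> "regular_module A"
    by (intro scalar_extension.intro A \<Lambda> regular_module_is_module)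
  show ?thesis
    using H unfolding submodule_def submodule_axioms_def conj_module_add_monoid
    by (auto simp: conj_module_simps A.antipode_closed)
qed

text \<open>The antipode affects the scalar multiplication only, so twisting P/L is the same as
  dividing the twisted \<open>P\<close> by \<open>L\<close>. The whole argument can thus run over
  the twisted \<open>P\<close>.\<close>

lemma conj_quotient_module:
  "conj_module A \<Lambda> (quotient_module M H) = quotient_module (conj_module A \<Lambda> M) H"
  unfolding conj_module_def quotient_module_def A_RCOSETS_def a_r_coset_def set_add_def
  by simp

section \<open>Group algebras over the integers modulo n\<close>

text \<open>Division with remainder by the least positive element of \<open>J\<close>. That n lies
  in \<open>J\<close> provides a positive element and makes the generator a divisor of n.\<close>

lemma int_subgroup_multiples:
  fixes J :: "int set" and n :: nat
  assumes n: "0 < n" "int n \<in> J" and diff: "\<And>a b. a \<in> J \<Longrightarrow> b \<in> J \<Longrightarrow> a - b \<in> J"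
  obtains d :: int where "0 < d" and "d dvd int n" and "\<And>c. c \<in> J \<longleftrightarrow> d dvd c"
proof -
  have zero: "0 \<in> J" using diff[OF n(2) n(2)] by simp
  have neg: "- a \<in> J" if "a \<in> J" for a using diff[OF zero that] by simp
  have add: "a + b \<in> J" if "a \<in> J" "b \<in> J" for a b using diff[OF that(1) neg[OF that(2)]] by simp
  have mult_nat: "int k * a \<in> J" if "a \<in> J" for a k
    by (induction k) (use zero add that in \<open>auto simp: algebra_simps\<close>)
  have mult: "k * a \<in> J" if "a \<in> J" for a k
    using mult_nat[OF that, of "nat k"] mult_nat[OF neg[OF that], of "nat (- k)"] by (cases "0 \<le> k") auto
  define m where "m = (LEAST m. 0 < m \<and> int m \<in> J)"
  have m: "0 < m \<and> int m \<in> J" unfolding m_def by (rule LeastI[of _ n]) (use n in simp)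
  have dvd: "int m dvd c" if "c \<in> J" for c
  proof -
    have "c - (c div int m) * int m \<in> J" by (rule diff[OF that mult]) (use m in simp)
    then have "int (nat (c mod int m)) \<in> J" using m by (simp add: minus_div_mult_eq_mod)
    then have "\<not> 0 < nat (c mod int m)"
      using Least_le[of "\<lambda>m. 0 < m \<and> int m \<in> J" "nat (c mod int m)"] m
      by (metis m_def nat_less_iff of_nat_0_less_iff pos_mod_bound pos_mod_sign not_le)
    then have "c mod int m \<le> 0" by simp
    then have "c mod int m = 0" using m pos_mod_sign[of "int m" c] by linarith
    then show ?thesis by auto
  qed
  show thesis
  proof (rule that[of "int m"])
    show "c \<in> J \<longleftrightarrow> int m dvd c" for c
      using dvd mult[of "int m"] m by (auto simp: dvd_def mult.commute)
  qed (use m dvd[OF n(2)] in auto)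
qed

locale zn_group_algebra = \<Lambda>: comm_group \<Lambda> for \<Lambda> :: "'l monoid" (structure) +
  fixes n :: nat
  assumes n_pos: "0 < n"
begin

abbreviation "Zn \<equiv> ZFact (int n)"
abbreviation "\<iota> \<equiv> ZMod (int n)"

lemma iota_coset: "\<iota> c = Idl\<^bsub>\<Z>\<^esub> {int n} +>\<^bsub>\<Z>\<^esub> c"
  by (simp add: ZMod_def)

lemma iota_ring_hom: "\<iota> \<in> ring_hom \<Z> Zn"
proof -
  interpret I: ideal "Idl\<^bsub>\<Z>\<^esub> {int n}" \<Z> by (rule int.genideal_ideal) simp
  show ?thesis using I.rcos_ring_hom by (simp add: ZFact_def iota_coset[abs_def])
qed

lemma iota_closed [simp]: "\<iota> c \<in> carrier Zn"
  and iota_add: "\<iota> (a + b) = \<iota> a \<oplus>\<^bsub>Zn\<^esub> \<iota> b"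
  and iota_mult: "\<iota> (a * b) = \<iota> a \<otimes>\<^bsub>Zn\<^esub> \<iota> b"
  and iota_one: "\<iota> 1 = \<one>\<^bsub>Zn\<^esub>"
  using ring_hom_closed[OF iota_ring_hom, of c] ring_hom_add[OF iota_ring_hom, of a b]
    ring_hom_mult[OF iota_ring_hom, of a b] ring_hom_one[OF iota_ring_hom] by simp_all

lemma iota_eq_iff: "\<iota> a = \<iota> b \<longleftrightarrow> int n dvd a - b"
  by (simp add: ZMod_eq_mod mod_eq_dvd_iff)

text \<open>A natural number as representative permits the induction by repeated addition in
  \<open>R_induct_mono\<close>.\<close>

lemma iota_surj:
  assumes "a \<in> carrier Zn"
  obtains c where "a = \<iota> (int c)"
proof -
  have "carrier Zn = a_rcosets\<^bsub>\<Z>\<^esub> (Idl\<^bsub>\<Z>\<^esub> {int n})" by (simp add: ZFact_def FactRing_def)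
  then obtain c where "a = \<iota> c" using assms by (auto simp: A_RCOSETS_def' iota_coset)
  then have "a = \<iota> (int (nat (c mod int n)))" using n_pos by (simp add: ZMod_mod[symmetric])
  then show thesis by (rule that)
qed

sublocale Rg: scalar_extension Zn \<Lambda> "regular_module Zn"
  by (intro scalar_extension.intro ZFact_is_cring \<Lambda>.comm_group_axioms regular_module_is_module)

abbreviation "R \<equiv> group_algebra Zn \<Lambda>"

sublocale R: cring R by (rule Rg.group_algebra_cring)

lemma iota_zero: "\<iota> 0 = \<zero>\<^bsub>Zn\<^esub>"
proof -
  have "\<iota> 0 = \<iota> 0 \<oplus>\<^bsub>Zn\<^esub> \<iota> 0" using iota_add[of 0 0] by simp
  then show ?thesis using Rg.A.add.r_cancel_one'[of "\<iota> 0" "\<iota> 0"] by simp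
qed

lemma iota_eq_zero_iff: "\<iota> a = \<zero>\<^bsub>Zn\<^esub> \<longleftrightarrow> int n dvd a"
  using iota_eq_iff[of a 0] by (simp add: iota_zero)

definition const :: "int \<Rightarrow> 'l \<Rightarrow> int set" where
  "const c = single Zn \<one> (\<iota> c)"

definition mono :: "'l \<Rightarrow> 'l \<Rightarrow> int set" where
  "mono \<kappa> = single Zn \<kappa> \<one>\<^bsub>Zn\<^esub>"

lemma const_closed [simp]: "const c \<in> carrier R"
  by (simp add: const_def Rg.single_in_R)

lemma mono_closed [simp]: "\<kappa> \<in> carrier \<Lambda> \<Longrightarrow> mono \<kappa> \<in> carrier R"
  by (simp add: mono_def Rg.single_in_R)

lemma R_coeff [simp]: "r \<in> carrier R \<Longrightarrow> r \<nu> \<in> carrier Zn"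
  and R_coeff_outside: "r \<in> carrier R \<Longrightarrow> \<nu> \<notin> carrier \<Lambda> \<Longrightarrow> r \<nu> = \<zero>\<^bsub>Zn\<^esub>"
  using finsuppD[of r "carrier \<Lambda>" Zn] by (auto simp: group_algebra_simps)

lemma const_mult_coeff:
  assumes "r \<in> carrier R"
  shows "(const c \<otimes>\<^bsub>R\<^esub> r) \<nu> = \<iota> c \<otimes>\<^bsub>Zn\<^esub> r \<nu>"
  unfolding const_def Rg.R_single_mult[OF iota_closed \<Lambda>.one_closed assms]
  using assms R_coeff_outside[OF assms] by simp

lemma mono_mult_coeff:
  assumes "r \<in> carrier R" and "\<kappa> \<in> carrier \<Lambda>" and "\<nu> \<in> carrier \<Lambda>"
  shows "(mono \<kappa> \<otimes>\<^bsub>R\<^esub> r) \<nu> = r (inv \<kappa> \<otimes> \<nu>)"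
  unfolding mono_def Rg.R_single_mult[OF Rg.A.one_closed assms(2,1)]
  using assms by simp

lemma const_zero: "const 0 = \<zero>\<^bsub>R\<^esub>" and const_one: "const 1 = \<one>\<^bsub>R\<^esub>"
  by (auto simp: const_def iota_zero iota_one group_algebra_simps single_def)

lemma const_mult: "const (a * b) = const a \<otimes>\<^bsub>R\<^esub> const b"
  by (simp add: const_def Rg.R_single_single iota_mult)

lemma const_n: "n dvd a \<Longrightarrow> const (int a) = \<zero>\<^bsub>R\<^esub>"
  using iota_eq_zero_iff[of "int a"] by (auto simp: const_def single_def group_algebra_simps fun_eq_iff)

lemma mono_one: "mono \<one> = \<one>\<^bsub>R\<^esub>"
  by (simp add: mono_def group_algebra_simps)

lemma mono_mult:
  "\<kappa> \<in> carrier \<Lambda> \<Longrightarrow> \<mu> \<in> carrier \<Lambda> \<Longrightarrow> mono \<kappa> \<otimes>\<^bsub>R\<^esub> mono \<mu> = mono (\<kappa> \<otimes> \<mu>)"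
  by (simp add: mono_def Rg.R_single_single)

text \<open>The integers modulo n are generated by 1 under addition, so monomials alone generate
  \<open>R\<close> additively. Linearity over \<open>R\<close> thereby reduces to additivity and
  compatibility with \<Lambda>.\<close>

lemma R_induct_mono [consumes 1, case_names zero mono add]:
  assumes "r \<in> carrier R" and zero: "Q \<zero>\<^bsub>R\<^esub>"
    and mono: "\<And>\<kappa>. \<kappa> \<in> carrier \<Lambda> \<Longrightarrow> Q (mono \<kappa>)"
    and add: "\<And>r s. r \<in> carrier R \<Longrightarrow> s \<in> carrier R \<Longrightarrow> Q r \<Longrightarrow> Q s \<Longrightarrow> Q (r \<oplus>\<^bsub>R\<^esub> s)"
  shows "Q r"
  using assms(1)
proof (induction rule: Rg.R_induct)
  case (add s \<kappa> a)
  obtain c where a: "a = \<iota> (int c)" using iota_surj[OF add(3)] .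
  have "Q (single Zn \<kappa> (\<iota> (int c)))"
  proof (induction c)
    case 0
    then show ?case using zero by (simp add: iota_zero single_def group_algebra_simps)
  next
    case (Suc c)
    have "single Zn \<kappa> (\<iota> (int (Suc c))) = single Zn \<kappa> (\<iota> (int c)) \<oplus>\<^bsub>R\<^esub> mono \<kappa>"
      by (auto simp: single_def mono_def group_algebra_simps iota_add iota_one Rg.A.a_comm fun_eq_iff)
    then show ?case using Suc assms(4) mono add(2) by (simp add: Rg.single_in_R)
  qed
  then show ?case using assms(4) add by (simp add: a Rg.single_in_R)
qed (rule zero)

lemma module_homs_monoI:
  fixes M :: "('l \<Rightarrow> int set, 'm) module" and N :: "('l \<Rightarrow> int set, 'k) module"
  assumes M: "module R M" and N: "module R N"
    and closed: "\<And>x. x \<in> carrier M \<Longrightarrow> f x \<in> carrier N"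
    and add: "\<And>x y. x \<in> carrier M \<Longrightarrow> y \<in> carrier M \<Longrightarrow> f (x \<oplus>\<^bsub>M\<^esub> y) = f x \<oplus>\<^bsub>N\<^esub> f y"
    and mono: "\<And>\<kappa> x. \<kappa> \<in> carrier \<Lambda> \<Longrightarrow> x \<in> carrier M \<Longrightarrow> f (mono \<kappa> \<odot>\<^bsub>M\<^esub> x) = mono \<kappa> \<odot>\<^bsub>N\<^esub> f x"
  shows "f \<in> module_homs R M N"
proof (rule module_homsI[OF closed add])
  interpret M: module R M by (rule M)
  interpret N: module R N by (rule N)
  show "f (r \<odot>\<^bsub>M\<^esub> x) = r \<odot>\<^bsub>N\<^esub> f x" if r: "r \<in> carrier R" and x: "x \<in> carrier M" for r x
    using r
  proof (induction rule: R_induct_mono)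
    case zero
    have "f \<zero>\<^bsub>M\<^esub> = \<zero>\<^bsub>N\<^esub>"
      by (rule additive_zero_minus(1)[OF M.abelian_group_axioms N.abelian_group_axioms closed add])
    then show ?case using x closed by simp
  next
    case (add r s)
    then show ?case using x closed by (simp add: M.smult_l_distr N.smult_l_distr assms(4))
  qed (simp add: mono x)
qed

text \<open>Coefficients are divided one by one, with 0 outside the support of \<open>r\<close>.
  This keeps the quotient finitely supported, and the bound on its support later keeps it in the
  algebra of a subgroup.\<close>

lemma R_divisible_by_const:
  assumes r: "r \<in> carrier R" and d: "\<And>\<nu>. \<nu> \<in> carrier \<Lambda> \<Longrightarrow> \<exists>c. r \<nu> = \<iota> (d * c)"
  obtains s where "s \<in> carrier R" and "r = const d \<otimes>\<^bsub>R\<^esub> s" and "support Zn s \<subseteq> support Zn r"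
proof -
  obtain c where c: "\<And>\<nu>. \<nu> \<in> carrier \<Lambda> \<Longrightarrow> r \<nu> = \<iota> (d * c \<nu>)" using d by metis
  define s where "s = (\<lambda>\<nu>. if \<nu> \<in> support Zn r then \<iota> (c \<nu>) else \<zero>\<^bsub>Zn\<^esub>)"
  have rD: "support Zn r \<subseteq> carrier \<Lambda>" "finite (support Zn r)"
    using r finsuppD[of r "carrier \<Lambda>" Zn] by (auto simp: group_algebra_simps)
  have s: "s \<in> carrier R" unfolding group_algebra_simps
    by (rule finsuppI[OF _ rD(2,1)]) (auto simp: s_def)
  have "r \<nu> = (const d \<otimes>\<^bsub>R\<^esub> s) \<nu>" for \<nu>
  proof (cases "\<nu> \<in> support Zn r")
    case True
    then show ?thesis unfolding const_mult_coeff[OF s] using c[of \<nu>] rD(1) by (auto simp: s_def iota_mult)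
  next
    case False
    then show ?thesis unfolding const_mult_coeff[OF s] by (simp add: s_def support_def)
  qed
  moreover have "support Zn s \<subseteq> support Zn r" by (auto simp: s_def support_def)
  ultimately show thesis using that s by blast
qed

text \<open>Self-injectivity of the integers modulo \<open>n\<close>, in the form needed for \<open>hom_extension_step\<close>.\<close>

lemma R_divisible_if_annihilated:
  assumes d: "0 < d" "d dvd int n" and y: "y \<in> carrier R"
    and ann: "const (int n div d) \<otimes>\<^bsub>R\<^esub> y = \<zero>\<^bsub>R\<^esub>"
  shows "\<exists>z\<in>carrier R. y = const d \<otimes>\<^bsub>R\<^esub> z"
proof -
  have "\<exists>c. y \<nu> = \<iota> (d * c)" for \<nu>
  proof -
    obtain c where c: "y \<nu> = \<iota> (int c)" using iota_surj[OF R_coeff[OF y]] .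
    have "\<iota> (int n div d) \<otimes>\<^bsub>Zn\<^esub> y \<nu> = \<zero>\<^bsub>Zn\<^esub>"
      using fun_cong[OF ann, of \<nu>] by (simp add: const_mult_coeff[OF y] group_algebra_simps)
    then have "int n dvd int n div d * int c" by (simp add: c iota_eq_zero_iff flip: iota_mult)
    \<comment> \<open>With n = d e the divisibility reads: d e divides e c. The factor e is non-zero
      and cancels.\<close>
    moreover obtain e where e: "int n = d * e" using d(2) by blast
    moreover have "e \<noteq> 0" using e n_pos by auto
    ultimately have "d dvd int c" using d(1) by (simp add: mult.commute)
    then show ?thesis using c by (auto simp: dvd_def)
  qed
  then show ?thesis using R_divisible_by_const[OF y, of d] by metis
qed


definition reg :: "('l \<Rightarrow> int set, 'l \<Rightarrow> int set) module" where
  "reg = regular_module R"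

lemma reg_module: "module R reg"
  unfolding reg_def by (rule regular_module_is_module) (rule R.is_cring)

lemma reg_simps:
  "carrier reg = carrier R" "\<zero>\<^bsub>reg\<^esub> = \<zero>\<^bsub>R\<^esub>" "x \<oplus>\<^bsub>reg\<^esub> y = x \<oplus>\<^bsub>R\<^esub> y" "x \<odot>\<^bsub>reg\<^esub> y = x \<otimes>\<^bsub>R\<^esub> y"
  by (simp_all add: reg_def regular_module_simps)

end

locale zn_coefficient_module = zn_group_algebra \<Lambda> n + P0: module "ZFact (int n)" P0
  for \<Lambda> :: "'l monoid" (structure) and n :: nat and P0 :: "(int set, 'p) module"
begin

sublocale X: scalar_extension Zn \<Lambda> P0
  by (intro scalar_extension.intro ZFact_is_cring \<Lambda>.comm_group_axioms P0.module_axioms)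

abbreviation "PP \<equiv> conj_module Zn \<Lambda> (extend_scalars Zn \<Lambda> P0)"

lemma PP_module: "module R PP"
  by (intro conj_module_is_module ZFact_is_cring \<Lambda>.comm_group_axioms X.E_is_module)

lemma PP_carrier: "carrier PP = finsupp (carrier \<Lambda>) P0"
  and PP_zero: "\<zero>\<^bsub>PP\<^esub> = (\<lambda>_. \<zero>\<^bsub>P0\<^esub>)"
  and PP_add: "f \<oplus>\<^bsub>PP\<^esub> g = (\<lambda>\<nu>. f \<nu> \<oplus>\<^bsub>P0\<^esub> g \<nu>)"
  by (simp_all add: conj_module_simps X.carrier_E X.zero_E X.add_E)

definition embed :: "'p \<Rightarrow> 'l \<Rightarrow> 'p" where
  "embed p = single P0 \<one> p"

lemma embed_closed: "p \<in> carrier P0 \<Longrightarrow> embed p \<in> carrier PP"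
  by (simp add: embed_def PP_carrier P0.single_finsupp)

text \<open>The inverse comes from the twist: in \<open>PP\<close> the monomial at \<kappa> moves p
  to the exponent \<open>inv \<kappa>\<close>. The induction is done in the untwisted module, where
  no inverse occurs.\<close>

lemma smult_embed:
  assumes r: "r \<in> carrier R" and p: "p \<in> carrier P0" and \<nu>: "\<nu> \<in> carrier \<Lambda>"
  shows "(r \<odot>\<^bsub>PP\<^esub> embed p) \<nu> = r (inv \<nu>) \<odot>\<^bsub>P0\<^esub> p"
proof -
  have "(r \<odot>\<^bsub>X.E\<^esub> embed p) \<nu> = r \<nu> \<odot>\<^bsub>P0\<^esub> p" if "r \<in> carrier R" for r
    using that
  proof (induction rule: Rg.R_induct)
    case zero
    then show ?case
      using p by (simp add: group_algebra_simps X.smult_E_zero embed_def P0.single_finsupp)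
  next
    case (add s \<kappa> a)
    have s: "s \<in> finsupp (carrier \<Lambda>) Zn" "s \<nu> \<in> carrier Zn" using add by (simp_all add: group_algebra_simps finsuppD(1))
    have "(s \<oplus>\<^bsub>R\<^esub> single Zn \<kappa> a) \<odot>\<^bsub>X.E\<^esub> embed p = (\<lambda>\<nu>. (s \<odot>\<^bsub>X.E\<^esub> embed p) \<nu> \<oplus>\<^bsub>P0\<^esub> single P0 \<kappa> (a \<odot>\<^bsub>P0\<^esub> p) \<nu>)"
      using s add p by (simp add: group_algebra_simps embed_def X.smult_E_add_left P0.single_finsupp
          Rg.A.single_finsupp X.smult_E_single_single)
    then show ?case
      using add s p by (simp add: group_algebra_simps single_def P0.smult_l_distr)
  qed
  from this[OF Rg.antipode_closed[OF r]] show ?thesis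
    using \<nu> by (simp add: conj_module_simps antipode_def)
qed

lemma mono_smult_PP:
  assumes \<kappa>: "\<kappa> \<in> carrier \<Lambda>" and f: "f \<in> carrier PP"
  shows "(mono \<kappa> \<odot>\<^bsub>PP\<^esub> f) \<nu> = (if \<nu> \<in> carrier \<Lambda> then f (\<kappa> \<otimes> \<nu>) else \<zero>\<^bsub>P0\<^esub>)"
  using X.smult_E_single[of "\<one>\<^bsub>Zn\<^esub>" "inv \<kappa>" f] assms finsuppD(1)[of f "carrier \<Lambda>" P0]
  by (simp add: conj_module_simps mono_def Rg.antipode_single X.carrier_E)

text \<open>
  The vanishing of the first Ext of \<open>PP\<close> into the group algebra: a homomorphism on the kernel of
  \<open>q\<close> is extended over the preimages of \<open>N[\<Lambda>]\<close>, for larger and larger submodules \<open>N\<close> of \<open>P0\<close>.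
\<close>

lemma extend_from_kernel:
  fixes E :: "('l \<Rightarrow> int set, 'e) module"
  assumes fg: "finitely_generated_module Zn P0"
    and E: "module R E" and q: "q \<in> module_homs R E PP" and q_surj: "q ` carrier E = carrier PP"
    and \<theta>: "\<theta> \<in> module_homs R (E\<lparr>carrier := a_kernel E PP q\<rparr>) reg"
  shows "\<exists>h\<in>module_homs R E reg. \<forall>k\<in>a_kernel E PP q. h k = \<theta> k"
proof -
  interpret E: module R E by (rule E)
  interpret PP: module R PP by (rule PP_module)
  \<comment> \<open>The preimage of N[\<Lambda>]. It grows from the kernel of \<open>q\<close>, for
    N = 0, to all of \<open>E\<close>, for N = \<open>P0\<close>.\<close>
  define pre where "pre N = {e \<in> carrier E. \<forall>\<nu>. q e \<nu> \<in> N}" for N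
  note q_closed = module_homs_closed[OF q] and q_add = module_homs_add[OF q] and q_smult = module_homs_smult[OF q]
  have q_val: "q e \<nu> \<in> carrier P0" "\<nu> \<notin> carrier \<Lambda> \<Longrightarrow> q e \<nu> = \<zero>\<^bsub>P0\<^esub>" if "e \<in> carrier E" for e \<nu>
    using finsuppD[of "q e" "carrier \<Lambda>" P0] q_closed[OF that] by (auto simp: PP_carrier)
  have pre_submodule: "submodule (pre N) R E" if N: "submodule N Zn P0" for N
  proof -
    note N_add = P0.submoduleE(5)[OF N] and N_zero = P0.submodule_zero[OF N]
    have zero: "\<zero>\<^bsub>E\<^esub> \<in> pre N"
      using N_zero by (simp add: pre_def module_homs_zero_minus(1)[OF E PP_module q] PP_zero)
    have add: "e \<oplus>\<^bsub>E\<^esub> e' \<in> pre N" if "e \<in> pre N" "e' \<in> pre N" for e e'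
      using that N_add by (simp add: pre_def q_add PP_add)
    have smult: "r \<odot>\<^bsub>E\<^esub> e \<in> pre N" if "r \<in> carrier R" "e \<in> pre N" for r e
      using that(1)
    proof (induction rule: R_induct_mono)
      case (mono \<kappa>)
      have "e \<in> carrier E" using that by (simp add: pre_def)
      then show ?case
        using that mono N_zero by (simp add: pre_def q_smult mono_smult_PP q_closed)
    next
      case (add r s)
      then show ?case using that \<open>\<And>e e'. e \<in> pre N \<Longrightarrow> e' \<in> pre N \<Longrightarrow> e \<oplus>\<^bsub>E\<^esub> e' \<in> pre N\<close>
        by (simp add: E.smult_l_distr pre_def)
    qed (use that zero in \<open>simp add: pre_def\<close>)
    show ?thesis
      by (rule E.submoduleI_smult[OF _ zero add smult]) (auto simp: pre_def)
  qed
  have claim: "\<exists>N h. submodule N Zn P0 \<and> S \<subseteq> N \<and> submodule (pre N) R E \<and>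
      h \<in> module_homs R (E\<lparr>carrier := pre N\<rparr>) reg \<and> (\<forall>k\<in>a_kernel E PP q. h k = \<theta> k)"
    if "finite S" "S \<subseteq> carrier P0" for S
    using that
  proof (induction rule: finite_induct)
    case empty
    have "pre {\<zero>\<^bsub>P0\<^esub>} = a_kernel E PP q"
      by (auto simp: pre_def a_kernel_def' PP_zero)
    moreover have "submodule {\<zero>\<^bsub>P0\<^esub>} Zn P0" by (rule P0.submoduleI) (simp_all add: P0.add.inv_one)
    moreover have "submodule (a_kernel E PP q) R E" by (rule module_homs_kernel_submodule[OF E PP_module q])
    ultimately show ?case using \<theta> by (metis empty_subsetI)
  next
    case (insert p S)
    then obtain N h where N: "submodule N Zn P0" and SN: "S \<subseteq> N" and K: "submodule (pre N) R E"
      and h: "h \<in> module_homs R (E\<lparr>carrier := pre N\<rparr>) reg" and h_eq: "\<forall>k\<in>a_kernel E PP q. h k = \<theta> k"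
      by auto
    note NP = P0.submoduleE(1)[OF N] and N_smult = P0.submoduleE(4)[OF N] and N_add = P0.submoduleE(5)[OF N]
      and N_inv = P0.submoduleE(3)[OF N]
    have p: "p \<in> carrier P0" using insert by simp
    note N_zero = P0.submodule_zero[OF N]
    obtain x where x: "x \<in> carrier E" "q x = embed p"
      using q_surj embed_closed[OF p] by (metis imageE)
    \<comment> \<open>The coefficients of a multiple of \<open>embed p\<close> are multiples of p,
      so whether it lies in N[\<Lambda>] is decided coefficient by coefficient. Hence the scalars
      carrying \<open>x\<close> into \<open>pre N\<close> are the multiples of the integer d
      generating \<open>J\<close>, and the extension step applies with u = 1.\<close>
    define J where "J = {c. \<iota> c \<odot>\<^bsub>P0\<^esub> p \<in> N}"
    obtain d where d: "0 < d" "d dvd int n" "\<And>c. c \<in> J \<longleftrightarrow> d dvd c"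
    proof (rule int_subgroup_multiples[OF n_pos, of J])
      show "int n \<in> J" using p N_zero iota_eq_zero_iff[of "int n"] by (simp add: J_def)
      show "a - b \<in> J" if "a \<in> J" "b \<in> J" for a b
      proof -
        have "\<iota> a = \<iota> (a - b) \<oplus>\<^bsub>Zn\<^esub> \<iota> b" by (simp flip: iota_add)
        then have "\<iota> a \<odot>\<^bsub>P0\<^esub> p = \<iota> (a - b) \<odot>\<^bsub>P0\<^esub> p \<oplus>\<^bsub>P0\<^esub> \<iota> b \<odot>\<^bsub>P0\<^esub> p"
          using p by (simp add: P0.smult_l_distr)
        then have "\<iota> (a - b) \<odot>\<^bsub>P0\<^esub> p = \<iota> a \<odot>\<^bsub>P0\<^esub> p \<oplus>\<^bsub>P0\<^esub> \<ominus>\<^bsub>P0\<^esub> (\<iota> b \<odot>\<^bsub>P0\<^esub> p)"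
          using p by (simp add: P0.a_assoc P0.r_neg)
        then show ?thesis using that N_add N_inv by (simp add: J_def)
      qed
    qed blast
    have qx: "q (r \<odot>\<^bsub>E\<^esub> x) \<nu> = r (inv \<nu>) \<odot>\<^bsub>P0\<^esub> p" if "r \<in> carrier R" "\<nu> \<in> carrier \<Lambda>" for r \<nu>
      using that by (simp add: q_smult x smult_embed p)
    have in_pre: "r \<odot>\<^bsub>E\<^esub> x \<in> pre N \<longleftrightarrow> (\<forall>\<nu>\<in>carrier \<Lambda>. r \<nu> \<odot>\<^bsub>P0\<^esub> p \<in> N)" if r: "r \<in> carrier R" for r
    proof -
      have rx: "r \<odot>\<^bsub>E\<^esub> x \<in> carrier E" using r x by simp
      have "r \<odot>\<^bsub>E\<^esub> x \<in> pre N \<longleftrightarrow> (\<forall>\<nu>\<in>carrier \<Lambda>. q (r \<odot>\<^bsub>E\<^esub> x) \<nu> \<in> N)"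
      proof -
        have "q (r \<odot>\<^bsub>E\<^esub> x) \<nu> \<in> N" if "\<nu> \<notin> carrier \<Lambda>" for \<nu> using q_val(2)[OF rx that] N_zero by simp
        then show ?thesis using rx unfolding pre_def by blast
      qed
      also have "\<dots> \<longleftrightarrow> (\<forall>\<nu>\<in>carrier \<Lambda>. r (inv \<nu>) \<odot>\<^bsub>P0\<^esub> p \<in> N)"
        by (simp add: qx[OF r])
      also have "\<dots> \<longleftrightarrow> (\<forall>\<nu>\<in>carrier \<Lambda>. r \<nu> \<odot>\<^bsub>P0\<^esub> p \<in> N)"
        using \<Lambda>.inv_inv \<Lambda>.inv_closed by metis
      finally show ?thesis .
    qed
    have dx: "(const d \<otimes>\<^bsub>R\<^esub> \<one>\<^bsub>R\<^esub>) \<odot>\<^bsub>E\<^esub> x \<in> pre N"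
    proof -
      have "\<iota> d \<odot>\<^bsub>P0\<^esub> p \<in> N" using d(3)[of d] by (simp add: J_def)
      then have "const d \<nu> \<odot>\<^bsub>P0\<^esub> p \<in> N" for \<nu> using N_zero p by (simp add: const_def single_def)
      then show ?thesis by (simp add: in_pre)
    qed
    obtain K' h' where K': "submodule K' R E" and KK': "pre N \<subseteq> K'" and xK': "x \<in> K'"
      and h': "h' \<in> module_homs R (E\<lparr>carrier := K'\<rparr>) reg"
      and h'_eq: "\<And>k. k \<in> pre N \<Longrightarrow> h' k = \<one>\<^bsub>R\<^esub> \<odot>\<^bsub>reg\<^esub> h k"
    proof (rule hom_extension_step[OF E reg_module K h x(1) const_closed R.one_closed dx])
      show "\<exists>c\<in>carrier R. b = c \<otimes>\<^bsub>R\<^esub> const d" if b: "b \<in> carrier R" "b \<odot>\<^bsub>E\<^esub> x \<in> pre N" for b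
      proof -
        have "\<exists>c. b \<nu> = \<iota> (d * c)" if \<nu>: "\<nu> \<in> carrier \<Lambda>" for \<nu>
        proof -
          obtain c where c: "b \<nu> = \<iota> (int c)" using iota_surj[OF R_coeff[OF b(1)]] .
          have "b \<nu> \<odot>\<^bsub>P0\<^esub> p \<in> N" using b \<nu> in_pre by blast
          then have "int c \<in> J" by (simp add: J_def c)
          then show ?thesis using c d(3) by (auto simp: dvd_def)
        qed
        from R_divisible_by_const[OF b(1) this] show ?thesis by (metis R.m_comm const_closed)
      qed
      show "\<exists>z\<in>carrier reg. y = const d \<odot>\<^bsub>reg\<^esub> z"
        if y: "y \<in> carrier reg" and ann: "\<And>b. b \<in> carrier R \<Longrightarrow> b \<otimes>\<^bsub>R\<^esub> const d = \<zero>\<^bsub>R\<^esub> \<Longrightarrow> b \<odot>\<^bsub>reg\<^esub> y = \<zero>\<^bsub>reg\<^esub>" for y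
      proof -
        have "const (int n div d) \<otimes>\<^bsub>R\<^esub> const d = \<zero>\<^bsub>R\<^esub>"
          using d const_n[of n] by (simp flip: const_mult)
        then show ?thesis
          using R_divisible_if_annihilated[OF d(1,2)] ann[OF const_closed] y by (simp add: reg_simps)
      qed
    qed blast
    define N' where "N' = {m \<oplus>\<^bsub>P0\<^esub> a \<odot>\<^bsub>P0\<^esub> p | m a. m \<in> N \<and> a \<in> carrier Zn}"
    have N'I: "m \<oplus>\<^bsub>P0\<^esub> a \<odot>\<^bsub>P0\<^esub> p \<in> N'" if "m \<in> N" "a \<in> carrier Zn" for m a using that by (auto simp: N'_def)
    have N': "submodule N' Zn P0"
    proof (rule P0.submoduleI_smult)
      show "N' \<subseteq> carrier P0" using NP p by (auto simp: N'_def)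
      show "\<zero>\<^bsub>P0\<^esub> \<in> N'" using N'I[OF N_zero, of "\<zero>\<^bsub>Zn\<^esub>"] p by simp
      fix e assume "e \<in> N'"
      then obtain m a where e: "m \<in> N" "a \<in> carrier Zn" "e = m \<oplus>\<^bsub>P0\<^esub> a \<odot>\<^bsub>P0\<^esub> p" by (auto simp: N'_def)
      have mP: "m \<in> carrier P0" using e(1) NP by blast
      show "r \<odot>\<^bsub>P0\<^esub> e \<in> N'" if "r \<in> carrier Zn" for r
        using N'I[OF N_smult[OF that e(1)], of "r \<otimes>\<^bsub>Zn\<^esub> a"] e mP p that
        by (simp add: P0.smult_r_distr P0.smult_assoc1)
      fix e' assume "e' \<in> N'"
      then obtain m' a' where e': "m' \<in> N" "a' \<in> carrier Zn" "e' = m' \<oplus>\<^bsub>P0\<^esub> a' \<odot>\<^bsub>P0\<^esub> p"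
        by (auto simp: N'_def)
      have "m' \<in> carrier P0" using e'(1) NP by blast
      then have "e \<oplus>\<^bsub>P0\<^esub> e' = (m \<oplus>\<^bsub>P0\<^esub> m') \<oplus>\<^bsub>P0\<^esub> (a \<oplus>\<^bsub>Zn\<^esub> a') \<odot>\<^bsub>P0\<^esub> p"
        using e e' mP p by (simp add: P0.smult_l_distr P0.a_ac)
      then show "e \<oplus>\<^bsub>P0\<^esub> e' \<in> N'" using N'I[OF N_add[OF e(1) e'(1)]] e(2) e'(2) by simp
    qed
    have SN': "insert p S \<subseteq> N'"
    proof -
      have "m \<in> N'" if "m \<in> N" for m using N'I[OF that, of "\<zero>\<^bsub>Zn\<^esub>"] that NP p by (simp add: subset_iff)
      moreover have "p \<in> N'" using N'I[OF N_zero, of "\<one>\<^bsub>Zn\<^esub>"] p by simp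
      ultimately show ?thesis using SN by blast
    qed
    \<comment> \<open>Modulo \<open>N\<close> each coefficient of \<open>q e\<close> is a multiple
      of p. The multipliers form a ring element, the antipode undoes the twist, and subtracting the
      resulting multiple of \<open>x\<close> from \<open>e\<close> lands in
      \<open>pre N\<close>.\<close>
    have pre_sub: "e \<in> K'" if "e \<in> pre N'" for e
    proof -
      have e: "e \<in> carrier E" "\<And>\<nu>. q e \<nu> \<in> N'" using that by (simp_all add: pre_def)
      \<comment> \<open>Taking the multiplier 0 wherever \<open>q e\<close> vanishes gives the
        family of multipliers finite support.\<close>
      have "\<exists>a. a \<in> carrier Zn \<and> q e \<nu> \<ominus>\<^bsub>P0\<^esub> a \<odot>\<^bsub>P0\<^esub> p \<in> N \<and> (q e \<nu> = \<zero>\<^bsub>P0\<^esub> \<longrightarrow> a = \<zero>\<^bsub>Zn\<^esub>)" for \<nu>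
      proof (cases "q e \<nu> = \<zero>\<^bsub>P0\<^esub>")
        case True
        then show ?thesis using N_zero p by (intro exI[of _ "\<zero>\<^bsub>Zn\<^esub>"]) (simp add: P0.diff_zero)
      next
        case False
        from e(2)[of \<nu>] obtain m a where ma: "m \<in> N" "a \<in> carrier Zn" "q e \<nu> = m \<oplus>\<^bsub>P0\<^esub> a \<odot>\<^bsub>P0\<^esub> p"
          by (auto simp: N'_def)
        then have "q e \<nu> \<ominus>\<^bsub>P0\<^esub> a \<odot>\<^bsub>P0\<^esub> p = m"
          using NP p by (auto simp: P0.minus_eq P0.a_assoc P0.r_neg subset_iff)
        then show ?thesis using ma False by blast
      qed
      then obtain a where a: "\<And>\<nu>. a \<nu> \<in> carrier Zn" "\<And>\<nu>. q e \<nu> \<ominus>\<^bsub>P0\<^esub> a \<nu> \<odot>\<^bsub>P0\<^esub> p \<in> N"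
        "\<And>\<nu>. q e \<nu> = \<zero>\<^bsub>P0\<^esub> \<Longrightarrow> a \<nu> = \<zero>\<^bsub>Zn\<^esub>" by metis
      have "q e \<in> finsupp (carrier \<Lambda>) P0" using q_closed[OF e(1)] by (simp add: PP_carrier)
      note qeD = finsuppD[OF this]
      have aR: "a \<in> carrier R" unfolding group_algebra_simps
        by (rule finsuppI[OF a(1) qeD(3,2)]) (use a(3) in \<open>simp add: support_def\<close>)
      define r where "r = antipode Zn \<Lambda> a"
      have r: "r \<in> carrier R" unfolding r_def by (rule Rg.antipode_closed[OF aR])
      have rx: "r \<odot>\<^bsub>E\<^esub> x \<in> carrier E" using r x(1) by simp
      have "q (e \<ominus>\<^bsub>E\<^esub> r \<odot>\<^bsub>E\<^esub> x) \<nu> \<in> N" for \<nu>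
      proof (cases "\<nu> \<in> carrier \<Lambda>")
        case True
        have "q (r \<odot>\<^bsub>E\<^esub> x) \<nu> = a \<nu> \<odot>\<^bsub>P0\<^esub> p" using qx[OF r True] True by (simp add: r_def antipode_def)
        moreover have "q (e \<ominus>\<^bsub>E\<^esub> r \<odot>\<^bsub>E\<^esub> x) \<nu> = q e \<nu> \<ominus>\<^bsub>P0\<^esub> q (r \<odot>\<^bsub>E\<^esub> x) \<nu>"
          by (rule additive_zero_minus(3)[OF E.abelian_group_axioms P0.abelian_group_axioms, where f = "\<lambda>e. q e \<nu>"])
            (use e rx q_val in \<open>simp_all add: q_add PP_add\<close>)
        ultimately show ?thesis using a(2)[of \<nu>] by simp
      next
        case False
        then show ?thesis using q_val(2)[of "e \<ominus>\<^bsub>E\<^esub> r \<odot>\<^bsub>E\<^esub> x" \<nu>] e(1) rx N_zero by simp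
      qed
      then have "e \<ominus>\<^bsub>E\<^esub> r \<odot>\<^bsub>E\<^esub> x \<in> K'" using KK' e(1) rx by (auto simp: pre_def)
      moreover have "r \<odot>\<^bsub>E\<^esub> x \<in> K'" by (rule E.submoduleE(4)[OF K' r xK'])
      ultimately have "(e \<ominus>\<^bsub>E\<^esub> r \<odot>\<^bsub>E\<^esub> x) \<oplus>\<^bsub>E\<^esub> r \<odot>\<^bsub>E\<^esub> x \<in> K'" by (rule E.submoduleE(5)[OF K'])
      then show ?thesis using e(1) rx by (simp add: E.minus_eq E.a_assoc E.l_neg)
    qed
    have "h' \<in> module_homs R (E\<lparr>carrier := K'\<rparr>\<lparr>carrier := pre N'\<rparr>) reg"
      by (rule module_homs_restrict_domain[OF h']) (use pre_sub in auto)
    moreover have "h' k = \<theta> k" if "k \<in> a_kernel E PP q" for k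
    proof -
      have "k \<in> pre N" using that N_zero by (simp add: a_kernel_def' pre_def PP_zero)
      then show ?thesis
        using h'_eq h_eq that module_homs_closed[OF h, of k] by (simp add: reg_simps)
    qed
    ultimately show ?case using N' SN' pre_submodule[OF N'] by (intro exI[of _ N'] exI[of _ h']) simp
  qed
  obtain S where S: "finite S" "S \<subseteq> carrier P0" and gen: "\<And>N. submodule N Zn P0 \<Longrightarrow> S \<subseteq> N \<Longrightarrow> N = carrier P0"
    using fg unfolding finitely_generated_module_def by blast
  from claim[OF S] obtain N h where N: "submodule N Zn P0" "S \<subseteq> N"
    and h: "h \<in> module_homs R (E\<lparr>carrier := pre N\<rparr>) reg" "\<forall>k\<in>a_kernel E PP q. h k = \<theta> k" by blast
  have "pre N = carrier E" unfolding gen[OF N] pre_def using q_val by auto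
  then show ?thesis using h by (intro bexI[of _ h]) (simp_all add: module_homs_def)
qed

end

section \<open>Unique products\<close>

context comm_group
begin

text \<open>The second set ranges over the whole group and not only over \<open>H\<close>: elements
  supported in \<open>H\<close> are to be non-zero-divisors in the full group algebra.\<close>

definition unique_product_subgroup :: "'a set \<Rightarrow> bool" where
  "unique_product_subgroup H \<longleftrightarrow> subgroup H G \<and>
    (\<forall>V Y. finite V \<and> V \<noteq> {} \<and> V \<subseteq> H \<and> finite Y \<and> Y \<noteq> {} \<and> Y \<subseteq> carrier G \<longrightarrow>
      (\<exists>x\<in>V. \<exists>y\<in>Y. \<forall>x'\<in>V. \<forall>y'\<in>Y. x' \<otimes> y' = x \<otimes> y \<longrightarrow> x' = x \<and> y' = y))"

definition adjoin :: "'a set \<Rightarrow> 'a \<Rightarrow> 'a set" where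
  "adjoin H g = {a \<otimes> g [^] i | a i. a \<in> H \<and> i \<in> (UNIV :: int set)}"

lemma adjoinI: "a \<in> H \<Longrightarrow> a \<otimes> g [^] (i :: int) \<in> adjoin H g"
  by (auto simp: adjoin_def)

lemma adjoinE:
  assumes "x \<in> adjoin H g"
  obtains a and i :: int where "a \<in> H" and "x = a \<otimes> g [^] i"
  using assms by (auto simp: adjoin_def)

lemma adjoin_mult:
  assumes "a \<in> carrier G" "b \<in> carrier G" "g \<in> carrier G"
  shows "(a \<otimes> g [^] (i :: int)) \<otimes> (b \<otimes> g [^] (j :: int)) = (a \<otimes> b) \<otimes> g [^] (i + j)"
  using assms by (simp add: int_pow_mult m_ac)

lemma adjoin_subgroup:
  assumes H: "subgroup H G" and g: "g \<in> carrier G"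
  shows "subgroup (adjoin H g) G" and "H \<subseteq> adjoin H g" and "g \<in> adjoin H g"
proof -
  note HG = subgroup.subset[OF H] and one = subgroup.one_closed[OF H]
  show sub: "H \<subseteq> adjoin H g"
  proof
    fix a assume "a \<in> H"
    then show "a \<in> adjoin H g" using adjoinI[of a H g 0] HG by (simp add: subset_iff)
  qed
  show "g \<in> adjoin H g" using adjoinI[OF one, of g 1] g by (simp add: int_pow_1)
  show "subgroup (adjoin H g) G"
  proof (rule subgroupI)
    show "adjoin H g \<subseteq> carrier G" using HG g by (auto simp: adjoin_def)
    show "adjoin H g \<noteq> {}" using sub one by blast
    fix x assume "x \<in> adjoin H g"
    then obtain a i where x: "a \<in> H" "x = a \<otimes> g [^] (i :: int)" by (rule adjoinE)
    have aG: "a \<in> carrier G" using x(1) HG by blast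
    have "inv x = inv a \<otimes> g [^] (- i)" using x aG g by (simp add: inv_mult int_pow_neg)
    then show "inv x \<in> adjoin H g" using adjoinI[OF subgroup.m_inv_closed[OF H x(1)], of g "- i"] by simp
    fix y assume "y \<in> adjoin H g"
    then obtain b j where y: "b \<in> H" "y = b \<otimes> g [^] (j :: int)" by (rule adjoinE)
    have "b \<in> carrier G" using y(1) HG by blast
    then show "x \<otimes> y \<in> adjoin H g"
      using adjoinI[OF subgroup.m_closed[OF H x(1) y(1)], of g "i + j"] adjoin_mult[OF aG _ g, of b i j] x y by simp
  qed
qed

lemma unique_product_trivial: "unique_product_subgroup {\<one>}"
proof -
  have "\<exists>x\<in>V. \<exists>y\<in>Y. \<forall>x'\<in>V. \<forall>y'\<in>Y. x' \<otimes> y' = x \<otimes> y \<longrightarrow> x' = x \<and> y' = y"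
    if VY: "V \<noteq> {}" "V \<subseteq> {\<one>}" "Y \<noteq> {}" "Y \<subseteq> carrier G" for V Y
  proof -
    have V: "V = {\<one>}" using VY by auto
    obtain y where "y \<in> Y" using VY by blast
    then show ?thesis unfolding V using VY(4) by (auto intro!: bexI[of _ y] simp: subset_iff)
  qed
  then show ?thesis unfolding unique_product_subgroup_def using triv_subgroup by blast
qed

section \<open>Adjoining an element with no positive power in the subgroup\<close>

context
  fixes H g
  assumes H: "subgroup H G" and g: "g \<in> carrier G" and indep: "\<And>m :: nat. 0 < m \<Longrightarrow> g [^] m \<notin> H"
begin

lemma pow_independent:
  assumes "g [^] (i :: int) \<in> H"
  shows "i = 0"
proof (rule ccontr)
  assume "i \<noteq> 0"
  have "g [^] \<bar>i\<bar> \<in> H"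
  proof (cases "0 \<le> i")
    case False
    then have "g [^] \<bar>i\<bar> = inv (g [^] i)" using g by (simp add: int_pow_neg)
    then show ?thesis using subgroup.m_inv_closed[OF H assms] by simp
  qed (use assms in simp)
  then have "g [^] int (nat \<bar>i\<bar>) \<in> H" by simp
  then have "g [^] nat \<bar>i\<bar> \<in> H" unfolding int_pow_int .
  then show False using indep[of "nat \<bar>i\<bar>"] \<open>i \<noteq> 0\<close> by simp
qed

lemma adjoin_unique:
  assumes a: "a \<in> H" and b: "b \<in> H" and eq: "a \<otimes> g [^] (i :: int) = b \<otimes> g [^] (j :: int)"
  shows "a = b \<and> i = j"
proof -
  have aG: "a \<in> carrier G" "b \<in> carrier G" using a b subgroup.subset[OF H] by auto
  have "inv b \<otimes> a = inv b \<otimes> (a \<otimes> g [^] i) \<otimes> inv (g [^] i)" using aG g by (simp add: m_assoc)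
  also have "\<dots> = g [^] j \<otimes> inv (g [^] i)" unfolding eq using aG g by (simp add: inv_mult_cancel)
  also have "\<dots> = g [^] (j - i)" using g by (simp add: int_pow_diff)
  finally have "inv b \<otimes> a = g [^] (j - i)" .
  moreover have "inv b \<otimes> a \<in> H" using H a b by (simp add: subgroup.m_closed subgroup.m_inv_closed)
  ultimately have "j - i = 0" using pow_independent[of "j - i"] by metis
  then have "i = j" by simp
  then show ?thesis using eq aG g by simp
qed

text \<open>The group \<open>adjoin H g\<close> is the direct product of \<open>H\<close> and an
  infinite cyclic group, and this is the second coordinate. Outside \<open>adjoin H g\<close> the
  value is arbitrary.\<close>

definition "exponent x = (THE i :: int. \<exists>a\<in>H. x = a \<otimes> g [^] i)"

lemma exponent_eq: "a \<in> H \<Longrightarrow> exponent (a \<otimes> g [^] (i :: int)) = i"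
  unfolding exponent_def by (rule the_equality) (use adjoin_unique in blast)+

lemma adjoin_infinite: "infinite (adjoin H g)"
proof -
  have one: "\<one> \<in> H" by (rule subgroup.one_closed[OF H])
  have "range exponent \<subseteq> exponent ` UNIV" by simp
  have "UNIV \<subseteq> exponent ` adjoin H g"
  proof
    fix i :: int
    show "i \<in> exponent ` adjoin H g" using exponent_eq[OF one, of i] adjoinI[OF one, of g i] by (metis imageI)
  qed
  then show ?thesis using infinite_UNIV_int finite_subset by (metis finite_imageI)
qed

text \<open>A leading term argument: the top power of \<open>g\<close> in a product arises only from
  the top powers in both factors, and for the leading parts the property of \<open>H\<close>
  applies. As \<open>Y\<close> need not lie in \<open>adjoin H g\<close>, only its part in one coset
  of that subgroup, through \<open>y0\<close>, is used.\<close>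

lemma adjoin_unique_product:
  assumes U: "unique_product_subgroup H"
  shows "unique_product_subgroup (adjoin H g)"
  unfolding unique_product_subgroup_def
proof (rule conjI[OF adjoin_subgroup(1)[OF H g]], intro allI, rule impI)
  fix V Y assume VY: "finite V \<and> V \<noteq> {} \<and> V \<subseteq> adjoin H g \<and> finite Y \<and> Y \<noteq> {} \<and> Y \<subseteq> carrier G"
  have HG: "a \<in> carrier G" if "a \<in> H" for a using that subgroup.subset[OF H] by blast
  define i where "i = Max (exponent ` V)"
  define A where "A = {a \<in> H. a \<otimes> g [^] i \<in> V}"
  have "i \<in> exponent ` V" unfolding i_def by (rule Max_in) (use VY in auto)
  then obtain x where "x \<in> V" "exponent x = i" by blast
  then have "A \<noteq> {}" using VY by (force simp: A_def exponent_eq elim: adjoinE)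
  moreover have "finite A"
  proof (rule finite_imageD)
    show "finite ((\<lambda>a. a \<otimes> g [^] i) ` A)" by (rule finite_subset[of _ V]) (use VY in \<open>auto simp: A_def\<close>)
    show "inj_on (\<lambda>a. a \<otimes> g [^] i) A" using adjoin_unique by (auto simp: inj_on_def A_def)
  qed
  moreover obtain y0 where y0: "y0 \<in> Y" "y0 \<in> carrier G" using VY by blast
  define D where "D = {j :: int. \<exists>b\<in>H. y0 \<otimes> (b \<otimes> g [^] j) \<in> Y}"
  have "D \<subseteq> (\<lambda>y. exponent (inv y0 \<otimes> y)) ` Y"
  proof
    fix j assume "j \<in> D"
    then obtain b where b: "b \<in> H" "y0 \<otimes> (b \<otimes> g [^] j) \<in> Y" by (auto simp: D_def)
    then have "exponent (inv y0 \<otimes> (y0 \<otimes> (b \<otimes> g [^] j))) = j" using y0(2) HG g by (simp add: inv_mult_cancel exponent_eq)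
    then show "j \<in> (\<lambda>y. exponent (inv y0 \<otimes> y)) ` Y" using b(2) by (metis imageI)
  qed
  then have D: "finite D" using VY by (meson finite_imageI finite_subset)
  have "0 \<in> D" using y0 subgroup.one_closed[OF H] by (auto simp: D_def intro!: bexI[of _ \<one>])
  define j where "j = Max D"
  have j: "j \<in> D" and j_max: "\<And>k. k \<in> D \<Longrightarrow> k \<le> j" unfolding j_def
    using Max_in[OF D] Max_ge[OF D] \<open>0 \<in> D\<close> by auto
  \<comment> \<open>The leading part of \<open>Y\<close> in the coset, with the power of
    \<open>g\<close> removed. It lies in a translate of \<open>H\<close> rather than in
    \<open>H\<close>, which the unique product property admits for the second factor.\<close>
  define W where "W = {w. w \<otimes> g [^] j \<in> Y \<and> (\<exists>b\<in>H. w = y0 \<otimes> b)}"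
  have WG: "W \<subseteq> carrier G" using y0 HG by (auto simp: W_def)
  moreover have "W \<noteq> {}" using j y0 HG g by (auto simp: D_def W_def m_assoc[symmetric])
  moreover have "finite W"
  proof (rule finite_imageD)
    show "finite ((\<lambda>w. w \<otimes> g [^] j) ` W)" by (rule finite_subset[of _ Y]) (use VY in \<open>auto simp: W_def\<close>)
    show "inj_on (\<lambda>w. w \<otimes> g [^] j) W" using WG g by (auto simp: inj_on_def subset_iff)
  qed
  moreover have "A \<subseteq> H" by (auto simp: A_def)
  ultimately obtain a w where aw: "a \<in> A" "w \<in> W"
    and uniq: "\<And>a' w'. a' \<in> A \<Longrightarrow> w' \<in> W \<Longrightarrow> a' \<otimes> w' = a \<otimes> w \<Longrightarrow> a' = a \<and> w' = w"
    using U unfolding unique_product_subgroup_def by metis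
  have a: "a \<in> H" "a \<in> carrier G" "a \<otimes> g [^] i \<in> V" using aw(1) HG by (auto simp: A_def)
  obtain b where b: "b \<in> H" "b \<in> carrier G" "w = y0 \<otimes> b" using aw(2) HG by (auto simp: W_def)
  have w: "w \<in> carrier G" "w \<otimes> g [^] j \<in> Y" using aw(2) WG by (auto simp: W_def)
  show "\<exists>x\<in>V. \<exists>y\<in>Y. \<forall>x'\<in>V. \<forall>y'\<in>Y. x' \<otimes> y' = x \<otimes> y \<longrightarrow> x' = x \<and> y' = y"
  proof (rule bexI[OF _ a(3)], rule bexI[OF _ w(2)], intro ballI impI)
    fix x' y' assume x': "x' \<in> V" and y': "y' \<in> Y" and eq: "x' \<otimes> y' = (a \<otimes> g [^] i) \<otimes> (w \<otimes> g [^] j)"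
    have "x' \<in> adjoin H g" using x' VY by blast
    then obtain a' i' where a': "a' \<in> H" "x' = a' \<otimes> g [^] (i' :: int)" by (rule adjoinE)
    note a'G = HG[OF a'(1)]
    have y'G: "y' \<in> carrier G" using y' VY by blast
    have i': "i' \<le> i" unfolding i_def using VY x' exponent_eq[OF a'(1), of i'] a'(2) by (metis Max_ge finite_imageI imageI)
    \<comment> \<open>Solving for y' gives y' = y0 b' g^(i + j - i'). So y' lies in the coset of
      \<open>y0\<close>, and the maximality of j together with i' \<le> i forces i' = i.\<close>
    define b' where "b' = inv a' \<otimes> a \<otimes> b"
    have b': "b' \<in> H" unfolding b'_def using H a(1) b(1) a'(1) by (simp add: subgroup.m_closed subgroup.m_inv_closed)
    note b'G = HG[OF b']
    have swap: "a' \<otimes> (y0 \<otimes> b') = a \<otimes> w"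
      unfolding b'_def b(3) using a'G y0 a b
      by (simp add: m_assoc m_lcomm[of a' y0] m_lcomm[of y0 a] inv_mult_cancel)
    have "x' \<otimes> (y0 \<otimes> (b' \<otimes> g [^] (i + j - i'))) = x' \<otimes> y'"
    proof -
      have "x' \<otimes> (y0 \<otimes> (b' \<otimes> g [^] (i + j - i'))) = (a' \<otimes> g [^] i') \<otimes> ((y0 \<otimes> b') \<otimes> g [^] (i + j - i'))"
        using a'(2) y0 b'G g by (simp add: m_assoc)
      also have "\<dots> = (a' \<otimes> (y0 \<otimes> b')) \<otimes> g [^] (i + j)"
        using adjoin_mult[OF a'G _ g, of "y0 \<otimes> b'" i' "i + j - i'"] y0 b'G by simp
      also note swap
      also have "(a \<otimes> w) \<otimes> g [^] (i + j) = x' \<otimes> y'"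
        unfolding eq using adjoin_mult[OF a(2) w(1) g] by simp
      finally show ?thesis .
    qed
    then have y'_eq: "y' = y0 \<otimes> (b' \<otimes> g [^] (i + j - i'))"
      using a'G a'(2) g y0 b'G y'G by simp
    then have "i + j - i' \<in> D" using y' b' by (auto simp: D_def)
    then have "i' = i" using j_max i' by fastforce
    then have y'_eq': "y' = (y0 \<otimes> b') \<otimes> g [^] j" using y'_eq y0 b'G g by (simp add: m_assoc)
    have "a' \<in> A" using a' x' \<open>i' = i\<close> by (simp add: A_def)
    moreover have "y0 \<otimes> b' \<in> W" using y' y'_eq' b' by (auto simp: W_def)
    moreover note swap
    ultimately have "a' = a \<and> y0 \<otimes> b' = w" using uniq by blast
    then show "x' = a \<otimes> g [^] i \<and> y' = w \<otimes> g [^] j" using a'(2) y'_eq' \<open>i' = i\<close> by simp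
  qed
qed

end

text \<open>
  A finitely generated abelian group is finite over a free subgroup; the unique product property
  replaces freeness.
\<close>

lemma finite_index_unique_product_subgroup:
  assumes "finite S" and "S \<subseteq> carrier G" and gen: "generate G S = carrier G"
  obtains H T where "unique_product_subgroup H" and "H = {\<one>} \<or> infinite H" and "finite T"
    and "T \<subseteq> carrier G" and "\<And>x. x \<in> carrier G \<Longrightarrow> \<exists>a\<in>H. \<exists>t\<in>T. x = a \<otimes> t"
proof -
  \<comment> \<open>\<open>K\<close> contains the generators treated so far and is covered by the
    cosets of \<open>H\<close> through \<open>T\<close>. The alternative on \<open>H\<close> is
    carried along for \<open>ideal_content\<close>.\<close>
  have "\<exists>H K T. unique_product_subgroup H \<and> (H = {\<one>} \<or> infinite H) \<and> finite T \<and> T \<subseteq> carrier G \<and>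
      subgroup K G \<and> S \<subseteq> K \<and> (\<forall>x\<in>K. \<exists>a\<in>H. \<exists>t\<in>T. x = a \<otimes> t)"
    using assms(1,2)
  proof (induction rule: finite_induct)
    case empty
    show ?case
      by (rule exI[of _ "{\<one>}"], rule exI[of _ "{\<one>}"], rule exI[of _ "{\<one>}"])
        (simp add: unique_product_trivial triv_subgroup)
  next
    case (insert g S)
    then obtain H K T where U: "unique_product_subgroup H" and triv: "H = {\<one>} \<or> infinite H"
      and T: "finite T" "T \<subseteq> carrier G" and K: "subgroup K G" "S \<subseteq> K"
      and cover: "\<And>x. x \<in> K \<Longrightarrow> \<exists>a\<in>H. \<exists>t\<in>T. x = a \<otimes> t" by auto
    have g: "g \<in> carrier G" using insert by simp
    have H: "subgroup H G" using U by (simp add: unique_product_subgroup_def)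
    have HG: "a \<in> carrier G" if "a \<in> H" for a using that subgroup.subset[OF H] by blast
    have TG: "t \<in> carrier G" if "t \<in> T" for t using that T by blast
    note K' = adjoin_subgroup[OF K(1) g]
    have SK': "insert g S \<subseteq> adjoin K g" using K' K(2) by blast
    show ?case
    proof (cases "\<exists>m :: nat. 0 < m \<and> g [^] m \<in> H")
      case True
      \<comment> \<open>Some power of \<open>g\<close> falls into \<open>H\<close>: then
        \<open>H\<close> is kept, and the remainders of exponents modulo m enlarge
        \<open>T\<close>.\<close>
      then obtain m :: nat where m: "0 < m" "g [^] m \<in> H" by blast
      define T' where "T' = (\<lambda>(t, r). t \<otimes> g [^] (r :: int)) ` (T \<times> {0..<int m})"
      have "finite T'" "T' \<subseteq> carrier G" using T TG g by (auto simp: T'_def)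
      moreover have "\<exists>a\<in>H. \<exists>t\<in>T'. x = a \<otimes> t" if "x \<in> adjoin K g" for x
      proof -
        obtain k i where x: "k \<in> K" "x = k \<otimes> g [^] (i :: int)" using \<open>x \<in> adjoin K g\<close> by (rule adjoinE)
        obtain a t where at: "a \<in> H" "t \<in> T" "k = a \<otimes> t" using cover[OF x(1)] by blast
        define z where "z = (g [^] m) [^] (i div int m)"
        have z: "z \<in> H" unfolding z_def by (rule subgroup_int_pow_closed[OF H m(2)])
        have "z = g [^] (int m * (i div int m))"
          unfolding z_def using g int_pow_pow[of g "int m" "i div int m"] by (simp add: int_pow_int)
        then have "g [^] i = z \<otimes> g [^] (i mod int m)" using g by (simp flip: int_pow_mult)
        then have "x = (a \<otimes> z) \<otimes> (t \<otimes> g [^] (i mod int m))"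
          using x at HG[OF at(1)] HG[OF z] TG[OF at(2)] g by (simp add: m_ac)
        moreover have "a \<otimes> z \<in> H" by (rule subgroup.m_closed[OF H at(1) z])
        moreover have "t \<otimes> g [^] (i mod int m) \<in> T'"
          unfolding T'_def using at(2) m(1) by (intro image_eqI[of _ _ "(t, i mod int m)"]) auto
        ultimately show ?thesis by blast
      qed
      ultimately show ?thesis using U triv K'(1) SK'
        by (intro exI[of _ H] exI[of _ "adjoin K g"] exI[of _ T']) auto
    next
      case False
      \<comment> \<open>No power of \<open>g\<close> falls into \<open>H\<close>: then
        \<open>H\<close> absorbs \<open>g\<close>, and \<open>T\<close> is kept.\<close>
      then have indep: "\<And>m :: nat. 0 < m \<Longrightarrow> g [^] m \<notin> H" by blast
      have "\<exists>a\<in>adjoin H g. \<exists>t\<in>T. x = a \<otimes> t" if "x \<in> adjoin K g" for x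
      proof -
        obtain k i where x: "k \<in> K" "x = k \<otimes> g [^] (i :: int)" using \<open>x \<in> adjoin K g\<close> by (rule adjoinE)
        obtain a t where at: "a \<in> H" "t \<in> T" "k = a \<otimes> t" using cover[OF x(1)] by blast
        then have "x = (a \<otimes> g [^] i) \<otimes> t" using x HG[OF at(1)] TG[OF at(2)] g by (simp add: m_ac)
        then show ?thesis using adjoinI[OF at(1), of g i] at(2) by blast
      qed
      moreover have "unique_product_subgroup (adjoin H g)" by (rule adjoin_unique_product[OF H g indep U])
      moreover have "infinite (adjoin H g)" by (rule adjoin_infinite[OF H g indep])
      ultimately show ?thesis using T K'(1) SK'
        by (intro exI[of _ "adjoin H g"] exI[of _ "adjoin K g"] exI[of _ T]) auto
    qed
  qed
  then obtain H K T where HKT: "unique_product_subgroup H" "H = {\<one>} \<or> infinite H" "finite T" "T \<subseteq> carrier G"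
    "subgroup K G" "S \<subseteq> K" "\<And>x. x \<in> K \<Longrightarrow> \<exists>a\<in>H. \<exists>t\<in>T. x = a \<otimes> t" by auto
  have "carrier G \<subseteq> K" using generate_subgroup_incl[OF HKT(6,5)] gen by simp
  then have "\<exists>a\<in>H. \<exists>t\<in>T. x = a \<otimes> t" if "x \<in> carrier G" for x using HKT(7) that by blast
  with HKT(1-4) show thesis by (rule that)
qed

end

section \<open>Non-zero-divisors and the content of an element\<close>

context zn_group_algebra
begin

lemma iota_dvd_iff:
  assumes "e dvd int n"
  shows "(\<exists>c. \<iota> a = \<iota> (e * c)) \<longleftrightarrow> e dvd a"
proof
  assume "\<exists>c. \<iota> a = \<iota> (e * c)"
  then obtain c where "int n dvd a - e * c" by (auto simp: iota_eq_iff)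
  then have "e dvd a - e * c" using assms dvd_trans by blast
  then show "e dvd a" using dvd_add[of e "a - e * c" "e * c"] by simp
qed (auto simp: dvd_def)

definition rep :: "int set \<Rightarrow> int" where
  "rep a = (SOME c. a = \<iota> c)"

lemma iota_rep: "a \<in> carrier Zn \<Longrightarrow> \<iota> (rep a) = a"
  unfolding rep_def by (rule someI2_ex[of "\<lambda>c. a = \<iota> c"]) (auto elim: iota_surj)

text \<open>Including n makes the gcd positive and independent of the representatives chosen by
  \<open>rep\<close>, which are determined only modulo n.\<close>

definition content :: "('l \<Rightarrow> int set) \<Rightarrow> int" where
  "content r = Gcd (insert (int n) (range (\<lambda>\<nu>. rep (r \<nu>))))"

lemma dvd_content_iff:
  assumes r: "r \<in> carrier R" and e: "e dvd int n"
  shows "e dvd content r \<longleftrightarrow> (\<forall>\<nu>. \<exists>c. r \<nu> = \<iota> (e * c))"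
proof -
  have "e dvd content r \<longleftrightarrow> (\<forall>\<nu>. e dvd rep (r \<nu>))"
    unfolding content_def using e by (auto simp: dvd_Gcd_iff)
  also have "\<dots> \<longleftrightarrow> (\<forall>\<nu>. \<exists>c. r \<nu> = \<iota> (e * c))"
    using iota_dvd_iff[OF e] iota_rep[OF R_coeff[OF r]] by metis
  finally show ?thesis .
qed

lemma content_dvd: "content r dvd int n"
  unfolding content_def by (rule Gcd_dvd) simp

lemma content_pos: "0 < content r"
proof -
  have "content r \<noteq> 0" using content_dvd[of r] n_pos by auto
  moreover have "0 \<le> content r" by (simp add: content_def)
  ultimately show ?thesis by simp
qed

lemma R_mult_coeff:
  assumes "r \<in> carrier R" and "s \<in> carrier R"
  shows "(r \<otimes>\<^bsub>R\<^esub> s) \<nu> = finsum Zn (\<lambda>(\<kappa>, \<mu>). r \<kappa> \<otimes>\<^bsub>Zn\<^esub> s \<mu>)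
    {(\<kappa>, \<mu>) \<in> support Zn r \<times> support Zn s. \<kappa> \<otimes> \<mu> = \<nu>}"
  by (simp add: group_algebra_def)

lemma R_support:
  assumes "r \<in> carrier R"
  shows "finite (support Zn r)" and "support Zn r \<subseteq> carrier \<Lambda>"
  using assms finsuppD(2,3)[of r "carrier \<Lambda>" Zn] by (simp_all add: group_algebra_simps)

text \<open>
  If \<open>u c = 0\<close> with \<open>c \<noteq> 0\<close>, a multiple \<open>c'\<close> of \<open>c\<close> has additive order a prime \<open>p\<close>. Only the terms
  of \<open>u\<close> with coefficient prime to \<open>p\<close> act on \<open>c'\<close>, and a unique product of their
  exponents with those of \<open>c'\<close> gives a non-zero coefficient.
\<close>

lemma non_zero_divisor_if_content_one:
  assumes G: "\<Lambda>.unique_product_subgroup G" and u: "u \<in> carrier R" and supp: "support Zn u \<subseteq> G"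
    and one: "content u = 1"
  shows "non_zero_divisor R u"
  unfolding non_zero_divisor_def
proof (intro conjI u ballI impI, rule ccontr)
  fix c assume c: "c \<in> carrier R" and uc: "u \<otimes>\<^bsub>R\<^esub> c = \<zero>\<^bsub>R\<^esub>" and c0: "c \<noteq> \<zero>\<^bsub>R\<^esub>"
  \<comment> \<open>The additive order of \<open>c\<close>. Dividing it by a prime factor p gives
    the factor k, and \<open>c'\<close> = k c has order p.\<close>
  define m where "m = (LEAST m. 0 < m \<and> const (int m) \<otimes>\<^bsub>R\<^esub> c = \<zero>\<^bsub>R\<^esub>)"
  have m: "0 < m \<and> const (int m) \<otimes>\<^bsub>R\<^esub> c = \<zero>\<^bsub>R\<^esub>"
    unfolding m_def by (rule LeastI[of _ n]) (use n_pos const_n[of n] c in simp)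
  have "m \<noteq> 1" using m c c0 by (auto simp: const_one)
  then obtain p where p: "Factorial_Ring.prime p" "p dvd m" using prime_factor_nat by blast
  then obtain k where k: "m = p * k" by blast
  have "k < m" "0 < k" using k m p(1) prime_gt_1_nat[of p] by auto
  define c' where "c' = const (int k) \<otimes>\<^bsub>R\<^esub> c"
  have c': "c' \<in> carrier R" using c by (simp add: c'_def)
  have c'0: "c' \<noteq> \<zero>\<^bsub>R\<^esub>"
    using Least_le[of "\<lambda>m. 0 < m \<and> const (int m) \<otimes>\<^bsub>R\<^esub> c = \<zero>\<^bsub>R\<^esub>" k] \<open>k < m\<close> \<open>0 < k\<close>
    unfolding m_def c'_def by auto
  have pc': "const (int p) \<otimes>\<^bsub>R\<^esub> c' = \<zero>\<^bsub>R\<^esub>"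
    using m c unfolding c'_def k by (simp add: const_mult R.m_assoc)
  have uc': "u \<otimes>\<^bsub>R\<^esub> c' = \<zero>\<^bsub>R\<^esub>"
    unfolding c'_def using uc u c by (simp add: R.m_lcomm[of u "const (int k)"])
  have killed: "\<iota> (int p * a) \<otimes>\<^bsub>Zn\<^esub> c' \<nu> = \<zero>\<^bsub>Zn\<^esub>" for a \<nu>
  proof -
    have "\<iota> (int p) \<otimes>\<^bsub>Zn\<^esub> c' \<nu> = \<zero>\<^bsub>Zn\<^esub>"
      using fun_cong[OF pc', of \<nu>] by (simp add: const_mult_coeff[OF c'] group_algebra_simps)
    then show ?thesis
      using R_coeff[OF c'] by (simp add: iota_mult Rg.A.m_assoc Rg.A.m_lcomm[of "\<iota> (int p)"])
  qed
  have coprime_zero: "c' \<nu> = \<zero>\<^bsub>Zn\<^esub>" if a: "\<not> int p dvd a" and eq: "\<iota> a \<otimes>\<^bsub>Zn\<^esub> c' \<nu> = \<zero>\<^bsub>Zn\<^esub>" for a \<nu>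
  proof -
    have "coprime (int p) a" using a p(1) by (intro prime_imp_coprime) auto
    then obtain x y where xy: "x * int p + y * a = 1"
      using bezout_int[of "int p" a] by auto
    have "c' \<nu> = \<iota> (int p * x + y * a) \<otimes>\<^bsub>Zn\<^esub> c' \<nu>"
      using R_coeff[OF c'] xy by (simp add: iota_one mult.commute)
    also have "\<dots> = \<iota> (int p * x) \<otimes>\<^bsub>Zn\<^esub> c' \<nu> \<oplus>\<^bsub>Zn\<^esub> \<iota> y \<otimes>\<^bsub>Zn\<^esub> (\<iota> a \<otimes>\<^bsub>Zn\<^esub> c' \<nu>)"
      using R_coeff[OF c'] by (simp add: iota_add iota_mult[of y a] Rg.A.l_distr Rg.A.m_assoc)
    finally show ?thesis using killed eq by simp
  qed
  \<comment> \<open>If p did not divide n, then \<open>coprime_zero\<close> would make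
    \<open>c'\<close> vanish, since n annihilates it. The divisibility is needed because
    \<open>dvd_content_iff\<close> concerns divisors of n only.\<close>
  have p_dvd_n: "int p dvd int n"
  proof (rule ccontr)
    assume "\<not> int p dvd int n"
    then have "c' \<nu> = \<zero>\<^bsub>Zn\<^esub>" for \<nu>
      by (rule coprime_zero) (use R_coeff[OF c'] iota_eq_zero_iff[of "int n"] in simp)
    then show False using c'0 by (auto simp: group_algebra_simps)
  qed
  \<comment> \<open>The exponents whose coefficients in \<open>u\<close> are not multiples of p.
    Content 1 makes this set non-empty, and by \<open>killed\<close> all other terms of
    \<open>u\<close> act on \<open>c'\<close> as zero.\<close>
  define V where "V = {\<kappa>. \<not> (\<exists>a. u \<kappa> = \<iota> (int p * a))}"
  have "V \<noteq> {}"
  proof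
    assume "V = {}"
    then have "int p dvd content u" unfolding dvd_content_iff[OF u p_dvd_n] by (auto simp: V_def)
    then show False using one p(1) by (simp add: prime_nat_iff)
  qed
  have V_sub: "V \<subseteq> support Zn u"
  proof
    fix \<kappa> assume "\<kappa> \<in> V"
    then have "u \<kappa> \<noteq> \<iota> (int p * 0)" unfolding V_def by blast
    then show "\<kappa> \<in> support Zn u" by (simp add: support_def iota_zero)
  qed
  have "finite V" using V_sub R_support(1)[OF u] finite_subset by blast
  have "support Zn c' \<noteq> {}" using c'0 by (auto simp: support_def group_algebra_simps)
  then have "\<exists>x\<in>V. \<exists>y\<in>support Zn c'. \<forall>x'\<in>V. \<forall>y'\<in>support Zn c'. x' \<otimes> y' = x \<otimes> y \<longrightarrow> x' = x \<and> y' = y"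
    using G[unfolded \<Lambda>.unique_product_subgroup_def, THEN conjunct2, rule_format, of V "support Zn c'"]
      \<open>V \<noteq> {}\<close> \<open>finite V\<close> subset_trans[OF V_sub supp] R_support[OF c'] by simp
  then obtain x y where xy: "x \<in> V" "y \<in> support Zn c'"
    and uniq: "\<And>x' y'. x' \<in> V \<Longrightarrow> y' \<in> support Zn c' \<Longrightarrow> x' \<otimes> y' = x \<otimes> y \<Longrightarrow> x' = x \<and> y' = y"
    by blast
  let ?D = "{(\<kappa>, \<mu>) \<in> support Zn u \<times> support Zn c'. \<kappa> \<otimes> \<mu> = x \<otimes> y}"
  have D: "finite ?D" by (rule finite_subset[of _ "support Zn u \<times> support Zn c'"]) (use R_support u c' in auto)
  have xyD: "(x, y) \<in> ?D" using xy V_sub by auto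
  have "\<zero>\<^bsub>Zn\<^esub> = (u \<otimes>\<^bsub>R\<^esub> c') (x \<otimes> y)" using uc' by (simp add: group_algebra_simps)
  also have "\<dots> = finsum Zn (\<lambda>(\<kappa>, \<mu>). u \<kappa> \<otimes>\<^bsub>Zn\<^esub> c' \<mu>) ?D" by (rule R_mult_coeff[OF u c'])
  also have "\<dots> = finsum Zn (\<lambda>(\<kappa>, \<mu>). u \<kappa> \<otimes>\<^bsub>Zn\<^esub> c' \<mu>) {(x, y)}"
  proof (rule Rg.A.add.finprod_mono_neutral_cong_left[symmetric, OF D])
    fix q assume q: "q \<in> ?D - {(x, y)}"
    obtain \<kappa> \<mu> where q_eq: "q = (\<kappa>, \<mu>)" by (cases q)
    then have "\<kappa> \<notin> V" using q uniq[of \<kappa> \<mu>] by auto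
    then obtain a where "u \<kappa> = \<iota> (int p * a)" by (auto simp: V_def)
    then show "(case q of (\<kappa>, \<mu>) \<Rightarrow> u \<kappa> \<otimes>\<^bsub>Zn\<^esub> c' \<mu>) = \<zero>\<^bsub>Zn\<^esub>" by (simp add: q_eq killed)
  qed (use xyD u c' in auto)
  also have "\<dots> = u x \<otimes>\<^bsub>Zn\<^esub> c' y" using u c' by simp
  finally have "\<iota> (rep (u x)) \<otimes>\<^bsub>Zn\<^esub> c' y = \<zero>\<^bsub>Zn\<^esub>" using u by (simp add: iota_rep)
  moreover have "\<not> int p dvd rep (u x)"
    using xy(1) iota_rep[OF R_coeff[OF u, of x]] unfolding V_def by (metis (mono_tags, lifting) dvdE mem_Collect_eq)
  ultimately have "c' y = \<zero>\<^bsub>Zn\<^esub>" using coprime_zero by blast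
  then show False using xy(2) by (simp add: support_def)
qed


subsection \<open>Ideals of the group algebra of a subgroup\<close>

text \<open>The group algebra of \<open>G\<close>, kept inside \<open>R\<close>: it then acts on
  modules over \<open>R\<close> by restricting the set of scalars, with the module itself
  unchanged.\<close>

definition subalgebra :: "'l set \<Rightarrow> ('l \<Rightarrow> int set) set" where
  "subalgebra G = {r \<in> carrier R. support Zn r \<subseteq> G}"

lemma const_add: "const (a + b) = const a \<oplus>\<^bsub>R\<^esub> const b"
  by (auto simp: const_def single_def group_algebra_simps iota_add fun_eq_iff)

lemma const_support: "support Zn (const c) \<subseteq> {\<one>}"
  by (auto simp: const_def single_def support_def)

lemma mono_support: "support Zn (mono \<kappa>) \<subseteq> {\<kappa>}"
  by (auto simp: mono_def single_def support_def)

lemma subalgebra_mult: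
  assumes G: "subgroup G \<Lambda>" and r: "r \<in> subalgebra G" and s: "s \<in> subalgebra G"
  shows "r \<otimes>\<^bsub>R\<^esub> s \<in> subalgebra G"
proof -
  have rs: "r \<in> carrier R" "s \<in> carrier R" using r s by (auto simp: subalgebra_def)
  have "(r \<otimes>\<^bsub>R\<^esub> s) \<nu> = \<zero>\<^bsub>Zn\<^esub>" if "\<nu> \<notin> G" for \<nu>
  proof -
    have empty: "{(\<kappa>, \<mu>) \<in> support Zn r \<times> support Zn s. \<kappa> \<otimes> \<mu> = \<nu>} = {}"
      using that r s subgroup.m_closed[OF G] by (auto simp: subalgebra_def)
    show ?thesis unfolding R_mult_coeff[OF rs] empty by simp
  qed
  then show ?thesis using rs by (auto simp: subalgebra_def support_def)
qed

lemma subalgebra_const: "subgroup G \<Lambda> \<Longrightarrow> const c \<in> subalgebra G"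
  using const_support[of c] subgroup.one_closed[of G \<Lambda>] by (auto simp: subalgebra_def)

lemma subalgebra_mono: "subgroup G \<Lambda> \<Longrightarrow> \<kappa> \<in> G \<Longrightarrow> mono \<kappa> \<in> subalgebra G"
  using mono_support[of \<kappa>] subgroup.subset[of G \<Lambda>] by (auto simp: subalgebra_def)

lemma subalgebra_add:
  assumes r: "r \<in> subalgebra G" and s: "s \<in> subalgebra G"
  shows "r \<oplus>\<^bsub>R\<^esub> s \<in> subalgebra G"
proof -
  have "(r \<oplus>\<^bsub>R\<^esub> s) \<nu> = \<zero>\<^bsub>Zn\<^esub>" if "\<nu> \<notin> G" for \<nu>
  proof -
    have "r \<nu> = \<zero>\<^bsub>Zn\<^esub>" "s \<nu> = \<zero>\<^bsub>Zn\<^esub>" using that r s by (auto simp: subalgebra_def support_def)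
    then show ?thesis by (simp add: group_algebra_simps)
  qed
  then show ?thesis using r s by (auto simp: subalgebra_def support_def)
qed

lemma subalgebra_cring:
  assumes G: "subgroup G \<Lambda>"
  shows "cring (R\<lparr>carrier := subalgebra G\<rparr>)"
proof -
  have sub: "subalgebra G \<subseteq> carrier R" by (auto simp: subalgebra_def)
  have "subring (subalgebra G) R"
  proof (rule R.subringI[OF sub])
    show one: "\<one>\<^bsub>R\<^esub> \<in> subalgebra G" using subalgebra_const[OF G, of 1] by (simp add: const_one)
    show "\<ominus>\<^bsub>R\<^esub> h \<in> subalgebra G" if h: "h \<in> subalgebra G" for h
    proof -
      have "const (- 1) \<oplus>\<^bsub>R\<^esub> \<one>\<^bsub>R\<^esub> = \<zero>\<^bsub>R\<^esub>" using const_add[of "- 1" 1] by (simp add: const_one const_zero)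
      then have "\<ominus>\<^bsub>R\<^esub> \<one>\<^bsub>R\<^esub> = const (- 1)" by (intro R.minus_equality) simp_all
      moreover have "\<ominus>\<^bsub>R\<^esub> h = (\<ominus>\<^bsub>R\<^esub> \<one>\<^bsub>R\<^esub>) \<otimes>\<^bsub>R\<^esub> h" using h sub by (auto simp: R.l_minus)
      ultimately show ?thesis using subalgebra_mult[OF G subalgebra_const[OF G, of "- 1"] h] by simp
    qed
  qed (auto intro: subalgebra_mult[OF G] subalgebra_add)
  then show ?thesis using R.subcring_iff[OF sub] R.subcringI' by blast
qed

text \<open>A collision means that \<kappa> is a quotient of an element of \<open>V\<close> by one
  of \<open>W\<close>. There are finitely many such quotients, and \<open>G\<close> is
  infinite.\<close>

lemma disjoint_shift:
  assumes G: "subgroup G \<Lambda>" and inf: "infinite G" and V: "finite V" "V \<subseteq> G" and W: "finite W" "W \<subseteq> G"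
  obtains \<kappa> where "\<kappa> \<in> G" and "\<And>w. w \<in> W \<Longrightarrow> \<kappa> \<otimes> w \<notin> V"
proof -
  let ?bad = "(\<lambda>(v, w). v \<otimes> inv w) ` (V \<times> W)"
  have "\<not> G \<subseteq> ?bad" using inf V W by (meson finite_SigmaI finite_imageI finite_subset)
  then obtain \<kappa> where \<kappa>: "\<kappa> \<in> G" "\<kappa> \<notin> ?bad" by blast
  have GL: "x \<in> carrier \<Lambda>" if "x \<in> G" for x using that subgroup.subset[OF G] by blast
  have "\<kappa> \<otimes> w \<notin> V" if w: "w \<in> W" for w
  proof
    assume v: "\<kappa> \<otimes> w \<in> V"
    have "w \<in> carrier \<Lambda>" using w W GL by blast
    then have "\<kappa> = (\<kappa> \<otimes> w) \<otimes> inv w" using GL[OF \<kappa>(1)] by (simp add: \<Lambda>.m_assoc)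
    then have "\<kappa> \<in> ?bad" using v w by (intro image_eqI[of _ _ "(\<kappa> \<otimes> w, w)"]) auto
    then show False using \<kappa>(2) by simp
  qed
  then show thesis by (rule that[OF \<kappa>(1)])
qed

lemma subalgebra_divisible:
  assumes b: "b \<in> subalgebra G" and d: "\<And>\<nu>. \<exists>c. b \<nu> = \<iota> (d * c)"
  obtains c where "c \<in> subalgebra G" and "b = c \<otimes>\<^bsub>R\<^esub> const d"
proof -
  have bR: "b \<in> carrier R" and bG: "support Zn b \<subseteq> G" using b by (auto simp: subalgebra_def)
  obtain c where c: "c \<in> carrier R" "b = const d \<otimes>\<^bsub>R\<^esub> c" "support Zn c \<subseteq> support Zn b"
    using R_divisible_by_const[OF bR, of d] d by blast
  have "c \<in> subalgebra G" using c bG by (auto simp: subalgebra_def)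
  moreover have "b = c \<otimes>\<^bsub>R\<^esub> const d" using c by (simp add: R.m_comm)
  ultimately show thesis by (rule that)
qed

text \<open>
  Up to non-zero-divisors every ideal is generated by an integer: for infinite \<open>G\<close>, sums of elements
  with supports shifted apart realise greatest common divisors of contents.
\<close>

lemma ideal_content:
  assumes U: "\<Lambda>.unique_product_subgroup G" and triv: "G = {\<one>} \<or> infinite G"
    and I: "I \<subseteq> subalgebra G" and zero: "\<zero>\<^bsub>R\<^esub> \<in> I"
    and add: "\<And>a b. a \<in> I \<Longrightarrow> b \<in> I \<Longrightarrow> a \<oplus>\<^bsub>R\<^esub> b \<in> I"
    and mult: "\<And>r a. r \<in> subalgebra G \<Longrightarrow> a \<in> I \<Longrightarrow> r \<otimes>\<^bsub>R\<^esub> a \<in> I"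
  obtains d u where "0 < d" and "d dvd int n" and "u \<in> subalgebra G" and "non_zero_divisor R u"
    and "const d \<otimes>\<^bsub>R\<^esub> u \<in> I" and "\<And>b. b \<in> I \<Longrightarrow> \<exists>c\<in>subalgebra G. b = c \<otimes>\<^bsub>R\<^esub> const d"
proof -
  have G: "subgroup G \<Lambda>" using U by (simp add: \<Lambda>.unique_product_subgroup_def)
  have GL: "x \<in> carrier \<Lambda>" if "x \<in> G" for x using that subgroup.subset[OF G] by blast
  have IR: "b \<in> carrier R" "support Zn b \<subseteq> G" "b \<in> subalgebra G" if "b \<in> I" for b
    using that I by (auto simp: subalgebra_def)
  from triv show thesis
  proof
    assume G1: "G = {\<one>}"
    \<comment> \<open>An element supported at the unit is a constant, so the ideal is given by a
      subgroup of the integers containing n, and u can be 1.\<close>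
    have eq: "b = const c" if "b \<in> I" "b \<one> = \<iota> c" for b c
      using IR(2)[OF that(1)] that(2) by (auto simp: G1 const_def single_def fun_eq_iff support_def)
    define J where "J = {c. const c \<in> I}"
    obtain d where d: "0 < d" "d dvd int n" "\<And>c. c \<in> J \<longleftrightarrow> d dvd c"
    proof (rule int_subgroup_multiples[OF n_pos, of J])
      show "int n \<in> J" using const_n[of n] zero by (simp add: J_def)
      show "a - b \<in> J" if "a \<in> J" "b \<in> J" for a b
      proof -
        have "const (a - b) = const a \<oplus>\<^bsub>R\<^esub> const (- 1) \<otimes>\<^bsub>R\<^esub> const b"
          by (simp flip: const_mult const_add)
        then show ?thesis using that add mult[OF subalgebra_const[OF G]] by (simp add: J_def)
      qed
    qed blast
    show thesis
    proof (rule that[of d "\<one>\<^bsub>R\<^esub>"])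
      show "\<one>\<^bsub>R\<^esub> \<in> subalgebra G" using subalgebra_const[OF G, of 1] by (simp add: const_one)
      show "non_zero_divisor R \<one>\<^bsub>R\<^esub>" by (simp add: non_zero_divisor_def)
      show "const d \<otimes>\<^bsub>R\<^esub> \<one>\<^bsub>R\<^esub> \<in> I" using d(3)[of d] by (simp add: J_def)
      show "\<exists>c\<in>subalgebra G. b = c \<otimes>\<^bsub>R\<^esub> const d" if b: "b \<in> I" for b
      proof -
        obtain c where c: "b \<one> = \<iota> (int c)" using iota_surj[OF R_coeff[OF IR(1)[OF b]]] .
        then have "int c \<in> J" using eq[OF b] b by (simp add: J_def)
        then obtain e where "int c = d * e" using d(3) by blast
        then have "b = const e \<otimes>\<^bsub>R\<^esub> const d" using eq[OF b c] by (simp add: mult.commute flip: const_mult)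
        then show ?thesis using subalgebra_const[OF G] by blast
      qed
    qed (use d in auto)
  next
    assume inf: "infinite G"
    \<comment> \<open>An element of least content; this content d turns out to divide the
      coefficients of all elements of the ideal.\<close>
    obtain b where b: "b \<in> I" and least: "\<And>a. a \<in> I \<Longrightarrow> nat (content b) \<le> nat (content a)"
      using ex_has_least_nat[of "\<lambda>b. b \<in> I" _ "\<lambda>b. nat (content b)"] zero by blast
    define d where "d = content b"
    have d: "0 < d" "d dvd int n" unfolding d_def by (rule content_pos, rule content_dvd)
    have divides: "\<exists>c. a \<nu> = \<iota> (d * c)" if a: "a \<in> I" for a \<nu>
    proof -
      note bR = IR(1)[OF b] and aR = IR(1)[OF a]
      obtain \<kappa> where \<kappa>: "\<kappa> \<in> G" and disj: "\<And>w. w \<in> support Zn a \<Longrightarrow> \<kappa> \<otimes> w \<notin> support Zn b"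
        using disjoint_shift[OF G inf R_support(1)[OF bR] IR(2)[OF b] R_support(1)[OF aR] IR(2)[OF a]] by blast
      note \<kappa>L = GL[OF \<kappa>]
      \<comment> \<open>The supports of \<open>b\<close> and of the shifted \<open>a\<close> are
        disjoint, so every coefficient of \<open>b\<close> or \<open>a\<close> on its support occurs
        in \<open>s\<close> unchanged. The content of \<open>s\<close> thus divides d, equals it by
        minimality, and so divides \<open>a\<close>.\<close>
      define s where "s = b \<oplus>\<^bsub>R\<^esub> mono \<kappa> \<otimes>\<^bsub>R\<^esub> a"
      have sI: "s \<in> I" unfolding s_def by (intro add b mult subalgebra_mono G \<kappa> a)
      note sR = IR(1)[OF sI]
      have s_coeff: "s \<nu> = b \<nu> \<oplus>\<^bsub>Zn\<^esub> a (inv \<kappa> \<otimes> \<nu>)" if "\<nu> \<in> carrier \<Lambda>" for \<nu>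
        using mono_mult_coeff[OF aR \<kappa>L that] by (simp add: s_def group_algebra_simps)
      have sb: "s \<nu> = b \<nu>" if "\<nu> \<in> support Zn b" for \<nu>
      proof -
        have \<nu>: "\<nu> \<in> carrier \<Lambda>" using that R_support(2)[OF bR] by blast
        then have "inv \<kappa> \<otimes> \<nu> \<notin> support Zn a"
          using disj[of "inv \<kappa> \<otimes> \<nu>"] \<kappa>L that by (auto simp: \<Lambda>.inv_mult_cancel)
        then show ?thesis using s_coeff[OF \<nu>] bR by (simp add: support_def)
      qed
      have sa: "s (\<kappa> \<otimes> \<nu>) = a \<nu>" if "\<nu> \<in> support Zn a" for \<nu>
      proof -
        have \<nu>: "\<nu> \<in> carrier \<Lambda>" using that R_support(2)[OF aR] by blast
        have "b (\<kappa> \<otimes> \<nu>) = \<zero>\<^bsub>Zn\<^esub>" using disj[OF that] by (simp add: support_def)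
        then show ?thesis using s_coeff[of "\<kappa> \<otimes> \<nu>"] \<kappa>L \<nu> aR by (simp add: \<Lambda>.inv_mult_cancel)
      qed
      let ?e = "content s"
      have e: "\<exists>c. s \<nu> = \<iota> (?e * c)" for \<nu> using dvd_content_iff[OF sR content_dvd[of s]] by simp
      have zero_mult: "\<exists>c. \<zero>\<^bsub>Zn\<^esub> = \<iota> (?e * c)" by (rule exI[of _ 0]) (simp add: iota_zero)
      have "\<exists>c. b \<nu> = \<iota> (?e * c)" for \<nu>
        using e[of \<nu>] sb[of \<nu>] zero_mult by (cases "\<nu> \<in> support Zn b") (auto simp: support_def)
      then have "?e dvd d" unfolding d_def using dvd_content_iff[OF bR content_dvd[of s]] by simp
      moreover have "d \<le> ?e" using least[OF sI] content_pos[of s] by (simp add: d_def)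
      ultimately have "?e = d" using zdvd_imp_le[OF _ d(1)] by (metis antisym)
      then show ?thesis
        using e[of "\<kappa> \<otimes> \<nu>"] sa[of \<nu>] zero_mult by (cases "\<nu> \<in> support Zn a") (auto simp: support_def)
    qed
    obtain c where c: "c \<in> subalgebra G" "b = c \<otimes>\<^bsub>R\<^esub> const d"
      using subalgebra_divisible[OF IR(3)[OF b]] divides[OF b] by blast
    have cR: "c \<in> carrier R" using c by (simp add: subalgebra_def)
    \<comment> \<open>\<open>c\<close> is determined modulo \<open>n / d\<close> only; the extra term makes its content coprime to \<open>n / d\<close>.\<close>
    have "\<not> G \<subseteq> support Zn c" using inf R_support(1)[OF cR] finite_subset[of G] by metis
    then obtain \<mu> where \<mu>: "\<mu> \<in> G" "\<mu> \<notin> support Zn c" by blast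
    define u where "u = c \<oplus>\<^bsub>R\<^esub> const (int n div d) \<otimes>\<^bsub>R\<^esub> mono \<mu>"
    have uG: "u \<in> subalgebra G"
      unfolding u_def by (intro subalgebra_add c subalgebra_mult G subalgebra_const subalgebra_mono \<mu>)
    have uR: "u \<in> carrier R" using uG by (simp add: subalgebra_def)
    have u_coeff: "u \<nu> = c \<nu> \<oplus>\<^bsub>Zn\<^esub> \<iota> (int n div d) \<otimes>\<^bsub>Zn\<^esub> mono \<mu> \<nu>" for \<nu>
      unfolding const_mult_coeff[OF mono_closed[OF GL[OF \<mu>(1)]], symmetric] by (simp add: u_def group_algebra_simps)
    have nd: "d * (int n div d) = int n" using d(2) by simp
    have cn: "const d \<otimes>\<^bsub>R\<^esub> const (int n div d) = \<zero>\<^bsub>R\<^esub>"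
      using const_n[of n] by (simp add: nd flip: const_mult)
    have du: "const d \<otimes>\<^bsub>R\<^esub> u = b"
    proof -
      have "const d \<otimes>\<^bsub>R\<^esub> (const (int n div d) \<otimes>\<^bsub>R\<^esub> mono \<mu>) = \<zero>\<^bsub>R\<^esub>"
        using GL[OF \<mu>(1)] cn by (simp flip: R.m_assoc)
      then show ?thesis
        using cR GL[OF \<mu>(1)] by (simp add: u_def R.r_distr c(2) R.m_comm[of c])
    qed
    have "content u = 1"
    proof -
      let ?e = "content u"
      have e: "\<exists>c. u \<nu> = \<iota> (?e * c)" for \<nu> using dvd_content_iff[OF uR content_dvd[of u]] by simp
      \<comment> \<open>At \<mu> the coefficient is n/d, so the content e of \<open>u\<close>
        divides n/d and d e divides n. Since b = d u, the product d e then divides the content of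
        \<open>b\<close>, which is d; hence e = 1.\<close>
      have "u \<mu> = \<iota> (int n div d)" using \<mu> u_coeff[of \<mu>] by (simp add: support_def mono_def single_def)
      then have e_nd: "?e dvd int n div d" using e[of \<mu>] iota_dvd_iff[OF content_dvd[of u]] by simp
      then have den: "d * ?e dvd int n" using e_nd nd by (metis dvd_refl mult_dvd_mono)
      have "\<exists>k. b \<nu> = \<iota> (d * ?e * k)" for \<nu>
      proof -
        obtain k where "u \<nu> = \<iota> (?e * k)" using e by blast
        then have "b \<nu> = \<iota> (d * ?e * k)"
          using const_mult_coeff[OF uR, of d \<nu>] by (simp add: du mult.assoc flip: iota_mult)
        then show ?thesis by blast
      qed
      then have "d * ?e dvd d" unfolding d_def using dvd_content_iff[OF IR(1)[OF b]] den d_def by metis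
      then show ?thesis using d(1) content_pos[of u] by (simp add: zdvd_mult_cancel1)
    qed
    then have "non_zero_divisor R u"
      using non_zero_divisor_if_content_one[OF U uR] uG by (simp add: subalgebra_def)
    moreover have "const d \<otimes>\<^bsub>R\<^esub> u \<in> I" using du b by simp
    moreover have "\<exists>c\<in>subalgebra G. a = c \<otimes>\<^bsub>R\<^esub> const d" if "a \<in> I" for a
      using subalgebra_divisible[OF IR(3)[OF that]] divides[OF that] by metis
    ultimately show thesis using that d uG by blast
  qed
qed

end

section \<open>Extending homomorphisms up to a non-zero-divisor\<close>

lemma module_restrict_scalars:
  assumes "module R M" and "B \<subseteq> carrier R" and "cring (R\<lparr>carrier := B\<rparr>)"
  shows "module (R\<lparr>carrier := B\<rparr>) M"
proof -
  interpret module R M by fact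
  show ?thesis
    using assms(2,3)
    by (intro moduleI abelian_group_axioms) (auto simp: smult_l_distr smult_r_distr smult_assoc1 subset_iff)
qed

lemma submodule_restrict_scalars:
  "submodule K R M \<Longrightarrow> B \<subseteq> carrier R \<Longrightarrow> submodule K (R\<lparr>carrier := B\<rparr>) M"
  by (auto simp: submodule_def submodule_axioms_def)

lemma module_homs_restrict_scalars:
  "f \<in> module_homs R M N \<Longrightarrow> B \<subseteq> carrier R \<Longrightarrow> f \<in> module_homs (R\<lparr>carrier := B\<rparr>) M N"
  by (auto simp: module_homs_def)

lemma non_zero_divisor_mult:
  assumes "cring R" and "non_zero_divisor R r" and "non_zero_divisor R s"
  shows "non_zero_divisor R (r \<otimes>\<^bsub>R\<^esub> s)"
proof -
  interpret cring R by fact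
  have rs: "r \<in> carrier R" "s \<in> carrier R" using assms by (simp_all add: non_zero_divisor_def)
  have "t = \<zero>\<^bsub>R\<^esub>" if t: "t \<in> carrier R" "(r \<otimes>\<^bsub>R\<^esub> s) \<otimes>\<^bsub>R\<^esub> t = \<zero>\<^bsub>R\<^esub>" for t
  proof -
    have "r \<otimes>\<^bsub>R\<^esub> (s \<otimes>\<^bsub>R\<^esub> t) = \<zero>\<^bsub>R\<^esub>" using rs t by (simp add: m_assoc)
    then have "s \<otimes>\<^bsub>R\<^esub> t = \<zero>\<^bsub>R\<^esub>" using assms(2) rs t(1) by (simp add: non_zero_divisor_def)
    then show ?thesis using assms(3) t(1) by (simp add: non_zero_divisor_def)
  qed
  then show ?thesis using rs by (simp add: non_zero_divisor_def)
qed

context zn_group_algebra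
begin

text \<open>
  The homomorphism is first extended linearly over \<open>subalgebra G\<close>. Then \<open>\<psi>\<close> is replaced by
  \<open>m \<mapsto> (\<nu> \<mapsto> coefficient of \<psi> (x\<^sup>-\<^sup>\<nu> m) at the unit)\<close>, which is linear over the whole group algebra,
  has finite support because \<open>G\<close> has finite index, and does not change linear maps.
\<close>

lemma extend_up_to_non_zero_divisor:
  fixes E :: "('l \<Rightarrow> int set, 'e) module"
  assumes fg\<Lambda>: "\<exists>S. finite S \<and> S \<subseteq> carrier \<Lambda> \<and> generate \<Lambda> S = carrier \<Lambda>"
    and E: "module R E" and fg: "finitely_generated_module R E" and L: "submodule L R E"
    and \<phi>: "\<phi> \<in> module_homs R (E\<lparr>carrier := L\<rparr>) reg"
  obtains u \<Psi> where "non_zero_divisor R u" and "\<Psi> \<in> module_homs R E reg"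
    and "\<And>l. l \<in> L \<Longrightarrow> \<Psi> l = u \<otimes>\<^bsub>R\<^esub> \<phi> l"
proof -
  interpret E: module R E by (rule E)
  obtain G T where U: "\<Lambda>.unique_product_subgroup G" and triv: "G = {\<one>} \<or> infinite G"
    and T: "finite T" "T \<subseteq> carrier \<Lambda>" and cover: "\<And>x. x \<in> carrier \<Lambda> \<Longrightarrow> \<exists>a\<in>G. \<exists>t\<in>T. x = a \<otimes> t"
    using fg\<Lambda> \<Lambda>.finite_index_unique_product_subgroup by metis
  have G: "subgroup G \<Lambda>" using U by (simp add: \<Lambda>.unique_product_subgroup_def)
  have GL: "x \<in> carrier \<Lambda>" if "x \<in> G" for x using that subgroup.subset[OF G] by blast
  let ?B = "subalgebra G" and ?R' = "R\<lparr>carrier := subalgebra G\<rparr>"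
  have BR: "?B \<subseteq> carrier R" by (auto simp: subalgebra_def)
  note R' = subalgebra_cring[OF G]
  note E' = module_restrict_scalars[OF E BR R'] and reg' = module_restrict_scalars[OF reg_module BR R']
  interpret E': module ?R' E by (rule E')
  \<comment> \<open>Elements of S are adjoined one at a time, and the non-zero-divisors picked up on
    the way multiply to \<open>u\<close>.\<close>
  have claim: "\<exists>K \<psi> u. submodule K ?R' E \<and> L \<subseteq> K \<and> S \<subseteq> K \<and> non_zero_divisor R u \<and>
      \<psi> \<in> module_homs ?R' (E\<lparr>carrier := K\<rparr>) reg \<and> (\<forall>l\<in>L. \<psi> l = u \<otimes>\<^bsub>R\<^esub> \<phi> l)"
    if "finite S" "S \<subseteq> carrier E" for S
    using that
  proof (induction rule: finite_induct)
    case empty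
    have "\<phi> l = \<one>\<^bsub>R\<^esub> \<otimes>\<^bsub>R\<^esub> \<phi> l" if "l \<in> L" for l
      using module_homs_closed[OF \<phi>, of l] that by (simp add: reg_simps)
    moreover have "non_zero_divisor R \<one>\<^bsub>R\<^esub>" by (simp add: non_zero_divisor_def)
    ultimately show ?case
      using submodule_restrict_scalars[OF L BR] module_homs_restrict_scalars[OF \<phi> BR]
      by (intro exI[of _ L] exI[of _ \<phi>] exI[of _ "\<one>\<^bsub>R\<^esub>"]) simp
  next
    case (insert x S)
    then obtain K \<psi> u where K: "submodule K ?R' E" and LK: "L \<subseteq> K" and SK: "S \<subseteq> K" and u: "non_zero_divisor R u"
      and \<psi>: "\<psi> \<in> module_homs ?R' (E\<lparr>carrier := K\<rparr>) reg" and \<psi>_eq: "\<forall>l\<in>L. \<psi> l = u \<otimes>\<^bsub>R\<^esub> \<phi> l"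
      by auto
    have x: "x \<in> carrier E" using insert by simp
    note K_smult = E'.submoduleE(4)[OF K, simplified] and K_add = E'.submoduleE(5)[OF K]
    note K_zero = E'.submodule_zero[OF K]
    \<comment> \<open>\<open>ideal_content\<close>, applied to this conductor, yields exactly the
      integer d and the factor that \<open>hom_extension_step\<close> asks for.\<close>
    define I where "I = {b \<in> ?B. b \<odot>\<^bsub>E\<^esub> x \<in> K}"
    obtain d v where d: "0 < d" "d dvd int n" and v: "v \<in> ?B" "non_zero_divisor R v"
      and dv: "const d \<otimes>\<^bsub>R\<^esub> v \<in> I" and Id: "\<And>b. b \<in> I \<Longrightarrow> \<exists>c\<in>?B. b = c \<otimes>\<^bsub>R\<^esub> const d"
    proof (rule ideal_content[OF U triv, of I])
      show "I \<subseteq> ?B" by (auto simp: I_def)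
      show "\<zero>\<^bsub>R\<^esub> \<in> I" using subalgebra_const[OF G, of 0] K_zero x by (simp add: I_def const_zero)
      show "a \<oplus>\<^bsub>R\<^esub> b \<in> I" if "a \<in> I" "b \<in> I" for a b
        using that x BR K_add by (auto simp: I_def subalgebra_add E.smult_l_distr subset_iff)
      show "r \<otimes>\<^bsub>R\<^esub> a \<in> I" if "r \<in> ?B" "a \<in> I" for r a
        using that x BR K_smult by (auto simp: I_def subalgebra_mult[OF G] E.smult_assoc1 subset_iff)
    qed blast
    obtain K' \<psi>' where K': "submodule K' ?R' E" "K \<subseteq> K'" "x \<in> K'"
      and \<psi>': "\<psi>' \<in> module_homs ?R' (E\<lparr>carrier := K'\<rparr>) reg"
      and \<psi>'_eq: "\<And>k. k \<in> K \<Longrightarrow> \<psi>' k = v \<odot>\<^bsub>reg\<^esub> \<psi> k"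
    proof (rule hom_extension_step[OF E' reg' K \<psi> x, of "const d" v])
      show "const d \<in> carrier ?R'" "v \<in> carrier ?R'" using subalgebra_const[OF G] v by simp_all
      show "(const d \<otimes>\<^bsub>?R'\<^esub> v) \<odot>\<^bsub>E\<^esub> x \<in> K" using dv by (simp add: I_def)
      show "\<exists>c\<in>carrier ?R'. b = c \<otimes>\<^bsub>?R'\<^esub> const d" if "b \<in> carrier ?R'" "b \<odot>\<^bsub>E\<^esub> x \<in> K" for b
        using that Id by (simp add: I_def)
      show "\<exists>z\<in>carrier reg. y = const d \<odot>\<^bsub>reg\<^esub> z"
        if y: "y \<in> carrier reg"
          and ann: "\<And>b. b \<in> carrier ?R' \<Longrightarrow> b \<otimes>\<^bsub>?R'\<^esub> const d = \<zero>\<^bsub>?R'\<^esub> \<Longrightarrow> b \<odot>\<^bsub>reg\<^esub> y = \<zero>\<^bsub>reg\<^esub>" for y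
      proof -
        have "const (int n div d) \<otimes>\<^bsub>R\<^esub> const d = \<zero>\<^bsub>R\<^esub>"
          using d const_n[of n] by (simp flip: const_mult)
        then show ?thesis
          using R_divisible_if_annihilated[OF d(1,2)] ann[of "const (int n div d)"] subalgebra_const[OF G] y
          by (simp add: reg_simps)
      qed
    qed blast
    have "\<psi>' l = (v \<otimes>\<^bsub>R\<^esub> u) \<otimes>\<^bsub>R\<^esub> \<phi> l" if "l \<in> L" for l
      using \<psi>'_eq[of l] \<psi>_eq that LK u v(2) module_homs_closed[OF \<phi>, of l]
      by (auto simp: reg_simps non_zero_divisor_def R.m_assoc)
    moreover have "non_zero_divisor R (v \<otimes>\<^bsub>R\<^esub> u)" by (rule non_zero_divisor_mult[OF R.is_cring v(2) u])
    ultimately show ?case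
      using K' LK SK \<psi>' by (intro exI[of _ K'] exI[of _ \<psi>'] exI[of _ "v \<otimes>\<^bsub>R\<^esub> u"]) auto
  qed
  obtain S where S: "finite S" "S \<subseteq> carrier E" and gen: "\<And>N. submodule N R E \<Longrightarrow> S \<subseteq> N \<Longrightarrow> N = carrier E"
    using fg unfolding finitely_generated_module_def by blast
  \<comment> \<open>Over the smaller algebra \<open>E\<close> is generated by the translates of the
    generators by coset representatives; finite index keeps them finite in number.\<close>
  let ?S = "(\<lambda>(t, s). mono t \<odot>\<^bsub>E\<^esub> s) ` (T \<times> S)"
  have "finite ?S" "?S \<subseteq> carrier E" using S T by (auto simp: subset_iff)
  from claim[OF this] obtain K \<psi> u where K: "submodule K ?R' E" and SK: "?S \<subseteq> K" and u: "non_zero_divisor R u"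
    and \<psi>: "\<psi> \<in> module_homs ?R' (E\<lparr>carrier := K\<rparr>) reg" and \<psi>_eq: "\<And>l. l \<in> L \<Longrightarrow> \<psi> l = u \<otimes>\<^bsub>R\<^esub> \<phi> l"
    by blast
  note K_smult = E'.submoduleE(4)[OF K, simplified] and K_add = E'.submoduleE(5)[OF K] and KE = E'.submoduleE(1)[OF K]
  note K_zero = E'.submodule_zero[OF K]
  \<comment> \<open>The part of \<open>K\<close> that stays in \<open>K\<close> under all of
    \<Lambda>. It is a submodule over \<open>R\<close>, so that the generators of \<open>E\<close>
    over \<open>R\<close> decide that it is everything.\<close>
  define N where "N = {m \<in> carrier E. \<forall>\<kappa>\<in>carrier \<Lambda>. mono \<kappa> \<odot>\<^bsub>E\<^esub> m \<in> K}"
  have "N = carrier E"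
  proof (rule gen)
    have N_zero: "\<zero>\<^bsub>E\<^esub> \<in> N" using K_zero by (simp add: N_def)
    have N_add: "a \<oplus>\<^bsub>E\<^esub> b \<in> N" if "a \<in> N" "b \<in> N" for a b
      using that K_add by (simp add: N_def E.smult_r_distr)
    have N_smult: "r \<odot>\<^bsub>E\<^esub> m \<in> N" if r: "r \<in> carrier R" and m: "m \<in> N" for r m
      using r
    proof (induction rule: R_induct_mono)
      case (mono \<mu>)
      then show ?case using m by (simp add: N_def mono_mult flip: E.smult_assoc1)
    next
      case (add r s)
      have "m \<in> carrier E" using m by (simp add: N_def)
      then show ?case using add N_add by (simp add: E.smult_l_distr)
    qed (use m N_zero in \<open>simp add: N_def\<close>)
    show "submodule N R E"
      by (rule E.submoduleI_smult[OF _ N_zero N_add N_smult]) (auto simp: N_def)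
    show "S \<subseteq> N"
    proof
      fix s assume s: "s \<in> S"
      have sE: "s \<in> carrier E" using s S by blast
      have "mono \<kappa> \<odot>\<^bsub>E\<^esub> s \<in> K" if \<kappa>: "\<kappa> \<in> carrier \<Lambda>" for \<kappa>
      proof -
        obtain a t where at: "a \<in> G" "t \<in> T" "\<kappa> = a \<otimes> t" using cover[OF \<kappa>] by blast
        have t: "t \<in> carrier \<Lambda>" using at T by blast
        have "mono \<kappa> \<odot>\<^bsub>E\<^esub> s = mono a \<odot>\<^bsub>E\<^esub> (mono t \<odot>\<^bsub>E\<^esub> s)"
          using GL[OF at(1)] t sE by (simp add: at(3) mono_mult[symmetric] E.smult_assoc1)
        moreover have "mono t \<odot>\<^bsub>E\<^esub> s \<in> K" using SK at(2) s by auto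
        ultimately show ?thesis using K_smult[OF subalgebra_mono[OF G at(1)]] by simp
      qed
      then show "s \<in> N" using sE by (simp add: N_def)
    qed
  qed
  then have KE_eq: "K = carrier E"
  proof -
    assume NE: "N = carrier E"
    have "m \<in> K" if "m \<in> carrier E" for m
    proof -
      have "mono \<one> \<odot>\<^bsub>E\<^esub> m \<in> K" using that NE unfolding N_def by blast
      then show ?thesis using that by (simp add: mono_one)
    qed
    then show ?thesis using KE by blast
  qed
  have \<psi>R: "\<psi> m \<in> carrier R" if "m \<in> carrier E" for m
    using module_homs_closed[OF \<psi>, of m] that by (simp add: KE_eq reg_simps)
  have \<psi>_add: "\<psi> (m \<oplus>\<^bsub>E\<^esub> m') = \<psi> m \<oplus>\<^bsub>R\<^esub> \<psi> m'" if "m \<in> carrier E" "m' \<in> carrier E" for m m'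
    using module_homs_add[OF \<psi>, of m m'] that by (simp add: KE_eq reg_simps)
  have \<psi>_mono: "\<psi> (mono a \<odot>\<^bsub>E\<^esub> m) = mono a \<otimes>\<^bsub>R\<^esub> \<psi> m" if "a \<in> G" "m \<in> carrier E" for a m
    using module_homs_smult[OF \<psi>, of "mono a" m] that subalgebra_mono[OF G] by (simp add: KE_eq reg_simps)
  define \<Psi> where "\<Psi> = (\<lambda>m \<nu>. if \<nu> \<in> carrier \<Lambda> then \<psi> (mono (inv \<nu>) \<odot>\<^bsub>E\<^esub> m) \<one> else \<zero>\<^bsub>Zn\<^esub>)"
  have \<Psi>R: "\<Psi> m \<in> carrier R" if m: "m \<in> carrier E" for m
  proof -
    let ?m = "\<lambda>t. \<psi> (mono (inv t) \<odot>\<^bsub>E\<^esub> m)"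
    \<comment> \<open>On the coset of t the values of \<open>\<Psi> m\<close> are the coefficients
      of the single element \<open>?m t\<close>. Finitely many cosets therefore give a finite
      support.\<close>
    let ?V = "\<Union>t\<in>T. (\<lambda>a. a \<otimes> t) ` support Zn (?m t)"
    have mt: "?m t \<in> carrier R" if "t \<in> T" for t using that T m by (intro \<psi>R) auto
    have val: "\<Psi> m (a \<otimes> t) = ?m t a" if "a \<in> G" "t \<in> T" for a t
    proof -
      have at: "a \<in> carrier \<Lambda>" "t \<in> carrier \<Lambda>" using that GL T by auto
      have "mono (inv (a \<otimes> t)) \<odot>\<^bsub>E\<^esub> m = mono (inv a) \<odot>\<^bsub>E\<^esub> (mono (inv t) \<odot>\<^bsub>E\<^esub> m)"
        using at m by (simp add: \<Lambda>.inv_mult mono_mult[symmetric] E.smult_assoc1)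
      then have "\<Psi> m (a \<otimes> t) = (mono (inv a) \<otimes>\<^bsub>R\<^esub> ?m t) \<one>"
        using at m \<psi>_mono[OF subgroup.m_inv_closed[OF G that(1)]] by (simp add: \<Psi>_def)
      also have "\<dots> = ?m t a"
        using mono_mult_coeff[OF mt[OF that(2)], of "inv a" "\<one>"] at by simp
      finally show ?thesis .
    qed
    have "\<Psi> m \<nu> = \<zero>\<^bsub>Zn\<^esub>" if \<nu>: "\<nu> \<notin> ?V" for \<nu>
    proof (cases "\<nu> \<in> carrier \<Lambda>")
      case True
      then obtain a t where at: "a \<in> G" "t \<in> T" "\<nu> = a \<otimes> t" using cover by blast
      then show ?thesis using \<nu> val[OF at(1,2)] by (auto simp: support_def)
    qed (simp add: \<Psi>_def)
    moreover have "\<Psi> m \<nu> \<in> carrier Zn" for \<nu>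
      using m R_coeff[OF \<psi>R, of "mono (inv \<nu>) \<odot>\<^bsub>E\<^esub> m" "\<one>"] by (simp add: \<Psi>_def)
    moreover have "finite ?V" using T(1) R_support(1)[OF mt] by blast
    moreover have "?V \<subseteq> carrier \<Lambda>" using R_support(2)[OF mt] T(2) by blast
    ultimately show ?thesis unfolding group_algebra_simps by (intro finsuppI[of _ _ ?V])
  qed
  have "\<Psi> \<in> module_homs R E reg"
  proof (rule module_homs_monoI[OF E reg_module])
    show "\<Psi> m \<in> carrier reg" if "m \<in> carrier E" for m using \<Psi>R[OF that] by (simp add: reg_simps)
    show "\<Psi> (m \<oplus>\<^bsub>E\<^esub> m') = \<Psi> m \<oplus>\<^bsub>reg\<^esub> \<Psi> m'" if "m \<in> carrier E" "m' \<in> carrier E" for m m'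
      using that by (auto simp: \<Psi>_def reg_simps group_algebra_simps(3) fun_eq_iff E.smult_r_distr \<psi>_add)
    show "\<Psi> (mono \<kappa> \<odot>\<^bsub>E\<^esub> m) = mono \<kappa> \<odot>\<^bsub>reg\<^esub> \<Psi> m" if \<kappa>: "\<kappa> \<in> carrier \<Lambda>" and m: "m \<in> carrier E" for \<kappa> m
    proof
      fix \<nu>
      show "\<Psi> (mono \<kappa> \<odot>\<^bsub>E\<^esub> m) \<nu> = (mono \<kappa> \<odot>\<^bsub>reg\<^esub> \<Psi> m) \<nu>"
      proof (cases "\<nu> \<in> carrier \<Lambda>")
        case True
        have "(mono \<kappa> \<otimes>\<^bsub>R\<^esub> \<Psi> m) \<nu> = \<psi> (mono (inv (inv \<kappa> \<otimes> \<nu>)) \<odot>\<^bsub>E\<^esub> m) \<one>"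
          using mono_mult_coeff[OF \<Psi>R[OF m] \<kappa> True] \<kappa> True by (simp add: \<Psi>_def)
        also have "mono (inv (inv \<kappa> \<otimes> \<nu>)) \<odot>\<^bsub>E\<^esub> m = mono (inv \<nu>) \<odot>\<^bsub>E\<^esub> (mono \<kappa> \<odot>\<^bsub>E\<^esub> m)"
          using \<kappa> True m by (simp add: \<Lambda>.inv_mult_group mono_mult flip: E.smult_assoc1)
        finally show ?thesis using True by (simp add: \<Psi>_def reg_simps)
      next
        case False
        have "mono \<kappa> \<otimes>\<^bsub>R\<^esub> \<Psi> m \<in> carrier R" using \<kappa> \<Psi>R[OF m] by simp
        then show ?thesis using False by (simp add: \<Psi>_def reg_simps R_coeff_outside)
      qed
    qed
  qed
  moreover have "\<Psi> l = u \<otimes>\<^bsub>R\<^esub> \<phi> l" if l: "l \<in> L" for l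
  proof
    fix \<nu>
    have lE: "l \<in> carrier E" using l E.submoduleE(1)[OF L] by blast
    have \<phi>l: "\<phi> l \<in> carrier R" using module_homs_closed[OF \<phi>, of l] l by (simp add: reg_simps)
    have uR: "u \<in> carrier R" using u by (simp add: non_zero_divisor_def)
    show "\<Psi> l \<nu> = (u \<otimes>\<^bsub>R\<^esub> \<phi> l) \<nu>"
    proof (cases "\<nu> \<in> carrier \<Lambda>")
      case True
      \<comment> \<open>On \<open>L\<close> the map \<psi> is u \<phi>, which is linear over all of
        \<open>R\<close>; the shift by the inverse of \<nu> can be pulled out, and the coefficient
        at the unit becomes the coefficient at \<nu>.\<close>
      have \<nu>l: "mono (inv \<nu>) \<odot>\<^bsub>E\<^esub> l \<in> L" using E.submoduleE(4)[OF L _ l] True by simp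
      have "\<psi> (mono (inv \<nu>) \<odot>\<^bsub>E\<^esub> l) = u \<otimes>\<^bsub>R\<^esub> (mono (inv \<nu>) \<otimes>\<^bsub>R\<^esub> \<phi> l)"
        using \<psi>_eq[OF \<nu>l] module_homs_smult[OF \<phi>, of "mono (inv \<nu>)" l] True l by (simp add: reg_simps)
      also have "\<dots> = mono (inv \<nu>) \<otimes>\<^bsub>R\<^esub> (u \<otimes>\<^bsub>R\<^esub> \<phi> l)"
        using True uR \<phi>l by (simp add: R.m_lcomm[of u])
      finally show ?thesis
        using mono_mult_coeff[of "u \<otimes>\<^bsub>R\<^esub> \<phi> l" "inv \<nu>" "\<one>"] True uR \<phi>l by (simp add: \<Psi>_def)
    next
      case False
      then show ?thesis using uR \<phi>l by (simp add: \<Psi>_def R_coeff_outside)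
    qed
  qed
  ultimately show thesis by (rule that[OF u])
qed

end

context zn_coefficient_module
begin

text \<open>For a submodule \<open>N\<close> containing the embedded generators, the p in
  \<open>P0\<close> with \<open>embed p\<close> in \<open>N\<close> form a submodule, hence all of
  \<open>P0\<close>. Translates of such elements add up to every element of
  \<open>PP\<close>.\<close>

lemma PP_finitely_generated:
  assumes "finitely_generated_module Zn P0"
  shows "finitely_generated_module R PP"
proof -
  interpret PP: module R PP by (rule PP_module)
  obtain S where S: "finite S" "S \<subseteq> carrier P0" and gen: "\<And>N. submodule N Zn P0 \<Longrightarrow> S \<subseteq> N \<Longrightarrow> N = carrier P0"
    using assms unfolding finitely_generated_module_def by blast
  have "N = carrier PP" if N: "submodule N R PP" and SN: "embed ` S \<subseteq> N" for N
  proof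
    note N_smult = PP.submoduleE(4)[OF N] and N_add = PP.submoduleE(5)[OF N]
    show "N \<subseteq> carrier PP" by (rule PP.submoduleE(1)[OF N])
    note N_zero = PP.submodule_zero[OF N]
    define N0 where "N0 = {p \<in> carrier P0. embed p \<in> N}"
    have scale: "a \<odot>\<^bsub>P0\<^esub> p \<in> N0" if "a \<in> carrier Zn" "p \<in> N0" for a p
    proof -
      have "single Zn \<one> a \<odot>\<^bsub>PP\<^esub> embed p = embed (a \<odot>\<^bsub>P0\<^esub> p)"
        using that X.smult_E_single_single[of a "\<one>" p "\<one>"]
        by (simp add: conj_module_simps Rg.antipode_single embed_def N0_def)
      moreover have "single Zn \<one> a \<odot>\<^bsub>PP\<^esub> embed p \<in> N"
        using that by (intro N_smult Rg.single_in_R) (simp_all add: N0_def)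
      ultimately show ?thesis using that by (simp add: N0_def)
    qed
    have "submodule N0 Zn P0"
    proof (rule P0.submoduleI_smult)
      show "N0 \<subseteq> carrier P0" by (auto simp: N0_def)
      show "\<zero>\<^bsub>P0\<^esub> \<in> N0" using N_zero by (simp add: N0_def embed_def single_def PP_zero)
      show "a \<oplus>\<^bsub>P0\<^esub> b \<in> N0" if "a \<in> N0" "b \<in> N0" for a b
      proof -
        have "embed (a \<oplus>\<^bsub>P0\<^esub> b) = embed a \<oplus>\<^bsub>PP\<^esub> embed b" by (auto simp: PP_add embed_def single_def)
        then show ?thesis using that N_add by (simp add: N0_def)
      qed
    qed (rule scale)
    moreover have "S \<subseteq> N0" using S SN by (auto simp: N0_def)
    ultimately have N0: "N0 = carrier P0" by (rule gen)
    show "carrier PP \<subseteq> N"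
    proof
      fix f assume "f \<in> carrier PP"
      then have "f \<in> finsupp (carrier \<Lambda>) P0" by (simp add: PP_carrier)
      then show "f \<in> N"
      proof (induction rule: P0.finsupp_induct)
        case zero
        then show ?case using N_zero by (simp add: PP_zero)
      next
        case (add g \<nu> p)
        have "mono (inv \<nu>) \<odot>\<^bsub>PP\<^esub> embed p = single P0 \<nu> p"
          using add X.smult_E_single_single[of "\<one>\<^bsub>Zn\<^esub>" \<nu> p "\<one>"]
          by (simp add: conj_module_simps mono_def Rg.antipode_single embed_def)
        moreover have "mono (inv \<nu>) \<odot>\<^bsub>PP\<^esub> embed p \<in> N"
          using add N0 by (intro N_smult) (auto simp: N0_def)
        ultimately have "g \<oplus>\<^bsub>PP\<^esub> single P0 \<nu> p \<in> N" using add N_add by simp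
        then show ?case by (simp add: PP_add)
      qed
    qed
  qed
  moreover have "embed ` S \<subseteq> carrier PP" using S embed_closed by blast
  ultimately show ?thesis
    unfolding finitely_generated_module_def using S(1) by (intro exI[of _ "embed ` S"]) auto
qed

end

section \<open>The torsion of the cokernel\<close>

theorem proposition24:
  fixes n :: nat
    and \<Lambda> :: "'l monoid"
    and P0 :: "(int set, 'p) module"
    and \<omega>0 :: "'p \<Rightarrow> 'p \<Rightarrow> int set"
    and L :: "('l \<Rightarrow> 'p) set"
    and F :: "('l \<Rightarrow> int set, 'f) module"
    and \<sigma> :: "'f \<Rightarrow> 'l \<Rightarrow> 'p"
  defines "A \<equiv> ZFact (int n)"
  defines "R \<equiv> group_algebra A \<Lambda>"
  defines "P \<equiv> extend_scalars A \<Lambda> P0"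
  defines "T \<equiv> torsion_submodule R
    (quotient_module (dual_module A \<Lambda> F) (dual_map F \<sigma> ` carrier (dual_module A \<Lambda> P)))"
  assumes "stabilizer_code n \<Lambda> P0 \<omega>0 L"
    and "module R F"
    and "quasi_free A \<Lambda> F"
    and "\<sigma> \<in> module_homs R F P"
    and "\<sigma> ` carrier F = L"
  shows "module_isomorphic R T (Q0_module n \<Lambda> P0 L)"
proof -
  interpret code: stabilizer_code n \<Lambda> P0 \<omega>0 L by fact
  interpret zn_coefficient_module \<Lambda> n P0
    by (intro zn_coefficient_module.intro zn_group_algebra.intro zn_group_algebra_axioms.intro
        code.comm_group code.n_pos code.module_P0)
  note [simp] = A_def R_def P_def
  have A: "cring A" and \<Lambda>: "comm_group \<Lambda>" by (simp_all add: ZFact_is_cring code.comm_group)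
  let ?C = "conj_module A \<Lambda> F" and ?PL = "PP\<lparr>carrier := L\<rparr>"
  have C: "module R ?C" using conj_module_is_module[OF A \<Lambda>] assms(6) by simp
  have PP: "module R PP" using PP_module by simp
  have reg: "module R reg" using reg_module by simp
  have L: "submodule L R PP" using conj_submodule[OF A \<Lambda>, of L] code.submodule_L by simp
  have PL: "module R ?PL" by (rule submodule.submodule_is_module[OF L PP])
  note cringR = module.axioms(1)[OF C]
  interpret PL: module R ?PL by (rule PL)
  interpret reg: module R reg by (rule reg)
  have \<sigma>PP: "\<sigma> \<in> module_homs R ?C PP" using conj_module_homs[OF A \<Lambda>, of \<sigma> F P] assms(8) by simp
  have \<sigma>L: "\<sigma> ` carrier ?C = L" using assms(9) by (simp add: conj_module_simps)
  have \<sigma>: "\<sigma> \<in> module_homs R ?C ?PL"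
    by (rule module_homs_restrict_codomain[OF \<sigma>PP]) (use \<sigma>L in blast)
  define D where "D = Hom_module R ?PL reg"
  define M where "M = Hom_module R ?C reg"
  define pull :: "(('l \<Rightarrow> 'p) \<Rightarrow> 'l \<Rightarrow> int set) \<Rightarrow> 'f \<Rightarrow> 'l \<Rightarrow> int set"
    where "pull = (\<lambda>\<phi>. compose (carrier ?C) \<phi> \<sigma>)"
  define H where "H = pull ` carrier (Hom_module R PP reg)"
  have T_eq: "T = torsion_submodule R (quotient_module M H)"
    by (simp add: T_def M_def H_def pull_def dual_module_def dual_map_def reg_def conj_module_simps)
  have D: "module R D" unfolding D_def by (rule Hom_module_is_module[OF PL reg])
  have M: "module R M" unfolding M_def by (rule Hom_module_is_module[OF C reg])
  interpret M: module R M by (rule M)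
  have pullPP: "pull \<in> module_homs R (Hom_module R PP reg) M"
    unfolding pull_def M_def by (rule Hom_module_precompose[OF C PP \<sigma>PP])
  have pull: "pull \<in> module_homs R D M"
    unfolding pull_def M_def D_def by (rule Hom_module_precompose[OF C PL \<sigma>])
  have H: "submodule H R M"
    unfolding H_def by (rule module_homs_image_submodule[OF Hom_module_is_module[OF PP reg] M pullPP])
  have pull_eq_iff: "pull \<phi> = pull \<Psi> \<longleftrightarrow> (\<forall>l\<in>L. \<Psi> l = \<phi> l)" for \<phi> \<Psi>
    by (auto simp: pull_def compose_def fun_eq_iff simp flip: \<sigma>L)
  \<comment> \<open>As \<sigma> is onto \<open>L\<close>, pullbacks agree exactly when the
    homomorphisms agree on \<open>L\<close>. The resulting criterion is the same as
    \<open>f_ker\<close> below, so the two maps out of \<open>D\<close> have the same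
    kernel.\<close>
  have pull_H: "pull \<phi> \<in> H \<longleftrightarrow> (\<exists>\<Psi>\<in>carrier (Hom_module R PP reg). \<forall>l\<in>L. \<Psi> l = \<phi> l)" for \<phi>
    unfolding H_def image_iff pull_eq_iff ..

  let ?Q = "quotient_module PP L"
  let ?Z = "Hom_module R (cover R (syzygy R ?Q)) reg\<lparr>carrier := Ext1_cocycles R ?Q reg\<rparr>"
  let ?B = "Ext1_boundaries R ?Q reg"
  obtain f where f: "f \<in> module_homs R D ?Z"
    and f_ker: "\<And>\<phi>. \<phi> \<in> carrier D \<Longrightarrow> f \<phi> \<in> ?B \<longleftrightarrow>
      (\<exists>\<Psi>\<in>carrier (Hom_module R PP reg). \<forall>l\<in>L. \<Psi> l = \<phi> l)"
    and f_surj: "\<And>c. c \<in> carrier ?Z \<Longrightarrow> \<exists>\<phi>\<in>carrier D.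
      c \<ominus>\<^bsub>?Z\<^esub> f \<phi> \<in> ?B"
    unfolding D_def
  proof (rule Ext1_quotient[OF PP L reg])
    fix \<theta> assume "\<theta> \<in> module_homs R (syzygy R PP) reg"
    then show "\<exists>h\<in>module_homs R (cover R PP) reg. \<forall>k\<in>carrier (syzygy R PP). h k = \<theta> k"
      using extend_from_kernel[OF code.finitely_generated_P0 cover_is_module[OF cringR, of PP, simplified]
          cover_map_hom[OF PP, simplified] cover_map_surj[OF PP, simplified]]
      by (simp add: syzygy_def)
  qed blast
  have Q: "module R ?Q" by (rule quotient_is_module[OF PP L])
  have Q0: "Q0_module n \<Lambda> P0 L = quotient_module ?Z ?B"
    using Ext1_eq_cocycles_mod_boundaries[OF Q reg]
    by (simp add: Q0_module_def Let_def conj_quotient_module reg_def)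
  have Z: "module R ?Z"
    by (intro submodule.submodule_is_module[OF Ext1_cocycles_submodule[OF Q reg]] Hom_module_is_module
        cover_is_module reg cringR)

  define T0 where "T0 = {m \<in> carrier (quotient_module M H). \<exists>r. non_zero_divisor R r \<and>
    r \<odot>\<^bsub>quotient_module M H\<^esub> m = \<zero>\<^bsub>quotient_module M H\<^esub>}"
  have "T0 = (\<lambda>\<phi>. H +>\<^bsub>M\<^esub> pull \<phi>) ` carrier D"
  proof
    show "(\<lambda>\<phi>. H +>\<^bsub>M\<^esub> pull \<phi>) ` carrier D \<subseteq> T0"
    proof
      fix m assume "m \<in> (\<lambda>\<phi>. H +>\<^bsub>M\<^esub> pull \<phi>) ` carrier D"
      then obtain \<phi> where \<phi>: "\<phi> \<in> carrier D" "m = H +>\<^bsub>M\<^esub> pull \<phi>" by blast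
      have \<phi>h: "\<phi> \<in> module_homs R ?PL reg" using \<phi>(1) by (simp add: D_def Hom_module_simps)
      \<comment> \<open>The multiple u \<phi> extends to all of \<open>PP\<close>, so its pullback
        lies in \<open>H\<close> and \<open>u\<close> annihilates the class of \<phi>.\<close>
      obtain u \<Psi> where u: "non_zero_divisor R u" and \<Psi>: "\<Psi> \<in> module_homs R PP reg"
        and \<Psi>L: "\<And>l. l \<in> L \<Longrightarrow> \<Psi> l = u \<otimes>\<^bsub>R\<^esub> \<phi> l"
        using extend_up_to_non_zero_divisor[OF code.finitely_generated_group PP[simplified]
            PP_finitely_generated[OF code.finitely_generated_P0] L[simplified] \<phi>h[simplified]] by auto
      have uR: "u \<in> carrier R" using u by (simp only: non_zero_divisor_def)
      have p\<phi>: "pull \<phi> \<in> carrier M" by (rule module_homs_closed[OF pull \<phi>(1)])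
      have LP: "L \<subseteq> carrier PP" by (rule module.submoduleE(1)[OF PP L])
      have "pull (u \<odot>\<^bsub>D\<^esub> \<phi>) \<in> H"
        unfolding pull_H
      proof (rule bexI[OF _ restrict_module_homs[OF PP \<Psi>]], rule ballI)
        fix l assume "l \<in> L"
        then show "restrict \<Psi> (carrier PP) l = (u \<odot>\<^bsub>D\<^esub> \<phi>) l"
          using \<Psi>L[of l] LP by (simp only: D_def Hom_module_simps reg_simps) auto
      qed
      then have "u \<odot>\<^bsub>M\<^esub> pull \<phi> \<in> H" using module_homs_smult[OF pull uR \<phi>(1)] by simp
      then have "u \<odot>\<^bsub>quotient_module M H\<^esub> m = \<zero>\<^bsub>quotient_module M H\<^esub>"
        unfolding \<phi>(2) quotient_smult[OF M H uR p\<phi>] quotient_module_simps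
        using quotient_proj_zero_iff[OF M H] uR p\<phi> by simp
      moreover have "m \<in> carrier (quotient_module M H)"
        using p\<phi> \<phi>(2) by (simp add: quotient_module_simps)
      ultimately show "m \<in> T0" using u unfolding T0_def by blast
    qed
    show "T0 \<subseteq> (\<lambda>\<phi>. H +>\<^bsub>M\<^esub> pull \<phi>) ` carrier D"
    proof
      fix m assume "m \<in> T0"
      then obtain \<psi> r where \<psi>: "\<psi> \<in> carrier M" "m = H +>\<^bsub>M\<^esub> \<psi>" and r: "non_zero_divisor R r"
        and rm: "r \<odot>\<^bsub>quotient_module M H\<^esub> m = H"
        by (auto simp: T0_def quotient_module_simps)
      have rR: "r \<in> carrier R" using r by (simp only: non_zero_divisor_def)
      have "H +>\<^bsub>M\<^esub> (r \<odot>\<^bsub>M\<^esub> \<psi>) = H" using rm quotient_smult[OF M H rR \<psi>(1)] \<psi>(2) by simp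
      then have "r \<odot>\<^bsub>M\<^esub> \<psi> \<in> H" using quotient_proj_zero_iff[OF M H] rR \<psi>(1) by simp
      then obtain \<Psi> where \<Psi>: "\<Psi> \<in> carrier (Hom_module R PP reg)" "r \<odot>\<^bsub>M\<^esub> \<psi> = pull \<Psi>"
        unfolding H_def by blast
      have \<psi>h: "\<psi> \<in> module_homs R ?C reg" and \<Psi>h: "\<Psi> \<in> module_homs R PP reg"
        using \<psi>(1) \<Psi>(1) by (simp_all add: M_def Hom_module_simps)
      \<comment> \<open>On the kernel of \<sigma> the multiple r \<psi> takes the value of \<Psi> at
        0, and a non-zero-divisor r can be cancelled in \<open>R\<close>. So \<psi> vanishes there
        and descends to \<open>L\<close>.\<close>
      have ker: "\<psi> x = \<zero>\<^bsub>reg\<^esub>" if x: "x \<in> carrier ?C" "\<sigma> x = \<zero>\<^bsub>?PL\<^esub>" for x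
      proof -
        have "r \<odot>\<^bsub>reg\<^esub> \<psi> x = (r \<odot>\<^bsub>M\<^esub> \<psi>) x" using x(1) by (simp only: M_def Hom_module_simps) simp
        also have "\<dots> = \<Psi> \<zero>\<^bsub>PP\<^esub>" unfolding \<Psi>(2) using x by (simp add: pull_def compose_def)
        also have "\<dots> = \<zero>\<^bsub>reg\<^esub>" by (rule module_homs_zero_minus(1)[OF PP reg \<Psi>h])
        finally show ?thesis
          using r module_homs_closed[OF \<psi>h x(1)] unfolding non_zero_divisor_def by (simp add: reg_simps)
      qed
      have "\<sigma> ` carrier ?C = carrier ?PL" using \<sigma>L by simp
      from module_homs_factor[OF C PL reg \<sigma> this \<psi>h ker]
      obtain \<phi> where \<phi>: "\<phi> \<in> carrier D" "\<And>x. x \<in> carrier ?C \<Longrightarrow> \<phi> (\<sigma> x) = \<psi> x" unfolding D_def by blast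
      have "\<psi> = pull \<phi>"
      proof (rule Hom_module_eqI)
        show "\<psi> \<in> carrier (Hom_module R ?C reg)" using \<psi>(1) by (simp only: M_def)
        show "pull \<phi> \<in> carrier (Hom_module R ?C reg)" using module_homs_closed[OF pull \<phi>(1)] by (simp only: M_def)
      qed (simp add: pull_def compose_def \<phi>(2))
      then show "m \<in> (\<lambda>\<phi>. H +>\<^bsub>M\<^esub> pull \<phi>) ` carrier D" using \<psi>(2) \<phi>(1) by blast
    qed
  qed
  then show ?thesis
    unfolding Q0 T_eq torsion_submodule_def T0_def[symmetric]
    using f_ker pull_H f_surj
    by (intro quotient_modules_isomorphic[OF D M Z H Ext1_boundaries_submodule[OF Q reg] pull f]) auto
qed

end
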